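(* Let $d\ge 2$ be an integer, let $S:\Sigma_d^{dual}\to \mathrm{Simp}_{2d-2}$ be a function, and let $\rho_S$ be the associated metric on $\Sigma_d^{dual}$. Fix $0<\epsilon\le 1$. The following are equivalent: 1. There exists a $C^{1+\epsilon}$ embedding of $\Sigma_d$ with scaling function $S$. 2. $S$ is $C^{\epsilon}$ on $(\Sigma_d^{dual},\rho_S)$, i.e. there is a constant $K$ with $|S(j)-S(j')|\le K\,\rho_S(j,j')^{\epsilon}$ for all $j,j'\in\Sigma_d^{dual}$ (for $\epsilon=1$ this means Lipschitz).
   Context: Embeddings. $\Sigma_d=\{1,\dots,d\}^{\mathbb N}$ with the product topology, and the shift $\sigma(\alpha_1\alpha_2\dots)=(\alpha_2\alpha_3\dots)$, with right-inverses $\sigma_i^{-1}(\alpha_1\alpha_2\dots)=(i\alpha_1\alpha_2\dots)$, $i=1,\dots,d$. An embedding is a topological embedding $h:\Sigma_d\to\mathbb R$ that respects the order: for $\alpha\ne\beta$, $h(\alpha)>h(\beta)$ iff $\alpha_m>\beta_m$, where $m$ is the first index with $\alpha_m\ne\beta_m$. It is always assumed that the convex hull of $h(\Sigma_d)$ is $[0,1]$. Let $f=h\circ\sigma\circ h^{-1}$ be the induced shift map on $h(\Sigma_d)$ and $f_i^{-1}=h\circ\sigma_i^{-1}\circ h^{-1}$ its right-inverses. For $r>1$, $h$ is called $C^r$ if each $f_i^{-1}$ extends to a $C^r$ contraction of $\mathbb R$ (Lipschitz constant $<1$) which is a diffeomorphism onto its image, i.e. an inverse branch of an orientation preserving smooth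 expanding map. For an integer $k\ge1$ and $0<\epsilon\le1$, $C^{k+\epsilon}$ means $C^k$ with $k$-th derivative locally $\epsilon$-Hölder; $\epsilon=1$ means locally Lipschitz $k$-th derivative. Scaling function. For a finite string $j_1\dots j_n$ in $\{1,\dots,d\}$ put $I_{j_1\dots j_n}=h(\{\alpha:\alpha_1=j_n,\alpha_2=j_{n-1},\dots,\alpha_n=j_1\})$ (note the reversed order), and let $|J|$ denote the length of the convex hull of a set $J\subset\mathbb R$. Then $I_{j_0j_1\dots j_n}\subset I_{j_1\dots j_n}$ for $j_0=1,\dots,d$, and the convex hulls of these $d$ subsets are disjoint intervals separated by $d-1$ gaps. Let $\mathrm{Simp}_{2d-2}$ be the set of vectors in $(0,1)^{2d-1}$ whose coordinates sum to $1$. Define $S(j_1\dots j_n)\in \mathrm{Simp}_{2d-2}$ as follows: for $j_0=1,\dots,d$ its $j_0$-th coordinate is $S(j_1\dots j_n)_{j_0}=|I_{j_0j_1\dots j_n}|/|I_{j_1\dots j_n}|$, and its last $d-1$ coordinates are the lengths of the $d-1$ gaps (from left to right) divided by $|I_{j_1\dots j_n}|$. The dual Cantor set $\Sigma_d^{dual}$ is the set of infinite sequences $j=(j_1j_2\dots)$ with entries in $\{1,\dots,d\}$. The embedding $h$ has scaling function $S:\Sigma_d^{dual}\to \mathrm{Simp}_{2d-2}$ if $S(j)=\lim_{n\to\infty}S(j_1\dots j_n)$ for every $j\in\Sigma_d^{dual}$ (the limit exists for every $C^{1+\epsilon}$ embedding). Metric. For $j\neq j'$ in $\Sigma_d^{dual}$,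 let $j\cap j'$ be their longest common initial string and $\sharp(j\cap j')$ its length. Given a function $S:\Sigma_d^{dual}\to \mathrm{Simp}_{2d-2}$, define, for $j\ne j'$ and $n=\sharp(j\cap j')$, $$\rho_S(j,j')=\sup_{w\in\Sigma_d^{dual}}\ \prod_{t=1}^{n} S(j_{t+1}j_{t+2}\dots j_n w)_{j_t},$$ where $j_{t+1}\dots j_nw$ denotes concatenation (equal to $w$ when $t=n$) and the empty product is $1$; put $\rho_S(j,j)=0$.
   Formalization: Item 2 additionally requires S to be continuous for the product topology on the dual Cantor set; for arbitrary S the Hölder estimate with respect to ρ_S alone does not imply item 1, since ρ_S need not tend to 0 as the common initial string grows. *)

theory Defs
  imports "HOL-Analysis.Analysis" "HOL-Library.Omega_Words_Fun"
begin

(* Conventions: infinite sequences are words nat => nat indexed from 0, so the informal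
   entry alpha_m is "\<alpha> (m - 1)"; letters range over {1..d}; a finite string j_1 ... j_n is a
   list with head j_1. *)

section \<open>Sequence space\<close>

definition words :: "nat \<Rightarrow> nat word set" where
  "words d = {\<alpha>. \<forall>n. \<alpha> n \<in> {1..d}}"

definition words_top :: "nat \<Rightarrow> nat word topology" where
  "words_top d = product_topology (\<lambda>_. discrete_topology {1..d}) UNIV"

lemma topspace_words_top [simp]: "topspace (words_top d) = words d"
  by (auto simp: words_top_def words_def)

(* Counting from 0, the first index of disagreement of two distinct words is also the length
   of their longest common initial string. *)
definition first_diff :: "nat word \<Rightarrow> nat word \<Rightarrow> nat" where
  "first_diff \<alpha> \<beta> = (LEAST m. \<alpha> m \<noteq> \<beta> m)"

section \<open>Embeddings and their smoothness\<close>

definition cantor_embedding :: "nat \<Rightarrow> (nat word \<Rightarrow> real) \<Rightarrow> bool" where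
  "cantor_embedding d h \<longleftrightarrow>
     embedding_map (words_top d) euclideanreal h \<and>
     (\<forall>\<alpha>\<in>words d. \<forall>\<beta>\<in>words d. \<alpha> \<noteq> \<beta> \<longrightarrow>
        (h \<alpha> > h \<beta> \<longleftrightarrow> \<alpha> (first_diff \<alpha> \<beta>) > \<beta> (first_diff \<alpha> \<beta>))) \<and>
     convex hull (h ` words d) = {0..1}"

definition shift_branch :: "nat \<Rightarrow> (nat word \<Rightarrow> real) \<Rightarrow> nat \<Rightarrow> real \<Rightarrow> real" where
  "shift_branch d h i = h \<circ> (\<lambda>\<alpha>. i ## \<alpha>) \<circ> inv_into (words d) h"

definition locally_holder_on :: "real \<Rightarrow> real set \<Rightarrow> (real \<Rightarrow> real) \<Rightarrow> bool" where
  "locally_holder_on \<epsilon> U g \<longleftrightarrow>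
     (\<forall>x\<in>U. \<exists>r>0. \<exists>K. \<forall>y\<in>ball x r \<inter> U. \<forall>z\<in>ball x r \<inter> U. \<bar>g y - g z\<bar> \<le> K * \<bar>y - z\<bar> powr \<epsilon>)"

(* C^(k+eps) on an open set U. Continuity of the k-th derivative is part of the Hoelder
   condition. *)
definition C_smooth_on :: "nat \<Rightarrow> real \<Rightarrow> real set \<Rightarrow> (real \<Rightarrow> real) \<Rightarrow> bool" where
  "C_smooth_on k \<epsilon> U F \<longleftrightarrow>
     (\<forall>m<k. \<forall>x\<in>U. (deriv ^^ m) F field_differentiable (at x)) \<and>
     locally_holder_on \<epsilon> U ((deriv ^^ k) F)"

(* The range of an injective continuous F is open, so C_smooth_on applies to the inverse. *)
definition C_diffeo_onto_image :: "nat \<Rightarrow> real \<Rightarrow> (real \<Rightarrow> real) \<Rightarrow> bool" where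
  "C_diffeo_onto_image k \<epsilon> F \<longleftrightarrow>
     C_smooth_on k \<epsilon> UNIV F \<and> inj F \<and> C_smooth_on k \<epsilon> (range F) (inv F)"

definition C_embedding :: "nat \<Rightarrow> real \<Rightarrow> nat \<Rightarrow> (nat word \<Rightarrow> real) \<Rightarrow> bool" where
  "C_embedding k \<epsilon> d h \<longleftrightarrow>
     cantor_embedding d h \<and>
     (\<forall>i\<in>{1..d}. \<exists>F.
        (\<forall>x\<in>h ` words d. F x = shift_branch d h i x) \<and>
        (\<exists>L<1. L-lipschitz_on UNIV F) \<and>
        C_diffeo_onto_image k \<epsilon> F)"

section \<open>Scaling functions\<close>

definition cyl :: "nat \<Rightarrow> (nat word \<Rightarrow> real) \<Rightarrow> nat list \<Rightarrow> real set" where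
  "cyl d h js = h ` {\<alpha> \<in> words d. prefix (length js) \<alpha> = rev js}"

definition hull_length :: "real set \<Rightarrow> real" where
  "hull_length J = measure lborel (convex hull J)"

(* The i-th gap, counted from the left: it lies between the hulls of the pieces i and i + 1. *)
definition gap :: "nat \<Rightarrow> (nat word \<Rightarrow> real) \<Rightarrow> nat list \<Rightarrow> nat \<Rightarrow> real set" where
  "gap d h js i = {Sup (cyl d h (i # js)) <..< Inf (cyl d h (Suc i # js))}"

(* Vectors with 2d-1 coordinates, indexed by {1..2*d-1}: coordinates 1, ..., d belong to the
   pieces and d+1, ..., 2d-1 to the gaps. *)
definition Simp :: "nat \<Rightarrow> (nat \<Rightarrow> real) set" where
  "Simp d = {v \<in> {1..2*d-1} \<rightarrow>\<^sub>E {0<..<1}. (\<Sum>k=1..2*d-1. v k) = 1}"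

definition finite_scaling :: "nat \<Rightarrow> (nat word \<Rightarrow> real) \<Rightarrow> nat list \<Rightarrow> nat \<Rightarrow> real" where
  "finite_scaling d h js k =
     (if k \<le> d then hull_length (cyl d h (k # js)) else hull_length (gap d h js (k - d)))
       / hull_length (cyl d h js)"

definition has_scaling_function ::
    "nat \<Rightarrow> (nat word \<Rightarrow> real) \<Rightarrow> (nat word \<Rightarrow> nat \<Rightarrow> real) \<Rightarrow> bool" where
  "has_scaling_function d h S \<longleftrightarrow>
     (\<forall>j\<in>words d. \<forall>k\<in>{1..2*d-1}. (\<lambda>n. finite_scaling d h (prefix n j) k) \<longlonglongrightarrow> S j k)"

definition rho :: "nat \<Rightarrow> (nat word \<Rightarrow> nat \<Rightarrow> real) \<Rightarrow> nat word \<Rightarrow> nat word \<Rightarrow> real" where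
  "rho d S j j' =
     (if j = j' then 0
      else let n = first_diff j j' in
        SUP w\<in>words d. \<Prod>t<n. S (j [Suc t \<rightarrow> n] \<frown> w) (j t))"

definition vec_dist :: "nat \<Rightarrow> (nat \<Rightarrow> real) \<Rightarrow> (nat \<Rightarrow> real) \<Rightarrow> real" where
  "vec_dist d u v = L2_set (\<lambda>k. u k - v k) {1..2*d-1}"

(* Continuity for the product topology on the dual Cantor set. This has to be required
   separately from a Hoelder estimate with respect to rho: for an arbitrary S the distances
   rho d S j j' need not tend to 0 as the common initial string of j and j' grows. *)
definition continuous_scaling :: "nat \<Rightarrow> (nat word \<Rightarrow> nat \<Rightarrow> real) \<Rightarrow> bool" where
  "continuous_scaling d S \<longleftrightarrow>
     (\<forall>k\<in>{1..2*d-1}. continuous_map (words_top d) euclideanreal (\<lambda>j. S j k))"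

end

(* An embedding gives a Hoelder scaling function by bounded distortion: the logarithm of the
   derivative of each branch is Hoelder, so log S changes by O(|I|^eps) when a letter is appended to
   the string of the cylinder I; summing these changes, rho is comparable with the lengths of
   cylinders.

   Conversely, given S, cylinders are assigned the lengths l0(j_1 ... j_n) = prod_t S(j_{t+1} ... j_n w)_{j_t}
   for a fixed tail w; the Hoelder condition makes them independent of w up to a bounded factor.
   The branches of the resulting Cantor set need not be contractions, so l0 is replaced by an
   adapted length, the average sum_{m<N} lambda^(-m) sum_{|v|=m} l0(j v), which has the same scaling
   function and shrinks by lambda under every branch.  The branches then satisfy the
   Whitney C^(1+eps) condition on the Cantor set, and are extended to the line by interpolating over
   each gap with a derivative that stays inside (0,1). *)

theory Submission
  imports Defs
begin

section \<open>Extension of Hoelder jets from a compact set to the line\<close>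

text \<open>Everything rests on a duality: with reversed strings, refining a cylinder conses a
  letter, while applying a branch appends one. One and the same logarithmic difference measures how
  a branch changes a scaling vector and how refinement changes the mean slope of the branch, so
  regularity of \<open>S\<close> and of the branches are two readings of one estimate. Continuity on
  the compact dual Cantor set bounds all coordinates of \<open>S\<close> below by some c > 0, hence
  the decay rate \<theta> = 1 - c. This a priori decay makes the Hoelder condition summable along
  strings and yields the distortion constant \<open>E\<close>. That constant is also the obstacle:
  l0 of an image under many branches is bounded by \<open>E\<close> times a geometric factor, so
  contraction is visible only after many iterates. Averaging over N levels repairs this, as for the
  adapted metrics of hyperbolic dynamics. It keeps the scaling function because the averaged ratios
  are weighted means of values of \<open>S\<close> at words with a common prefix. Gaps carry adapted
  lengths too, since the mean slope across each gap must lie inside (0,1) before it can be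
  interpolated.\<close>

definition jet_close :: "real \<Rightarrow> real \<Rightarrow> (real \<Rightarrow> real) \<Rightarrow> (real \<Rightarrow> real) \<Rightarrow> real \<Rightarrow> real \<Rightarrow> bool" where
  "jet_close \<epsilon> C F G x y \<longleftrightarrow>
     \<bar>G y - G x\<bar> \<le> C * (y - x) powr \<epsilon> \<and> \<bar>F y - F x - G x * (y - x)\<bar> \<le> C * (y - x) powr (1 + \<epsilon>)"

lemma powr_one_plus: "t \<ge> 0 \<Longrightarrow> t powr (1 + \<epsilon>) = t * t powr \<epsilon>" for t :: real
  by (cases "t = 0") (auto simp: powr_add)

lemma jet_close_refl: "jet_close \<epsilon> C F G x x"
  by (simp add: jet_close_def)

lemma jet_close_mono: "jet_close \<epsilon> C F G x y \<Longrightarrow> C \<le> D \<Longrightarrow> jet_close \<epsilon> D F G x y"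
  unfolding jet_close_def by (meson mult_right_mono order_trans powr_ge_zero)

text \<open>The pair (F, G) stands for a function and its candidate derivative, expanded at the left
  point. The remainder from \<open>x\<close> to \<open>z\<close> is the sum of the two remainders
  and of \<open>(G y - G x) * (z - y)\<close>; this cross term is the second \<open>C\<close> in the
  constant.\<close>

lemma jet_close_trans:
  assumes xy: "jet_close \<epsilon> C F G x y" and yz: "jet_close \<epsilon> D F G y z"
    and "x \<le> y" "y \<le> z" "0 \<le> C" "0 \<le> D" "0 < \<epsilon>"
  shows "jet_close \<epsilon> (2 * C + D) F G x z"
proof -
  define t where "t = z - x"
  have p: "(y - x) powr \<epsilon> \<le> t powr \<epsilon>" "(z - y) powr \<epsilon> \<le> t powr \<epsilon>"
    "(y - x) powr (1 + \<epsilon>) \<le> t powr (1 + \<epsilon>)" "(z - y) powr (1 + \<epsilon>) \<le> t powr (1 + \<epsilon>)"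
    unfolding t_def using assms by (auto intro!: powr_mono2)
  have c: "C * (y - x) powr \<epsilon> \<le> C * t powr \<epsilon>" "D * (z - y) powr \<epsilon> \<le> D * t powr \<epsilon>"
    "C * (y - x) powr (1 + \<epsilon>) \<le> C * t powr (1 + \<epsilon>)"
    "D * (z - y) powr (1 + \<epsilon>) \<le> D * t powr (1 + \<epsilon>)"
    using p assms by (auto intro: mult_left_mono)
  have a: "\<bar>G y - G x\<bar> \<le> C * t powr \<epsilon>" "\<bar>G z - G y\<bar> \<le> D * t powr \<epsilon>"
    "\<bar>F y - F x - G x * (y - x)\<bar> \<le> C * t powr (1 + \<epsilon>)"
    "\<bar>F z - F y - G y * (z - y)\<bar> \<le> D * t powr (1 + \<epsilon>)"
    using xy yz c unfolding jet_close_def by linarith+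
  have "\<bar>(G y - G x) * (z - y)\<bar> = \<bar>G y - G x\<bar> * (z - y)"
    using assms by (simp add: abs_mult)
  also have "\<dots> \<le> (C * t powr \<epsilon>) * t"
    using a(1) assms by (intro mult_mono) (auto simp: t_def)
  also have "\<dots> = C * t powr (1 + \<epsilon>)"
    using assms by (simp add: t_def powr_one_plus)
  finally have e: "\<bar>(G y - G x) * (z - y)\<bar> \<le> C * t powr (1 + \<epsilon>)" .
  have "F z - F x - G x * (z - x) = (F z - F y - G y * (z - y)) + (F y - F x - G x * (y - x))
      + (G y - G x) * (z - y)"
    by (simp add: algebra_simps)
  then have "\<bar>F z - F x - G x * (z - x)\<bar> \<le> (2 * C + D) * t powr (1 + \<epsilon>)"
    using e a(3,4) by (simp add: distrib_right)
  moreover have "\<bar>G z - G x\<bar> \<le> (C + D) * t powr \<epsilon>"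
    using a(1,2) by (simp add: distrib_right)
  moreover have "(C + D) * t powr \<epsilon> \<le> (2 * C + D) * t powr \<epsilon>"
    using \<open>0 \<le> C\<close> by (intro mult_right_mono) auto
  ultimately show ?thesis
    by (simp add: jet_close_def t_def)
qed

text \<open>A Lipschitz bound on [0, 1] is stronger than a Hoelder bound, because distances are at
  most 1 and \<epsilon> \<le> 1.\<close>

lemma power_diff_le_powr:
  fixes s t :: real
  assumes "0 \<le> s" "s \<le> 1" "0 \<le> t" "t \<le> 1" "\<epsilon> \<le> 1"
  shows "\<bar>s ^ n - t ^ n\<bar> \<le> n * \<bar>s - t\<bar> powr \<epsilon>"
proof -
  have "\<bar>s ^ n - t ^ n\<bar> \<le> n * \<bar>s - t\<bar>"
    using norm_power_diff[of s t n] assms by simp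
  also have "\<bar>s - t\<bar> \<le> \<bar>s - t\<bar> powr \<epsilon>"
    using powr_mono'[of \<epsilon> 1 "\<bar>s - t\<bar>"] assms by (cases "s = t") auto
  finally show ?thesis by (simp add: mult_left_mono)
qed

text \<open>The derivative is \<open>y + (p - y)(1 - s)^n + (q - y)s^n\<close> in the affine coordinate \<open>s\<close> of the gap,
  a convex combination of \<open>p\<close>, \<open>q\<close> and \<open>y\<close>; matching the increment forces \<open>y\<close>, which tends to the
  mean slope \<open>m\<close> as \<open>n\<close> grows.\<close>

lemma gap_interpolation:
  fixes a b u v m p q c l C \<epsilon> :: real and N :: nat
  assumes slope: "v - u = m * (b - a)" and "a < b" "0 < \<epsilon>" "\<epsilon> \<le> 1" "0 < c" "l < 1"
    and range: "p \<in> {c..l}" "q \<in> {c..l}" "m \<in> {c..l}"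
    and close: "\<bar>p - m\<bar> \<le> C * (b - a) powr \<epsilon>" "\<bar>q - m\<bar> \<le> C * (b - a) powr \<epsilon>"
    and N: "N > 0" "2 / N \<le> c / 2" "2 / N \<le> (1 - l) / 2"
  shows "\<exists>P Q. P a = u \<and> P b = v \<and> Q a = p \<and> Q b = q \<and>
     (\<forall>x\<in>{a..b}. (P has_real_derivative Q x) (at x) \<and> c / 2 \<le> Q x \<and> Q x \<le> (1 + l) / 2) \<and>
     (\<forall>x\<in>{a..b}. \<forall>y\<in>{a..b}. \<bar>Q y - Q x\<bar> \<le> 6 * C * Suc N * \<bar>y - x\<bar> powr \<epsilon>)"
proof -
  define L where "L = b - a"
  \<comment> \<open>Solves y + ((p - y) + (q - y)) / (N + 2) = m: the mean of \<open>Q\<close> over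
    the gap must be \<open>m\<close>, and a power with exponent N + 1 has mean 1 / (N + 2).
    \<open>P\<close> is the explicit antiderivative of \<open>Q\<close>.\<close>
  define y where "y = m + (2 * m - p - q) / N"
  define s where "s x = (x - a) / L" for x
  define P where "P x = u + L * (y * s x + (p - y) * (1 - (1 - s x) ^ (N + 2)) / (N + 2)
     + (q - y) * s x ^ (N + 2) / (N + 2))" for x
  define Q where "Q x = y + (p - y) * (1 - s x) ^ Suc N + (q - y) * s x ^ Suc N" for x
  have L: "L > 0" using assms by (simp add: L_def)
  have C: "0 \<le> C * L powr \<epsilon>" using close by (simp add: L_def)
  have sab: "s a = 0" "s b = 1" using L by (auto simp: s_def L_def)
  have s01: "0 \<le> s x \<and> s x \<le> 1" if "x \<in> {a..b}" for x
    using that L by (auto simp: s_def L_def divide_simps)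
  \<comment> \<open>Two bounds on y - m: this scale-free one keeps \<open>y\<close> in the
    admissible range; the next, proportional to \<open>L powr \<epsilon>\<close>, makes the Hoelder
    constant of \<open>Q\<close> independent of the gap length.\<close>
  have "\<bar>2 * m - p - q\<bar> \<le> 2" using range assms by auto
  then have ym: "\<bar>y - m\<bar> \<le> 2 / N"
    using N by (simp add: y_def abs_divide divide_right_mono)
  have "\<bar>2 * m - p - q\<bar> \<le> 2 * (C * L powr \<epsilon>)" using close by (simp add: L_def)
  then have "\<bar>y - m\<bar> \<le> 2 * (C * L powr \<epsilon>) / N"
    using N by (simp add: y_def abs_divide divide_right_mono)
  also have "\<dots> \<le> 2 * (C * L powr \<epsilon>)"
    using C N by (simp add: divide_le_eq mult_le_cancel_left1)
  finally have yp: "\<bar>p - y\<bar> \<le> 3 * (C * L powr \<epsilon>)" "\<bar>q - y\<bar> \<le> 3 * (C * L powr \<epsilon>)"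
    using close by (auto simp: L_def)
  have Pab: "P a = u" "Q a = p" "Q b = q"
    by (auto simp: P_def Q_def sab)
  have "(N + 2) * (P b - u) = L * (real (N + 2) * y + (p - y) + (q - y))"
  proof -
    have "k * (L * (y + \<alpha> / k + \<beta> / k)) = L * (k * y + \<alpha> + \<beta>)" if "k > 0" for k \<alpha> \<beta>
      using that by (simp add: field_simps)
    from this[of "real (N + 2)" "p - y" "q - y"] show ?thesis by (simp add: P_def sab)
  qed
  also have "real (N + 2) * y + (p - y) + (q - y) = (N + 2) * m"
    using N by (simp add: y_def field_simps)
  also have "L * ((N + 2) * m) = (N + 2) * (v - u)"
    unfolding slope L_def by (simp only: mult_ac)
  finally have Pb: "P b = v" by simp
  have ds: "(s has_real_derivative 1 / L) (at x)" for x
    unfolding s_def using L by (auto intro!: derivative_eq_intros)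
  have dP: "(P has_real_derivative Q x) (at x)" for x
    unfolding P_def
    apply (rule derivative_eq_intros ds refl | simp)+
    using L apply (simp add: Q_def field_simps)
    done
  have bnd: "c / 2 \<le> Q x \<and> Q x \<le> (1 + l) / 2" if x: "x \<in> {a..b}" for x
  proof -
    \<comment> \<open>The exponents are at least 1, so A + B \<le> (1 - s x) + s x = 1 and
      \<open>Q x\<close> is a convex combination of \<open>y\<close>, \<open>p\<close> and
      \<open>q\<close>.\<close>
    define A B where "A = (1 - s x) ^ Suc N" and "B = s x ^ Suc N"
    have "A \<le> 1 - s x" "B \<le> s x" "0 \<le> A" "0 \<le> B"
      using power_decreasing[of 1 "Suc N" "1 - s x"] power_decreasing[of 1 "Suc N" "s x"] s01[OF x]
      by (auto simp: A_def B_def)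
    then have AB: "0 \<le> 1 - A - B" by simp
    have Q: "Q x = y * (1 - A - B) + p * A + q * B"
      by (simp add: Q_def A_def B_def algebra_simps)
    have yr: "c / 2 \<le> y" "y \<le> (1 + l) / 2" "p \<le> (1 + l) / 2" "q \<le> (1 + l) / 2" "c / 2 \<le> p" "c / 2 \<le> q"
      using ym N range assms by auto
    have "(c / 2) * (1 - A - B) + (c / 2) * A + (c / 2) * B \<le> Q x" unfolding Q
      using yr AB \<open>0 \<le> A\<close> \<open>0 \<le> B\<close> by (intro add_mono mult_right_mono) auto
    moreover have "Q x \<le> ((1 + l) / 2) * (1 - A - B) + ((1 + l) / 2) * A + ((1 + l) / 2) * B" unfolding Q
      using yr AB \<open>0 \<le> A\<close> \<open>0 \<le> B\<close> by (intro add_mono mult_right_mono) auto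
    moreover have "k * (1 - A - B) + k * A + k * B = k" for k by (simp add: algebra_simps)
    ultimately show ?thesis by (simp only:)
  qed
  have hol: "\<bar>Q x' - Q x\<bar> \<le> 6 * C * Suc N * \<bar>x' - x\<bar> powr \<epsilon>" if x: "x \<in> {a..b}" "x' \<in> {a..b}" for x x'
  proof -
    define D where "D = \<bar>s x' - s x\<bar> powr \<epsilon>"
    have 1: "\<bar>(1 - s x') ^ Suc N - (1 - s x) ^ Suc N\<bar> \<le> Suc N * D"
      using power_diff_le_powr[of "1 - s x'" "1 - s x" \<epsilon> "Suc N"] s01[OF x(1)] s01[OF x(2)] assms
      by (simp add: D_def abs_minus_commute)
    have 2: "\<bar>s x' ^ Suc N - s x ^ Suc N\<bar> \<le> Suc N * D"
      using power_diff_le_powr[of "s x'" "s x" \<epsilon> "Suc N"] s01[OF x(1)] s01[OF x(2)] assms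
      by (simp add: D_def)
    have "Q x' - Q x = (p - y) * ((1 - s x') ^ Suc N - (1 - s x) ^ Suc N) + (q - y) * (s x' ^ Suc N - s x ^ Suc N)"
      by (simp add: Q_def algebra_simps)
    also have "\<bar>\<dots>\<bar> \<le> \<bar>p - y\<bar> * \<bar>(1 - s x') ^ Suc N - (1 - s x) ^ Suc N\<bar> + \<bar>q - y\<bar> * \<bar>s x' ^ Suc N - s x ^ Suc N\<bar>"
      by (metis abs_mult abs_triangle_ineq)
    also have "\<dots> \<le> 3 * (C * L powr \<epsilon>) * (Suc N * D) + 3 * (C * L powr \<epsilon>) * (Suc N * D)"
      using yp 1 2 C by (intro add_mono mult_mono) auto
    also have "\<dots> = 6 * C * Suc N * (L powr \<epsilon> * D)" by (simp add: algebra_simps)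
    also have "L powr \<epsilon> * D = \<bar>x' - x\<bar> powr \<epsilon>"
    proof -
      have "s x' - s x = (x' - x) / L" by (simp add: s_def diff_divide_distrib)
      then show ?thesis using L by (simp add: D_def powr_mult[symmetric] abs_divide)
    qed
    finally show ?thesis .
  qed
  show ?thesis
    by (rule exI[of _ P], rule exI[of _ Q]) (use Pab Pb dP bnd hol in auto)
qed

lemma jet_close_of_holder_derivative:
  assumes der: "\<And>z. z \<in> {a..b} \<Longrightarrow> (P has_real_derivative Q z) (at z)"
    and hol: "\<And>z. z \<in> {a..b} \<Longrightarrow> \<bar>Q z - Q x\<bar> \<le> C * \<bar>z - x\<bar> powr \<epsilon>"
    and "a \<le> x" "x \<le> y" "y \<le> b" "0 < \<epsilon>" "0 \<le> C"
  shows "jet_close \<epsilon> C P Q x y"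
proof (cases "x = y")
  case False
  then have "x < y" using assms by simp
  then obtain z where z: "x < z" "z < y" "P y - P x = (y - x) * Q z"
    using MVT2[of x y P Q] der assms by auto
  have "P y - P x - Q x * (y - x) = (Q z - Q x) * (y - x)"
    using z by (simp add: algebra_simps)
  also have "\<bar>\<dots>\<bar> = \<bar>Q z - Q x\<bar> * (y - x)" using \<open>x < y\<close> by (simp add: abs_mult)
  also have "\<dots> \<le> (C * \<bar>z - x\<bar> powr \<epsilon>) * (y - x)"
    using hol[of z] z assms by (intro mult_right_mono) auto
  also have "\<dots> \<le> (C * (y - x) powr \<epsilon>) * (y - x)"
    using z assms by (intro mult_right_mono mult_left_mono powr_mono2) auto
  finally show ?thesis
    using hol[of y] assms by (simp add: jet_close_def powr_one_plus mult_ac)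
qed (simp add: jet_close_refl)

text \<open>In dimension one only the gaps of \<open>K\<close> have to be filled, each independently
  of the others, and the interpolants share one Hoelder constant. The slopes across gaps are a
  hypothesis of their own because the jet estimate does not confine the mean slope of a long gap to
  [c, l].\<close>

lemma whitney_extension_interval:
  fixes K :: "real set" and \<phi> g :: "real \<Rightarrow> real"
  assumes K: "closed K" "a0 \<in> K" "b0 \<in> K" "K \<subseteq> {a0..b0}" and \<epsilon>: "0 < \<epsilon>" "\<epsilon> \<le> 1"
    and "0 < c" "l < 1" "0 \<le> C"
    and jet: "\<And>x y. x \<in> K \<Longrightarrow> y \<in> K \<Longrightarrow> x \<le> y \<Longrightarrow> jet_close \<epsilon> C \<phi> g x y"
    and g: "\<And>x. x \<in> K \<Longrightarrow> g x \<in> {c..l}"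
    and gap: "\<And>a b. a \<in> K \<Longrightarrow> b \<in> K \<Longrightarrow> a < b \<Longrightarrow> {a<..<b} \<inter> K = {} \<Longrightarrow>
        c * (b - a) \<le> \<phi> b - \<phi> a \<and> \<phi> b - \<phi> a \<le> l * (b - a)"
  shows "\<exists>F G D. 0 \<le> D \<and> (\<forall>x\<in>K. F x = \<phi> x) \<and>
     (\<forall>x\<in>{a0..b0}. \<forall>y\<in>{a0..b0}. x \<le> y \<longrightarrow> jet_close \<epsilon> D F G x y) \<and>
     (\<forall>x\<in>{a0..b0}. c / 2 \<le> G x \<and> G x \<le> (1 + l) / 2)"
proof -
  \<comment> \<open>Beyond 4 / c and 4 / (1 - l), the deviation 2 / N from the mean slope is small
    against both ends of the range.\<close>
  obtain N0 :: nat where N0: "max (4 / c) (4 / (1 - l)) < N0" using reals_Archimedean2 by blast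
  define N where "N = Suc N0"
  have N: "N > 0" "2 / N \<le> c / 2" "2 / N \<le> (1 - l) / 2"
  proof -
    have "4 / c < N" "4 / (1 - l) < N" using N0 by (auto simp: N_def)
    then show "2 / N \<le> c / 2" "2 / N \<le> (1 - l) / 2"
      using \<open>0 < c\<close> \<open>l < 1\<close> by (auto simp: field_simps N_def)
  qed (simp add: N_def)
  define isgap where "isgap a b \<longleftrightarrow> a \<in> K \<and> b \<in> K \<and> a < b \<and> {a<..<b} \<inter> K = {}" for a b
  \<comment> \<open>The constant of \<open>gap_interpolation\<close> for \<open>2 * C\<close>: in
    units of \<open>(b - a) powr \<epsilon>\<close>, \<open>g a\<close> is within \<open>C\<close>
    of the mean slope by the Taylor estimate, and \<open>g b\<close> within \<open>2 * C\<close> by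
    the Hoelder bound on \<open>g\<close>.\<close>
  define D where "D = 6 * (2 * C) * Suc N"
  have D: "0 \<le> D" using \<open>0 \<le> C\<close> by (simp add: D_def)
  define good where "good a b P Q \<longleftrightarrow> P a = \<phi> a \<and> P b = \<phi> b \<and> Q a = g a \<and> Q b = g b \<and>
     (\<forall>x\<in>{a..b}. (P has_real_derivative Q x) (at x) \<and> c / 2 \<le> Q x \<and> Q x \<le> (1 + l) / 2) \<and>
     (\<forall>x\<in>{a..b}. \<forall>y\<in>{a..b}. \<bar>Q y - Q x\<bar> \<le> D * \<bar>y - x\<bar> powr \<epsilon>)" for a b P Q
  have "\<exists>P Q. good a b P Q" if ab: "isgap a b" for a b
  proof -
    define m where "m = (\<phi> b - \<phi> a) / (b - a)"
    have L: "a < b" "a \<in> K" "b \<in> K" using ab by (auto simp: isgap_def)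
    have m: "\<phi> b - \<phi> a = m * (b - a)" using L by (simp add: m_def)
    have "c * (b - a) \<le> m * (b - a)" "m * (b - a) \<le> l * (b - a)"
      using gap[of a b] ab unfolding isgap_def m by auto
    then have mr: "m \<in> {c..l}" using L by simp
    have j: "\<bar>g b - g a\<bar> \<le> C * (b - a) powr \<epsilon>" "\<bar>\<phi> b - \<phi> a - g a * (b - a)\<bar> \<le> C * (b - a) powr (1 + \<epsilon>)"
      using jet[of a b] L by (auto simp: jet_close_def)
    have "\<bar>m - g a\<bar> * (b - a) = \<bar>\<phi> b - \<phi> a - g a * (b - a)\<bar>"
      unfolding m left_diff_distrib[symmetric] abs_mult using L by simp
    also have "\<dots> \<le> (C * (b - a) powr \<epsilon>) * (b - a)" using j(2) L by (simp add: powr_one_plus mult_ac)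
    finally have *: "\<bar>m - g a\<bar> \<le> C * (b - a) powr \<epsilon>" using L by simp
    have "\<bar>g a - m\<bar> \<le> (2 * C) * (b - a) powr \<epsilon>" "\<bar>g b - m\<bar> \<le> (2 * C) * (b - a) powr \<epsilon>"
      using * j(1) by auto
    from gap_interpolation[OF m L(1) \<epsilon> \<open>0 < c\<close> \<open>l < 1\<close> g[OF L(2)] g[OF L(3)] mr this N]
    show ?thesis unfolding good_def D_def .
  qed
  then obtain P Q where PQ: "\<And>a b. isgap a b \<Longrightarrow> good a b (P a b) (Q a b)" by metis
  define A where "A x = Sup (K \<inter> {..x})" for x
  define B where "B x = Inf (K \<inter> {x..})" for x
  have A: "A x \<in> K" "A x \<le> x" "\<And>z. z \<in> K \<Longrightarrow> z \<le> x \<Longrightarrow> z \<le> A x" if "x \<in> {a0..b0}" for x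
  proof -
    have bdd: "bdd_above (K \<inter> {..x})" by (auto intro: bdd_aboveI[of _ x])
    have "a0 \<in> K \<inter> {..x}" using that K by auto
    then have "A x \<in> K \<inter> {..x}" unfolding A_def
      using K bdd by (intro closed_contains_Sup closed_Int) auto
    then show "A x \<in> K" "A x \<le> x" by auto
    show "z \<le> A x" if "z \<in> K" "z \<le> x" for z
      unfolding A_def using that bdd by (intro cSup_upper) auto
  qed
  have B: "B x \<in> K" "x \<le> B x" "\<And>z. z \<in> K \<Longrightarrow> x \<le> z \<Longrightarrow> B x \<le> z" if "x \<in> {a0..b0}" for x
  proof -
    have bdd: "bdd_below (K \<inter> {x..})" by (auto intro: bdd_belowI[of _ x])
    have "b0 \<in> K \<inter> {x..}" using that K by auto
    then have "B x \<in> K \<inter> {x..}" unfolding B_def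
      using K bdd by (intro closed_contains_Inf closed_Int) auto
    then show "B x \<in> K" "x \<le> B x" by auto
    show "B x \<le> z" if "z \<in> K" "x \<le> z" for z
      unfolding B_def using that bdd by (intro cInf_lower) auto
  qed
  have AB: "isgap (A x) (B x)" if "x \<in> {a0..b0}" "x \<notin> K" for x
  proof -
    have "A x < x" "x < B x" using A[OF that(1)] B[OF that(1)] that(2) by (auto simp: order.order_iff_strict)
    moreover have "z \<notin> K" if "A x < z" "z < B x" for z
      using A(3)[of x z] B(3)[of x z] that \<open>x \<in> {a0..b0}\<close> by (meson leD linear)
    ultimately show ?thesis using A[OF that(1)] B[OF that(1)] by (auto simp: isgap_def)
  qed
  have ABeq: "A x = a \<and> B x = b" if "isgap a b" "a < x" "x < b" for x a b
  proof -
    have x: "x \<in> {a0..b0}" using that K by (auto simp: isgap_def)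
    have "a \<le> A x" "B x \<le> b" using A(3)[OF x, of a] B(3)[OF x, of b] that by (auto simp: isgap_def)
    moreover have "A x \<notin> {a<..<b}" "B x \<notin> {a<..<b}"
      using A(1)[OF x] B(1)[OF x] that(1) by (auto simp: isgap_def)
    moreover have "A x < b" "a < B x" using A(2)[OF x] B(2)[OF x] that by auto
    ultimately show ?thesis by auto
  qed
  define F where "F x = (if x \<in> K then \<phi> x else P (A x) (B x) x)" for x
  define G where "G x = (if x \<in> K then g x else Q (A x) (B x) x)" for x
  have FG: "F x = P a b x \<and> G x = Q a b x" if "isgap a b" "x \<in> {a..b}" for a b x
  proof (cases "x \<in> K")
    case True
    then have "x = a \<or> x = b" using that by (force simp: isgap_def)
    then show ?thesis using PQ[OF that(1)] True by (auto simp: F_def G_def good_def)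
  next
    case False
    then have "a < x" "x < b" using that by (auto simp: isgap_def order.order_iff_strict)
    then show ?thesis using ABeq[OF that(1)] False by (simp add: F_def G_def)
  qed
  have gapjet: "jet_close \<epsilon> D F G x y" if ab: "isgap a b" and xy: "a \<le> x" "x \<le> y" "y \<le> b" for a b x y
  proof -
    have "jet_close \<epsilon> D (P a b) (Q a b) x y"
      using PQ[OF ab] xy D \<epsilon> by (intro jet_close_of_holder_derivative[of a b]) (auto simp: good_def)
    then show ?thesis using FG[OF ab, of x] FG[OF ab, of y] xy by (simp add: jet_close_def)
  qed
  have CD: "C \<le> D"
  proof -
    have "C * 1 \<le> C * (12 * Suc N)" using \<open>0 \<le> C\<close> by (intro mult_left_mono) auto
    then show ?thesis by (simp add: D_def algebra_simps)
  qed
  \<comment> \<open>The constant comes from the chain x, B x, A y, y, which crosses a gap,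
    \<open>K\<close> and a gap: three estimates with constant D and two uses of
    \<open>jet_close_trans\<close>.\<close>
  have all: "jet_close \<epsilon> (2 * (2 * D + D) + D) F G x y" if xy: "x \<in> {a0..b0}" "y \<in> {a0..b0}" "x \<le> y" for x y
  proof (cases "{x..y} \<inter> K = {}")
    case True
    then have nK: "x \<notin> K" "y \<notin> K" using xy by auto
    have "\<not> B x \<le> y" using True B[OF xy(1)] by auto
    then have "jet_close \<epsilon> D F G x y"
      using gapjet[OF AB[OF xy(1) nK(1)]] A[OF xy(1)] xy by auto
    then show ?thesis by (rule jet_close_mono) (use D in auto)
  next
    case False
    then obtain z where z: "z \<in> K" "x \<le> z" "z \<le> y" by auto
    have BA: "B x \<le> z" "z \<le> A y" using B(3)[OF xy(1)] A(3)[OF xy(2)] z by auto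
    have 1: "jet_close \<epsilon> D F G x (B x)"
    proof (cases "x \<in> K")
      case True
      then have "B x = x" using B(2,3)[OF xy(1)] by (meson order_antisym order_refl)
      then show ?thesis by (simp add: jet_close_refl)
    next
      case False
      then show ?thesis using gapjet[OF AB[OF xy(1)]] A[OF xy(1)] B[OF xy(1)] by auto
    qed
    have 2: "jet_close \<epsilon> D F G (A y) y"
    proof (cases "y \<in> K")
      case True
      then have "A y = y" using A(2,3)[OF xy(2)] by (meson order_antisym order_refl)
      then show ?thesis by (simp add: jet_close_refl)
    next
      case False
      then show ?thesis using gapjet[OF AB[OF xy(2)]] A[OF xy(2)] B[OF xy(2)] by auto
    qed
    have "jet_close \<epsilon> D F G (B x) (A y)"
      using jet[of "B x" "A y"] A(1)[OF xy(2)] B(1)[OF xy(1)] BA jet_close_mono[OF _ CD, of \<epsilon> F G "B x" "A y"]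
      by (simp add: jet_close_def F_def G_def)
    from jet_close_trans[OF 1 this] have "jet_close \<epsilon> (2 * D + D) F G x (A y)"
      using B(2)[OF xy(1)] BA D \<epsilon> by auto
    from jet_close_trans[OF this 2] show ?thesis
      using B(2)[OF xy(1)] A(2)[OF xy(2)] BA D \<epsilon> by auto
  qed
  have rg: "c / 2 \<le> G x \<and> G x \<le> (1 + l) / 2" if x: "x \<in> {a0..b0}" for x
  proof (cases "x \<in> K")
    case True
    then show ?thesis using g[OF True] \<open>0 < c\<close> \<open>l < 1\<close> by (simp add: G_def)
  next
    case False
    then show ?thesis
      using PQ[OF AB[OF x False]] A(2)[OF x] B(2)[OF x] by (simp add: G_def good_def)
  qed
  show ?thesis
    by (rule exI[of _ F], rule exI[of _ G], rule exI[of _ "2 * (2 * D + D) + D"])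
      (use all rg D in \<open>auto simp: F_def\<close>)
qed

text \<open>Continuation by tangent lines: \<open>r\<close> clamps to [a, b], so the derivative
  \<open>G \<circ> r\<close> is constant on either side and takes no new values.\<close>

lemma whitney_extension_line:
  fixes F G :: "real \<Rightarrow> real"
  assumes "a \<le> b" "0 < \<epsilon>" "0 \<le> C"
    and jet: "\<And>x y. x \<in> {a..b} \<Longrightarrow> y \<in> {a..b} \<Longrightarrow> x \<le> y \<Longrightarrow> jet_close \<epsilon> C F G x y"
  defines "r \<equiv> \<lambda>x. max a (min b x)"
  shows "x \<le> y \<Longrightarrow> jet_close \<epsilon> (2 * C) (\<lambda>x. F (r x) + G (r x) * (x - r x)) (G \<circ> r) x y"
proof -
  assume xy: "x \<le> y"
  have r: "r x \<in> {a..b}" "r y \<in> {a..b}" "r x \<le> r y" "r y - r x \<le> y - x"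
    using \<open>a \<le> b\<close> xy by (auto simp: r_def)
  have j: "\<bar>G (r y) - G (r x)\<bar> \<le> C * (r y - r x) powr \<epsilon>"
    "\<bar>F (r y) - F (r x) - G (r x) * (r y - r x)\<bar> \<le> C * (r y - r x) powr (1 + \<epsilon>)"
    using jet[OF r(1-3)] by (auto simp: jet_close_def)
  have p: "C * (r y - r x) powr \<epsilon> \<le> C * (y - x) powr \<epsilon>"
    "C * (r y - r x) powr (1 + \<epsilon>) \<le> C * (y - x) powr (1 + \<epsilon>)"
    using r assms by (auto intro!: mult_left_mono powr_mono2)
  \<comment> \<open>If y lies in [a, b], then r y = y. If y > b, either x \<ge> b and the clamped
    points coincide, or b separates x from y. If y < a, they coincide again.\<close>
  have d: "G (r y) = G (r x) \<or> \<bar>y - r y\<bar> \<le> y - x" using xy \<open>a \<le> b\<close> by (auto simp: r_def max_def min_def)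
  have "\<bar>(G (r y) - G (r x)) * (y - r y)\<bar> \<le> (C * (y - x) powr \<epsilon>) * (y - x)"
    using d
  proof
    assume "\<bar>y - r y\<bar> \<le> y - x"
    then show ?thesis unfolding abs_mult using j(1) p(1) by (intro mult_mono) auto
  qed (use assms xy in auto)
  also have "\<dots> = C * (y - x) powr (1 + \<epsilon>)" using xy by (simp add: powr_one_plus)
  finally have e: "\<bar>(G (r y) - G (r x)) * (y - r y)\<bar> \<le> C * (y - x) powr (1 + \<epsilon>)" .
  have "F (r y) + G (r y) * (y - r y) - (F (r x) + G (r x) * (x - r x)) - G (r x) * (y - x) =
    (F (r y) - F (r x) - G (r x) * (r y - r x)) + (G (r y) - G (r x)) * (y - r y)"
    by (simp add: algebra_simps)
  then have "\<bar>F (r y) + G (r y) * (y - r y) - (F (r x) + G (r x) * (x - r x)) - G (r x) * (y - x)\<bar>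
    \<le> 2 * C * (y - x) powr (1 + \<epsilon>)" using e j(2) p(2) by linarith
  moreover have "\<bar>G (r y) - G (r x)\<bar> \<le> 2 * C * (y - x) powr \<epsilon>"
  proof -
    have "0 \<le> C * (y - x) powr \<epsilon>" using \<open>0 \<le> C\<close> by simp
    then show ?thesis using j(1) p(1) by linarith
  qed
  ultimately show ?thesis by (simp add: jet_close_def)
qed

section \<open>From jets on the line to diffeomorphisms\<close>

lemma jet_close_imp_derivative:
  fixes F G :: "real \<Rightarrow> real"
  assumes "0 < \<epsilon>" "0 \<le> C" and jet: "\<And>x y. x \<le> y \<Longrightarrow> jet_close \<epsilon> C F G x y"
  shows "(F has_real_derivative G x) (at x)"
proof -
  \<comment> \<open>The hypothesis expands at the left point only; expanding at the right point
    costs the term \<open>(G x - G y) * (x - y)\<close>, hence the factor 2.\<close>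
  have est: "\<bar>F y - F x - G x * (y - x)\<bar> \<le> 2 * C * \<bar>y - x\<bar> powr (1 + \<epsilon>)" for x y
  proof (cases "x \<le> y")
    case True
    moreover have "0 \<le> C * (y - x) powr (1 + \<epsilon>)" using \<open>0 \<le> C\<close> by simp
    ultimately show ?thesis using jet[OF True] by (simp add: jet_close_def)
  next
    case False
    then have yx: "y \<le> x" by simp
    have j: "\<bar>G x - G y\<bar> \<le> C * (x - y) powr \<epsilon>" "\<bar>F x - F y - G y * (x - y)\<bar> \<le> C * (x - y) powr (1 + \<epsilon>)"
      using jet[OF yx] by (auto simp: jet_close_def)
    have "\<bar>(G x - G y) * (x - y)\<bar> \<le> (C * (x - y) powr \<epsilon>) * (x - y)"
      unfolding abs_mult using j(1) yx by (intro mult_mono) auto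
    also have "\<dots> = C * (x - y) powr (1 + \<epsilon>)" using yx by (simp add: powr_one_plus)
    finally have "\<bar>(G x - G y) * (x - y)\<bar> \<le> C * (x - y) powr (1 + \<epsilon>)" .
    moreover have "F y - F x - G x * (y - x) = (G x - G y) * (x - y) - (F x - F y - G y * (x - y))"
      by (simp add: algebra_simps)
    ultimately show ?thesis using j(2) yx by simp
  qed
  have "((\<lambda>y. (F y - F x) / (y - x) - G x) \<longlongrightarrow> 0) (at x)"
  proof (rule Lim_null_comparison)
    show "\<forall>\<^sub>F y in at x. norm ((F y - F x) / (y - x) - G x) \<le> 2 * C * \<bar>y - x\<bar> powr \<epsilon>"
      unfolding eventually_at_filter
    proof (intro always_eventually allI impI)
      fix y assume "y \<noteq> x"
      then have "(F y - F x) / (y - x) - G x = (F y - F x - G x * (y - x)) / (y - x)"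
        by (simp add: field_simps)
      then have "norm ((F y - F x) / (y - x) - G x) = \<bar>F y - F x - G x * (y - x)\<bar> / \<bar>y - x\<bar>"
        by (simp add: abs_divide)
      also have "\<dots> \<le> 2 * C * \<bar>y - x\<bar> powr (1 + \<epsilon>) / \<bar>y - x\<bar>"
        by (intro divide_right_mono est) auto
      also have "\<dots> = 2 * C * \<bar>y - x\<bar> powr \<epsilon>" using \<open>y \<noteq> x\<close> by (simp add: powr_one_plus)
      finally show "norm ((F y - F x) / (y - x) - G x) \<le> 2 * C * \<bar>y - x\<bar> powr \<epsilon>" .
    qed
    have "((\<lambda>y. 2 * C * \<bar>y - x\<bar> powr \<epsilon>) \<longlongrightarrow> 2 * C * \<bar>x - x\<bar> powr \<epsilon>) (at x)"
      using \<open>0 < \<epsilon>\<close> by (intro tendsto_intros tendsto_powr') auto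
    then show "((\<lambda>y. 2 * C * \<bar>y - x\<bar> powr \<epsilon>) \<longlongrightarrow> 0) (at x)" by simp
  qed
  then show ?thesis by (simp add: has_field_derivative_iff LIM_zero_iff)
qed

text \<open>By the mean value theorem \<open>F\<close> scales distances by factors between c and l.
  Hence it is onto, its inverse is Lipschitz with constant 1 / c, and the derivative of the inverse,
  1 / G along the inverse, inherits the Hoelder condition.\<close>

lemma C_diffeo_of_jet_close:
  fixes F G :: "real \<Rightarrow> real"
  assumes "0 < \<epsilon>" "0 \<le> C" and jet: "\<And>x y. x \<le> y \<Longrightarrow> jet_close \<epsilon> C F G x y"
    and "0 < c" "l < 1" and G: "\<And>x. c \<le> G x" "\<And>x. G x \<le> l"
  shows "l-lipschitz_on UNIV F" "C_diffeo_onto_image 1 \<epsilon> F"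
proof -
  have der: "(F has_real_derivative G x) (at x)" for x
    using jet_close_imp_derivative assms(1,2) jet .
  then have dF: "deriv F = G" by (auto intro: DERIV_imp_deriv)
  have mvt: "c * (y - x) \<le> F y - F x \<and> F y - F x \<le> l * (y - x)" if xy: "x \<le> y" for x y
  proof (cases "x = y")
    case False
    then obtain z where "F y - F x = (y - x) * G z" using MVT2[of x y F G] der xy by auto
    then show ?thesis using G[of z] xy by (simp add: mult.commute mult_right_mono)
  qed simp
  have lower: "c * \<bar>y - x\<bar> \<le> \<bar>F y - F x\<bar>" for x y
    using mvt[of x y] mvt[of y x] by (cases "x \<le> y") auto
  have l: "0 < l" using G[of 0] \<open>0 < c\<close> by simp
  show "l-lipschitz_on UNIV F"
  proof (rule lipschitz_onI)
    fix x y
    show "dist (F x) (F y) \<le> l * dist x y"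
    proof (cases "x \<le> y")
      case True
      then have "0 \<le> c * (y - x)" using \<open>0 < c\<close> by simp
      then show ?thesis using mvt[OF True] True by (simp add: dist_real_def)
    next
      case False
      then have "0 \<le> c * (x - y)" using \<open>0 < c\<close> by simp
      then show ?thesis using mvt[of y x] False by (simp add: dist_real_def)
    qed
  qed (use l in simp)
  have holG: "\<bar>G y - G x\<bar> \<le> C * \<bar>y - x\<bar> powr \<epsilon>" for x y
    using jet[of x y] jet[of y x] by (cases "x \<le> y") (auto simp: jet_close_def abs_minus_commute)
  have inj: "inj F"
  proof (rule injI)
    fix x y assume "F x = F y"
    then show "x = y" using lower[of x y] \<open>0 < c\<close> by (simp add: mult_le_0_iff)
  qed
  have "\<exists>x. F x = z" for z
  proof -
    \<comment> \<open>Over a distance M the map moves by at least c * M, enough to reach z from F 0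
      on either side.\<close>
    define M where "M = \<bar>z - F 0\<bar> / c"
    have M: "0 \<le> M" "c * M = \<bar>z - F 0\<bar>" using \<open>0 < c\<close> by (auto simp: M_def)
    have "F (- M) \<le> z" "z \<le> F M" using mvt[of 0 M] mvt[of "-M" 0] M by auto
    moreover have "isCont F x" for x using der by (rule DERIV_isCont)
    ultimately show ?thesis using IVT[of F "-M" z M] M by auto
  qed
  then have surj: "range F = UNIV" by (auto simp: surj_def) metis
  define I where "I = inv F"
  have FI: "F (I y) = y" for y using surj by (simp add: I_def f_inv_into_f)
  have lipI: "\<bar>I y - I x\<bar> \<le> \<bar>y - x\<bar> / c" for x y
    using lower[of "I y" "I x"] FI \<open>0 < c\<close> by (simp add: field_simps)
  have contI: "isCont I y" for y
  proof -
    have "(1 / c)-lipschitz_on UNIV I"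
      using lipI \<open>0 < c\<close> by (intro lipschitz_onI) (auto simp: dist_real_def)
    then show ?thesis using lipschitz_on_continuous_on continuous_on_eq_continuous_at by blast
  qed
  have dI: "(I has_real_derivative inverse (G (I y))) (at y)" for y
  proof (rule DERIV_inverse_function[of F _ I y "y - 1" "y + 1"])
    show "G (I y) \<noteq> 0" using G(1)[of "I y"] \<open>0 < c\<close> by simp
  qed (use der FI contI in auto)
  then have dI': "deriv I = (\<lambda>y. inverse (G (I y)))" by (auto intro: DERIV_imp_deriv)
  have holI: "\<bar>inverse (G (I y)) - inverse (G (I x))\<bar> \<le> (C / (c * c * c powr \<epsilon>)) * \<bar>y - x\<bar> powr \<epsilon>" for x y
  proof -
    have pos: "0 < G (I x)" "0 < G (I y)" "c * c \<le> G (I y) * G (I x)"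
      using G(1)[of "I x"] G(1)[of "I y"] \<open>0 < c\<close> by (auto intro: mult_mono)
    have "\<bar>inverse (G (I y)) - inverse (G (I x))\<bar> = \<bar>G (I y) - G (I x)\<bar> / (G (I y) * G (I x))"
      using pos by (simp add: divide_simps abs_if split: if_splits)
    also have "\<dots> \<le> (C * \<bar>I y - I x\<bar> powr \<epsilon>) / (c * c)"
      using pos assms(2,4) holG by (intro frac_le) auto
    also have "\<dots> \<le> (C * (\<bar>y - x\<bar> / c) powr \<epsilon>) / (c * c)"
      using lipI assms by (intro divide_right_mono mult_left_mono powr_mono2) auto
    also have "\<dots> = (C / (c * c * c powr \<epsilon>)) * \<bar>y - x\<bar> powr \<epsilon>"
      using \<open>0 < c\<close> by (simp add: powr_divide mult_ac)
    finally show ?thesis .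
  qed
  have loc: "locally_holder_on \<epsilon> UNIV u" if "\<And>x y. \<bar>u y - u x\<bar> \<le> D * \<bar>y - x\<bar> powr \<epsilon>" for u D
    unfolding locally_holder_on_def using that by (meson zero_less_one)
  show "C_diffeo_onto_image 1 \<epsilon> F"
    unfolding C_diffeo_onto_image_def C_smooth_on_def surj I_def[symmetric]
    using der dI inj loc[of G, OF holG] loc[of "\<lambda>y. inverse (G (I y))", OF holI]
    by (auto simp: dF dI' field_differentiable_def)
qed

lemma whitney_extension_diffeo:
  fixes K :: "real set" and \<phi> g :: "real \<Rightarrow> real"
  assumes K: "closed K" "a \<in> K" "b \<in> K" "K \<subseteq> {a..b}" and \<epsilon>: "0 < \<epsilon>" "\<epsilon> \<le> 1"
    and "0 < c" "l < 1" "0 \<le> C"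
    and "\<And>x y. x \<in> K \<Longrightarrow> y \<in> K \<Longrightarrow> x \<le> y \<Longrightarrow> jet_close \<epsilon> C \<phi> g x y"
    and "\<And>x. x \<in> K \<Longrightarrow> g x \<in> {c..l}"
    and "\<And>a b. a \<in> K \<Longrightarrow> b \<in> K \<Longrightarrow> a < b \<Longrightarrow> {a<..<b} \<inter> K = {} \<Longrightarrow>
        c * (b - a) \<le> \<phi> b - \<phi> a \<and> \<phi> b - \<phi> a \<le> l * (b - a)"
  shows "\<exists>F. (\<forall>x\<in>K. F x = \<phi> x) \<and> (\<exists>L<1. L-lipschitz_on UNIV F) \<and> C_diffeo_onto_image 1 \<epsilon> F"
proof -
  obtain F G D where D: "0 \<le> D" and F: "\<forall>x\<in>K. F x = \<phi> x"
    and jet: "\<forall>x\<in>{a..b}. \<forall>y\<in>{a..b}. x \<le> y \<longrightarrow> jet_close \<epsilon> D F G x y"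
    and G: "\<forall>x\<in>{a..b}. c / 2 \<le> G x \<and> G x \<le> (1 + l) / 2"
    using whitney_extension_interval[OF assms] by blast
  have ab: "a \<le> b" using K by auto
  define r where "r x = max a (min b x)" for x
  define E where "E x = F (r x) + G (r x) * (x - r x)" for x
  have r: "r x \<in> {a..b}" for x using ab by (auto simp: r_def)
  have "jet_close \<epsilon> (2 * D) E (G \<circ> r) x y" if "x \<le> y" for x y
    unfolding E_def r_def using whitney_extension_line[OF ab \<epsilon>(1) D, of F G] jet that by blast
  note * = C_diffeo_of_jet_close[OF \<epsilon>(1) _ this, of "c / 2" "(1 + l) / 2"]
  have 1: "((1 + l) / 2)-lipschitz_on UNIV E" "C_diffeo_onto_image 1 \<epsilon> E"
    using G r \<open>0 < c\<close> \<open>l < 1\<close> D by (intro *; simp)+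
  have "r x = x" if "x \<in> K" for x using that K by (auto simp: r_def)
  then have "\<forall>x\<in>K. E x = \<phi> x" using F by (simp add: E_def)
  moreover have "(1 + l) / 2 < 1" using \<open>l < 1\<close> by simp
  ultimately show ?thesis using 1 by blast
qed

section \<open>Distortion of smooth branches\<close>

text \<open>Compactness in the form of bisection: on adjacent intervals the constants add, since
  both legs through the common endpoint are no longer than the whole.\<close>

lemma locally_holder_on_interval:
  assumes loc: "locally_holder_on \<epsilon> UNIV g" and "0 < \<epsilon>" "a \<le> b"
  shows "\<exists>K\<ge>0. \<forall>y\<in>{a..b}. \<forall>z\<in>{a..b}. \<bar>g y - g z\<bar> \<le> K * \<bar>y - z\<bar> powr \<epsilon>"
  using \<open>a \<le> b\<close>
proof (induction rule: Bolzano)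
  case (trans a b c)
  obtain K1 where K1: "K1 \<ge> 0" "\<And>y z. y \<in> {a..b} \<Longrightarrow> z \<in> {a..b} \<Longrightarrow> \<bar>g y - g z\<bar> \<le> K1 * \<bar>y - z\<bar> powr \<epsilon>"
    using trans(1) by blast
  obtain K2 where K2: "K2 \<ge> 0" "\<And>y z. y \<in> {b..c} \<Longrightarrow> z \<in> {b..c} \<Longrightarrow> \<bar>g y - g z\<bar> \<le> K2 * \<bar>y - z\<bar> powr \<epsilon>"
    using trans(2) by blast
  have *: "\<bar>g y - g z\<bar> \<le> (K1 + K2) * \<bar>y - z\<bar> powr \<epsilon>" if "y \<in> {a..c}" "z \<in> {a..c}" "y \<le> z" for y z
  proof -
    have p: "0 \<le> K1 * \<bar>y - z\<bar> powr \<epsilon>" "0 \<le> K2 * \<bar>y - z\<bar> powr \<epsilon>" using K1 K2 by auto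
    consider "z \<le> b" | "b \<le> y" | "y \<le> b" "b \<le> z" by linarith
    then show ?thesis
    proof cases
      case 1
      then show ?thesis using K1(2)[of y z] that p by (simp add: distrib_right)
    next
      case 2
      then show ?thesis using K2(2)[of y z] that p by (simp add: distrib_right)
    next
      case 3
      have "K1 * \<bar>y - b\<bar> powr \<epsilon> \<le> K1 * \<bar>y - z\<bar> powr \<epsilon>" "K2 * \<bar>b - z\<bar> powr \<epsilon> \<le> K2 * \<bar>y - z\<bar> powr \<epsilon>"
        using K1(1) K2(1) 3 \<open>0 < \<epsilon>\<close> by (auto intro!: mult_left_mono powr_mono2)
      then show ?thesis using K1(2)[of y b] K2(2)[of b z] that 3 by (simp add: distrib_right)
    qed
  qed
  show ?case
  proof (intro exI[of _ "K1 + K2"] conjI ballI)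
    fix y z assume "y \<in> {a..c}" "z \<in> {a..c}"
    then show "\<bar>g y - g z\<bar> \<le> (K1 + K2) * \<bar>y - z\<bar> powr \<epsilon>"
      using *[of y z] *[of z y] by (cases "y \<le> z") (auto simp: abs_minus_commute)
  qed (use K1 K2 in auto)
next
  case (local x)
  obtain r K where r: "r > 0" and K: "\<And>y z. y \<in> ball x r \<Longrightarrow> z \<in> ball x r \<Longrightarrow> \<bar>g y - g z\<bar> \<le> K * \<bar>y - z\<bar> powr \<epsilon>"
    using loc unfolding locally_holder_on_def by (metis Int_UNIV_right UNIV_I)
  show ?case
  proof (rule exI[of _ r], intro conjI allI impI)
    fix a b assume ab: "a \<le> x \<and> x \<le> b \<and> b - a < r"
    have "\<bar>g y - g z\<bar> \<le> max K 0 * \<bar>y - z\<bar> powr \<epsilon>" if "y \<in> {a..b}" "z \<in> {a..b}" for y z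
    proof -
      have "\<bar>g y - g z\<bar> \<le> K * \<bar>y - z\<bar> powr \<epsilon>"
        using that ab by (intro K) (auto simp: dist_real_def)
      also have "\<dots> \<le> max K 0 * \<bar>y - z\<bar> powr \<epsilon>" by (intro mult_right_mono) auto
      finally show ?thesis .
    qed
    then show "\<exists>K\<ge>0. \<forall>y\<in>{a..b}. \<forall>z\<in>{a..b}. \<bar>g y - g z\<bar> \<le> K * \<bar>y - z\<bar> powr \<epsilon>"
      by (intro exI[of _ "max K 0"]) auto
  qed (use r in auto)
qed

lemma holder_imp_continuous_on:
  fixes g :: "real \<Rightarrow> real"
  assumes "\<And>y z. y \<in> A \<Longrightarrow> z \<in> A \<Longrightarrow> \<bar>g y - g z\<bar> \<le> K * \<bar>y - z\<bar> powr \<epsilon>" "0 < \<epsilon>"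
  shows "continuous_on A g"
  unfolding continuous_on_def
proof
  fix x assume "x \<in> A"
  have "((\<lambda>y. g y - g x) \<longlongrightarrow> 0) (at x within A)"
  proof (rule Lim_null_comparison)
    show "\<forall>\<^sub>F y in at x within A. norm (g y - g x) \<le> K * \<bar>y - x\<bar> powr \<epsilon>"
      unfolding eventually_at_filter using assms(1) \<open>x \<in> A\<close> by (auto intro: always_eventually)
    have "((\<lambda>y. K * \<bar>y - x\<bar> powr \<epsilon>) \<longlongrightarrow> K * \<bar>x - x\<bar> powr \<epsilon>) (at x within A)"
      using \<open>0 < \<epsilon>\<close> by (intro tendsto_intros tendsto_powr') auto
    then show "((\<lambda>y. K * \<bar>y - x\<bar> powr \<epsilon>) \<longlongrightarrow> 0) (at x within A)" by simp
  qed
  then show "(g \<longlongrightarrow> g x) (at x within A)" by (simp add: LIM_zero_iff)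
qed

lemma abs_ln_diff_le:
  fixes a b m :: real
  assumes "0 < m" "m \<le> a" "m \<le> b"
  shows "\<bar>ln a - ln b\<bar> \<le> \<bar>a - b\<bar> / m"
proof -
  have "ln a - ln b \<le> \<bar>a - b\<bar> / m" if "m \<le> a" "m \<le> b" for a b
  proof -
    have "ln a - ln b \<le> (a - b) / b" using ln_diff_le[of a b] that assms by simp
    also have "\<dots> \<le> \<bar>a - b\<bar> / b" using that assms by (intro divide_right_mono) auto
    also have "\<dots> \<le> \<bar>a - b\<bar> / m" using that assms by (intro frac_le) auto
    finally show ?thesis .
  qed
  from this[of a b] this[of b a] show ?thesis using assms by (auto simp: abs_if)
qed

text \<open>The logarithm has slope at least 1 on (0, 1]; this carries logarithmic estimates over to
  scaling coordinates and slopes.\<close>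

lemma abs_diff_le_abs_ln_diff:
  fixes a b :: real
  assumes "0 < a" "a \<le> 1" "0 < b" "b \<le> 1"
  shows "\<bar>a - b\<bar> \<le> \<bar>ln a - ln b\<bar>"
proof -
  have "a - b \<le> \<bar>ln a - ln b\<bar>" if "0 < a" "a \<le> 1" "0 < b" "b \<le> 1" "b \<le> a" for a b :: real
  proof -
    have "a - b \<le> (a - b) / a" using that by (simp add: le_divide_eq mult_left_le)
    also have "\<dots> \<le> ln a - ln b" using ln_diff_le[of b a] that by (simp add: diff_divide_distrib)
    finally show ?thesis by simp
  qed
  from this[of a b] this[of b a] show ?thesis using assms by (auto simp: abs_if)
qed

text \<open>By the mean value theorem the two ratios differ by a factor |G x| / |G y| with x, y in
  [a, b], and ln |G| is Hoelder on [0, 1] because |G| has a positive minimum there.\<close>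

lemma C_diffeo_log_distortion:
  assumes F: "C_diffeo_onto_image 1 \<epsilon> F" and \<epsilon>: "0 < \<epsilon>"
  shows "\<exists>H\<ge>0. \<forall>a p q b. 0 \<le> a \<longrightarrow> a \<le> p \<longrightarrow> p < q \<longrightarrow> q \<le> b \<longrightarrow> b \<le> 1 \<longrightarrow>
    \<bar>ln \<bar>(F q - F p) / (F b - F a)\<bar> - ln \<bar>(q - p) / (b - a)\<bar>\<bar> \<le> H * (b - a) powr \<epsilon>"
proof -
  define G where "G = deriv F"
  have der: "(F has_real_derivative G x) (at x)" for x
    using F by (simp add: C_diffeo_onto_image_def C_smooth_on_def G_def DERIV_deriv_iff_field_differentiable)
  have "locally_holder_on \<epsilon> UNIV G"
    using F by (simp add: C_diffeo_onto_image_def C_smooth_on_def G_def)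
  then obtain K where K: "K \<ge> 0" "\<And>y z. y \<in> {0..1} \<Longrightarrow> z \<in> {0..1} \<Longrightarrow> \<bar>G y - G z\<bar> \<le> K * \<bar>y - z\<bar> powr \<epsilon>"
    using locally_holder_on_interval[of \<epsilon> G 0 1] \<epsilon> by auto
  \<comment> \<open>Differentiability of the inverse excludes critical points, by the chain
    rule.\<close>
  have "G x \<noteq> 0" for x
  proof -
    have inj: "inj F" and inv: "inv F field_differentiable at (F x)"
      using F by (auto simp: C_diffeo_onto_image_def C_smooth_on_def)
    then have "(inv F has_real_derivative deriv (inv F) (F x)) (at (F x))"
      by (simp add: DERIV_deriv_iff_field_differentiable)
    from DERIV_chain[OF this der] have "((\<lambda>y. y) has_real_derivative deriv (inv F) (F x) * G x) (at x)"
      using inj by (simp add: comp_def)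
    then have "deriv (inv F) (F x) * G x = 1" using DERIV_unique DERIV_ident by blast
    then show ?thesis by auto
  qed
  moreover have "continuous_on {0..1} (\<lambda>x. \<bar>G x\<bar>)"
    by (intro continuous_on_rabs holder_imp_continuous_on[OF K(2) \<epsilon>])
  ultimately obtain m where m: "m > 0" "\<And>x. x \<in> {0..1} \<Longrightarrow> m \<le> \<bar>G x\<bar>"
    using continuous_attains_inf[of "{0..1::real}" "\<lambda>x. \<bar>G x\<bar>"] by (metis atLeastAtMost_iff compact_Icc empty_iff zero_less_abs_iff zero_le_one order_refl)
  show ?thesis
  proof (intro exI[of _ "K / m"] conjI allI impI)
    fix a p q b :: real
    assume *: "0 \<le> a" "a \<le> p" "p < q" "q \<le> b" "b \<le> 1"
    obtain x where x: "p < x" "x < q" "F q - F p = (q - p) * G x" using MVT2[of p q F G] der * by auto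
    obtain y where y: "a < y" "y < b" "F b - F a = (b - a) * G y" using MVT2[of a b F G] der * by auto
    have xy: "x \<in> {0..1}" "y \<in> {0..1}" "\<bar>x - y\<bar> \<le> b - a" using x y * by auto
    have G: "0 < \<bar>G x\<bar>" "0 < \<bar>G y\<bar>" using m xy by (metis less_le_trans)+
    have "\<bar>(F q - F p) / (F b - F a)\<bar> = \<bar>(q - p) / (b - a)\<bar> * (\<bar>G x\<bar> / \<bar>G y\<bar>)"
      unfolding x y by (simp add: abs_mult)
    moreover have "0 < \<bar>(q - p) / (b - a)\<bar>" using * by auto
    ultimately have "ln \<bar>(F q - F p) / (F b - F a)\<bar> - ln \<bar>(q - p) / (b - a)\<bar> = ln \<bar>G x\<bar> - ln \<bar>G y\<bar>"
      using G * by (simp add: ln_mult ln_div)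
    also have "\<bar>\<dots>\<bar> \<le> \<bar>\<bar>G x\<bar> - \<bar>G y\<bar>\<bar> / m" using m xy by (intro abs_ln_diff_le) auto
    also have "\<dots> \<le> \<bar>G x - G y\<bar> / m" using m(1) by (intro divide_right_mono) auto
    also have "\<dots> \<le> (K * \<bar>x - y\<bar> powr \<epsilon>) / m" using m(1) K xy by (intro divide_right_mono) auto
    also have "\<dots> \<le> (K * (b - a) powr \<epsilon>) / m"
      using m(1) K xy \<epsilon> by (intro divide_right_mono mult_left_mono powr_mono2) auto
    finally show "\<bar>ln \<bar>(F q - F p) / (F b - F a)\<bar> - ln \<bar>(q - p) / (b - a)\<bar>\<bar> \<le> K / m * (b - a) powr \<epsilon>"
      by simp
  qed (use K m in auto)
qed

section \<open>Words and products along strings\<close>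

lemma words_conc [intro]: "js \<in> lists {1..d} \<Longrightarrow> w \<in> words d \<Longrightarrow> js \<frown> w \<in> words d"
  unfolding words_def conc_def by (auto simp: in_lists_conv_set dest!: nth_mem)

lemma words_build [intro]: "i \<in> {1..d} \<Longrightarrow> w \<in> words d \<Longrightarrow> i ## w \<in> words d"
  using words_conc[of "[i]"] by simp

lemma const_in_words [intro]: "i \<in> {1..d} \<Longrightarrow> (\<lambda>_. i) \<in> words d"
  by (simp add: words_def)

lemma prefix_in_lists [intro]: "w \<in> words d \<Longrightarrow> prefix n w \<in> lists {1..d}"
  by (auto simp: words_def in_lists_conv_set)

lemma rev_in_lists: "rev js \<in> lists A \<longleftrightarrow> js \<in> lists A"
  by (simp add: in_lists_conv_set)

lemma prefix_eq_iff: "prefix n \<alpha> = prefix n \<beta> \<longleftrightarrow> (\<forall>m<n. \<alpha> m = \<beta> m)"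
  by (auto simp: subsequence_def)

lemma first_diff_neq: "\<alpha> \<noteq> \<beta> \<Longrightarrow> \<alpha> (first_diff \<alpha> \<beta>) \<noteq> \<beta> (first_diff \<alpha> \<beta>)"
  unfolding first_diff_def by (rule LeastI_ex) auto

lemma first_diff_prefix: "prefix (first_diff \<alpha> \<beta>) \<alpha> = prefix (first_diff \<alpha> \<beta>) \<beta>"
  unfolding prefix_eq_iff first_diff_def using not_less_Least by blast

lemma first_diff_eqI: "prefix n \<alpha> = prefix n \<beta> \<Longrightarrow> \<alpha> n \<noteq> \<beta> n \<Longrightarrow> first_diff \<alpha> \<beta> = n"
  unfolding first_diff_def prefix_eq_iff by (rule Least_equality) (auto simp: not_less[symmetric])

lemma first_diff_ge: "prefix n \<alpha> = prefix n \<beta> \<Longrightarrow> \<alpha> \<noteq> \<beta> \<Longrightarrow> n \<le> first_diff \<alpha> \<beta>"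
  using first_diff_neq[of \<alpha> \<beta>] unfolding prefix_eq_iff by (meson not_le)

lemma compact_space_words_top: "compact_space (words_top d)"
  by (simp add: words_top_def compact_space_product_topology compact_space_discrete_topology)

lemma openin_words_cylinder: "openin (words_top d) {\<alpha> \<in> words d. prefix n \<alpha> = prefix n \<beta>}"
proof -
  \<comment> \<open>\<beta> is an arbitrary word, so its letters are intersected with the alphabet;
    the box may be empty.\<close>
  have "{\<alpha> \<in> words d. prefix n \<alpha> = prefix n \<beta>} =
      (\<Pi>\<^sub>E m\<in>UNIV. if m < n then {\<beta> m} \<inter> {1..d} else {1..d})"
    unfolding words_def prefix_eq_iff PiE_UNIV_domain Pi_def
    by (auto split: if_splits)
  moreover have "finite {m. (if m < n then {\<beta> m} \<inter> {1..d} else {1..d}) \<noteq> {1..d}}"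
    by (rule finite_subset[of _ "{..<n}"]) (auto split: if_splits)
  ultimately show ?thesis
    unfolding words_top_def by (simp add: openin_PiE_gen)
qed

lemma continuous_map_wordsI:
  fixes f :: "nat word \<Rightarrow> real"
  assumes "\<And>\<beta> e. \<beta> \<in> words d \<Longrightarrow> 0 < e \<Longrightarrow>
    \<exists>n. \<forall>\<alpha>\<in>words d. prefix n \<alpha> = prefix n \<beta> \<longrightarrow> \<bar>f \<alpha> - f \<beta>\<bar> < e"
  shows "continuous_map (words_top d) euclideanreal f"
  unfolding continuous_map_def
proof (intro conjI allI impI)
  fix U :: "real set" assume "openin euclideanreal U"
  then have U: "open U" by simp
  show "openin (words_top d) {x \<in> topspace (words_top d). f x \<in> U}"
  proof (subst openin_subopen, intro ballI)
    fix \<beta> assume "\<beta> \<in> {x \<in> topspace (words_top d). f x \<in> U}"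
    then have \<beta>: "\<beta> \<in> words d" "f \<beta> \<in> U" by auto
    then obtain e where e: "e > 0" "\<And>y. dist y (f \<beta>) < e \<Longrightarrow> y \<in> U" using U open_dist by metis
    then obtain n where "\<forall>\<alpha>\<in>words d. prefix n \<alpha> = prefix n \<beta> \<longrightarrow> \<bar>f \<alpha> - f \<beta>\<bar> < e"
      using assms[OF \<beta>(1)] by blast
    then have "{\<alpha> \<in> words d. prefix n \<alpha> = prefix n \<beta>} \<subseteq> {x \<in> topspace (words_top d). f x \<in> U}"
      using e(2) by (auto simp: dist_real_def)
    then show "\<exists>T. openin (words_top d) T \<and> \<beta> \<in> T \<and> T \<subseteq> {x \<in> topspace (words_top d). f x \<in> U}"
      using openin_words_cylinder[of d n \<beta>] \<beta>(1) by blast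
  qed
qed auto

text \<open>A letter is weighted by a factor depending on the string behind it. With
  \<open>finite_scaling\<close> as weight the product is the length of a cylinder; with the values
  of \<open>S\<close> at \<open>js \<frown> w\<close> it is the product inside
  \<open>rho\<close>.\<close>

primrec path_prod :: "('a list \<Rightarrow> 'a \<Rightarrow> real) \<Rightarrow> 'a list \<Rightarrow> real" where
  "path_prod f [] = 1"
| "path_prod f (k # js) = path_prod f js * f js k"

lemma path_prod_pos:
  "(\<And>js k. js \<in> lists A \<Longrightarrow> k \<in> A \<Longrightarrow> 0 < f js k) \<Longrightarrow> js \<in> lists A \<Longrightarrow> 0 < path_prod f js"
  by (induction js) auto

lemma path_prod_le_power:
  assumes "\<And>js k. js \<in> lists A \<Longrightarrow> k \<in> A \<Longrightarrow> 0 < f js k \<and> f js k \<le> q"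
  shows "js \<in> lists A \<Longrightarrow> path_prod f js \<le> q ^ length js"
proof (induction js)
  case (Cons k js)
  then have "path_prod f js * f js k \<le> q ^ length js * q"
    using assms[of js k] path_prod_pos[of A f js] by (intro mult_mono) (auto simp: assms less_imp_le)
  then show ?case by (simp add: mult.commute)
qed auto

lemma path_prod_append:
  "path_prod f (js @ vs) = path_prod (\<lambda>us. f (us @ vs)) js * path_prod f vs"
  by (induction js) auto

text \<open>Bounded distortion: a letter with t letters behind it adds at most
  \<open>C * q ^ t\<close> to the difference of logarithms, and the geometric series bounds the
  total for all lengths at once.\<close>

lemma path_prod_distortion:
  assumes pos: "\<And>js k. js \<in> lists A \<Longrightarrow> k \<in> A \<Longrightarrow> 0 < f js k" "\<And>js k. js \<in> lists A \<Longrightarrow> k \<in> A \<Longrightarrow> 0 < g js k"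
    and le: "\<And>js k. js \<in> lists A \<Longrightarrow> k \<in> A \<Longrightarrow> ln (f js k) \<le> ln (g js k) + C * q ^ length js"
    and q: "0 \<le> q" "q < 1" and "0 \<le> C" and js: "js \<in> lists A"
  shows "path_prod f js \<le> exp (C / (1 - q)) * path_prod g js"
proof -
  have "ln (path_prod f js) \<le> ln (path_prod g js) + C * (\<Sum>t<length js. q ^ t)"
    using js
  proof (induction js)
    case (Cons k js)
    then have "js \<in> lists A" "k \<in> A" by auto
    moreover from this have "0 < path_prod f js" "0 < path_prod g js" "0 < f js k" "0 < g js k"
      using pos path_prod_pos by metis+
    ultimately show ?case
      using Cons le[of js k] by (simp add: ln_mult algebra_simps)
  qed simp
  also have "C * (\<Sum>t<length js. q ^ t) \<le> C / (1 - q)"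
  proof -
    have "(\<Sum>t<length js. q ^ t) = (1 - q ^ length js) / (1 - q)"
      using q by (subst sum_gp_strict) auto
    also have "\<dots> \<le> 1 / (1 - q)" using q by (intro divide_right_mono) auto
    finally show ?thesis using mult_left_mono[OF _ \<open>0 \<le> C\<close>] by fastforce
  qed
  finally have "ln (path_prod f js) \<le> ln (exp (C / (1 - q)) * path_prod g js)"
    using path_prod_pos[of A g js] pos js by (simp add: ln_mult)
  then show ?thesis
    using path_prod_pos[of A g js] path_prod_pos[of A f js] pos js by simp
qed

lemma path_prod_map: "path_prod f (map j [m..<n]) = (\<Prod>t=m..<n. f (map j [Suc t..<n]) (j t))"
proof (induction "n - m" arbitrary: m)
  case (Suc p)
  then have "m < n" by simp
  then show ?case using Suc(1)[of "Suc m"] Suc(2)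
    by (simp add: upt_conv_Cons prod.atLeast_Suc_lessThan mult.commute)
qed auto

lemma rho_eq:
  "j \<noteq> j' \<Longrightarrow> rho d S j j' =
     (SUP w\<in>words d. path_prod (\<lambda>js. S (js \<frown> w)) (prefix (first_diff j j') j))"
  by (simp add: rho_def Let_def subsequence_def path_prod_map atLeast0LessThan)

text \<open>As \<delta> shrinks by q, the steps of x are dominated by a geometric series of ratio
  \<open>q powr \<epsilon>\<close>. It serves twice: for finite scalings along a dual word, and for
  the mean slopes of a branch along nested cylinders.\<close>

lemma geometric_drift:
  fixes x \<delta> :: "nat \<Rightarrow> real"
  assumes step: "\<And>n. \<bar>x (Suc n) - x n\<bar> \<le> C * \<delta> n powr \<epsilon>"
    and \<delta>: "\<And>n. 0 \<le> \<delta> n" "\<And>n. \<delta> (Suc n) \<le> q * \<delta> n"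
    and "0 < q" "q < 1" "0 < \<epsilon>" "0 \<le> C"
  shows "\<bar>x n - x 0\<bar> \<le> C / (1 - q powr \<epsilon>) * \<delta> 0 powr \<epsilon>"
    and "convergent x"
    and "x \<longlonglongrightarrow> y \<Longrightarrow> \<bar>y - x 0\<bar> \<le> C / (1 - q powr \<epsilon>) * \<delta> 0 powr \<epsilon>"
proof -
  define r where "r = q powr \<epsilon>"
  have r: "0 < r" "r < 1" using assms powr_less_mono2[of \<epsilon> q 1] by (auto simp: r_def)
  have \<delta>n: "\<delta> n powr \<epsilon> \<le> r ^ n * \<delta> 0 powr \<epsilon>" for n
  proof (induction n)
    case (Suc n)
    have "\<delta> (Suc n) powr \<epsilon> \<le> (q * \<delta> n) powr \<epsilon>" using assms by (intro powr_mono2) auto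
    also have "\<dots> = r * \<delta> n powr \<epsilon>" using assms by (simp add: powr_mult r_def)
    also have "\<dots> \<le> r * (r ^ n * \<delta> 0 powr \<epsilon>)" using Suc r by (intro mult_left_mono) auto
    finally show ?case by simp
  qed simp
  have sum: "\<bar>x n - x 0\<bar> \<le> C * \<delta> 0 powr \<epsilon> * (\<Sum>m<n. r ^ m)" for n
  proof (induction n)
    case (Suc n)
    have "\<bar>x (Suc n) - x n\<bar> \<le> C * (r ^ n * \<delta> 0 powr \<epsilon>)"
      using step[of n] mult_left_mono[OF \<delta>n[of n] \<open>0 \<le> C\<close>] by linarith
    then show ?case using Suc by (simp add: algebra_simps)
  qed simp
  show bound: "\<bar>x n - x 0\<bar> \<le> C / (1 - q powr \<epsilon>) * \<delta> 0 powr \<epsilon>" for n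
  proof -
    have "(\<Sum>m<n. r ^ m) = (1 - r ^ n) / (1 - r)"
      using r by (subst sum_gp_strict) auto
    also have "\<dots> \<le> 1 / (1 - r)" using r by (intro divide_right_mono) auto
    finally have "C * \<delta> 0 powr \<epsilon> * (\<Sum>m<n. r ^ m) \<le> C * \<delta> 0 powr \<epsilon> * (1 / (1 - r))"
      using \<open>0 \<le> C\<close> by (intro mult_left_mono) auto
    then show ?thesis using sum[of n] by (simp add: r_def)
  qed
  have "summable (\<lambda>n. x (Suc n) - x n)"
  proof (rule summable_comparison_test')
    show "summable (\<lambda>n. C * \<delta> 0 powr \<epsilon> * r ^ n)" using r by (intro summable_mult summable_geometric) auto
    show "norm (x (Suc n) - x n) \<le> C * \<delta> 0 powr \<epsilon> * r ^ n" for n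
      using step[of n] mult_left_mono[OF \<delta>n[of n] \<open>0 \<le> C\<close>] by (simp add: mult_ac)
  qed
  then have "convergent (\<lambda>n. (\<Sum>m<n. x (Suc m) - x m))" by (simp add: summable_iff_convergent)
  then show "convergent x"
    by (simp add: sum_lessThan_telescope convergent_diff_const_right_iff)
  assume "x \<longlonglongrightarrow> y"
  then have "(\<lambda>n. \<bar>x n - x 0\<bar>) \<longlonglongrightarrow> \<bar>y - x 0\<bar>" by (intro tendsto_intros)
  then show "\<bar>y - x 0\<bar> \<le> C / (1 - q powr \<epsilon>) * \<delta> 0 powr \<epsilon>"
    using bound by (intro LIMSEQ_le_const2) auto
qed

section \<open>Cylinders of order preserving maps\<close>

text \<open>The order combinatorics of cylinders, shared by a given embedding and by the map
  constructed from lengths.\<close>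

locale order_map =
  fixes d :: nat and h :: "nat word \<Rightarrow> real"
  assumes d: "2 \<le> d"
    and order: "\<And>\<alpha> \<beta>. \<alpha> \<in> words d \<Longrightarrow> \<beta> \<in> words d \<Longrightarrow> \<alpha> \<noteq> \<beta> \<Longrightarrow>
      (h \<alpha> > h \<beta> \<longleftrightarrow> \<alpha> (first_diff \<alpha> \<beta>) > \<beta> (first_diff \<alpha> \<beta>))"
begin

text \<open>Together with \<open>hi\<close> the extreme points of the cylinder, attained at the
  constant tails 1 and d; hull lengths thereby become differences of two values of
  \<open>h\<close>.\<close>

definition lo :: "nat list \<Rightarrow> real" where
  "lo js = h (rev js \<frown> (\<lambda>_. 1))"

definition hi :: "nat list \<Rightarrow> real" where
  "hi js = h (rev js \<frown> (\<lambda>_. d))"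

text \<open>Coordinate \<open>k\<close> of the scaling vector of \<open>js\<close> is the length of the interval between
  \<open>h (rev js \<frown> piece_lo k)\<close> and \<open>h (rev js \<frown> piece_hi k)\<close>, for pieces and gaps alike.\<close>

definition piece_lo :: "nat \<Rightarrow> nat word" where
  "piece_lo k = (if k \<le> d then k ## (\<lambda>_. 1) else (k - d) ## (\<lambda>_. d))"

definition piece_hi :: "nat \<Rightarrow> nat word" where
  "piece_hi k = (if k \<le> d then k ## (\<lambda>_. d) else Suc (k - d) ## (\<lambda>_. 1))"

lemma const_words: "(\<lambda>_. 1) \<in> words d" "(\<lambda>_. d) \<in> words d"
  using d by auto

lemma piece_words:
  assumes "k \<in> {1..2*d-1}"
  shows "piece_lo k \<in> words d" "piece_hi k \<in> words d"
  using assms d const_words unfolding piece_lo_def piece_hi_def by (auto intro!: words_build)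

lemma h_less:
  assumes "\<alpha> \<in> words d" "\<beta> \<in> words d" "prefix n \<alpha> = prefix n \<beta>" "\<alpha> n < \<beta> n"
  shows "h \<alpha> < h \<beta>"
proof -
  have "first_diff \<beta> \<alpha> = n" using assms by (intro first_diff_eqI) auto
  moreover have "\<beta> \<noteq> \<alpha>" using assms by auto
  ultimately show ?thesis using order[of \<beta> \<alpha>] assms by auto
qed

lemma h_inj: "inj_on h (words d)"
proof (rule inj_onI, rule ccontr)
  fix \<alpha> \<beta> assume *: "\<alpha> \<in> words d" "\<beta> \<in> words d" "h \<alpha> = h \<beta>" "\<alpha> \<noteq> \<beta>"
  then show False
    using h_less[of \<alpha> \<beta> "first_diff \<alpha> \<beta>"] h_less[of \<beta> \<alpha> "first_diff \<alpha> \<beta>"]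
      first_diff_neq[of \<alpha> \<beta>] first_diff_prefix[of \<alpha> \<beta>] by (metis less_irrefl linorder_neqE_nat)
qed

text \<open>A word of the cylinder can differ from an extreme word only inside the constant tail,
  where 1 and d are the extreme letters.\<close>

lemma h_between:
  assumes js: "js \<in> lists {1..d}" and \<alpha>: "\<alpha> \<in> words d" and pre: "prefix (length js) \<alpha> = rev js"
  shows "lo js \<le> h \<alpha>" "h \<alpha> \<le> hi js"
proof -
  have "h (rev js \<frown> (\<lambda>_. 1)) \<le> h \<alpha>" if "rev js \<frown> (\<lambda>_. 1) \<noteq> \<alpha>"
  proof -
    let ?n = "first_diff (rev js \<frown> (\<lambda>_. 1)) \<alpha>"
    have w: "rev js \<frown> (\<lambda>_. 1) \<in> words d" using js const_words by (auto simp: rev_in_lists)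
    have "length js \<le> ?n" using that pre by (intro first_diff_ge) auto
    then have "(rev js \<frown> (\<lambda>_. 1)) ?n = 1" by simp
    moreover have "1 \<le> \<alpha> ?n" using \<alpha> by (auto simp: words_def)
    ultimately have "(rev js \<frown> (\<lambda>_. 1)) ?n < \<alpha> ?n"
      using first_diff_neq[OF that] by simp
    then show ?thesis using h_less[OF w \<alpha> first_diff_prefix] by simp
  qed
  then show "lo js \<le> h \<alpha>" unfolding lo_def by fastforce
  have "h \<alpha> \<le> h (rev js \<frown> (\<lambda>_. d))" if "rev js \<frown> (\<lambda>_. d) \<noteq> \<alpha>"
  proof -
    let ?n = "first_diff (rev js \<frown> (\<lambda>_. d)) \<alpha>"
    have w: "rev js \<frown> (\<lambda>_. d) \<in> words d" using js const_words by (auto simp: rev_in_lists)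
    have "length js \<le> ?n" using that pre by (intro first_diff_ge) auto
    then have "(rev js \<frown> (\<lambda>_. d)) ?n = d" by simp
    moreover have "\<alpha> ?n \<le> d" using \<alpha> by (auto simp: words_def)
    ultimately have "\<alpha> ?n < (rev js \<frown> (\<lambda>_. d)) ?n"
      using first_diff_neq[OF that] by simp
    then show ?thesis using h_less[OF \<alpha> w first_diff_prefix[symmetric]] by simp
  qed
  then show "h \<alpha> \<le> hi js" unfolding hi_def by fastforce
qed

lemma conc_between:
  assumes "js \<in> lists {1..d}" "w \<in> words d"
  shows "lo js \<le> h (rev js \<frown> w)" "h (rev js \<frown> w) \<le> hi js"
  using assms by (auto intro!: h_between simp: rev_in_lists)

lemma conc_less:
  assumes "js \<in> lists {1..d}" "u \<in> words d" "w \<in> words d" "u 0 < w 0"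
  shows "h (rev js \<frown> u) < h (rev js \<frown> w)"
  using assms by (intro h_less[where n = "length js"]) (auto simp: rev_in_lists)

lemma lo_less_hi: "js \<in> lists {1..d} \<Longrightarrow> lo js < hi js"
  unfolding lo_def hi_def using d const_words by (intro conc_less) auto

lemma piece_less:
  assumes js: "js \<in> lists {1..d}" and k: "k \<in> {1..2*d-1}"
  shows "h (rev js \<frown> piece_lo k) < h (rev js \<frown> piece_hi k)"
proof (cases "k \<le> d")
  case True
  then show ?thesis
    using lo_less_hi[of "k # js"] js k by (simp add: lo_def hi_def piece_lo_def piece_hi_def)
next
  case False
  then show ?thesis
    using piece_words[OF k] js by (intro conc_less) (auto simp: piece_lo_def piece_hi_def)
qed

lemma cyl_bounds:
  assumes js: "js \<in> lists {1..d}"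
  shows "lo js \<in> cyl d h js" "hi js \<in> cyl d h js" "cyl d h js \<subseteq> {lo js..hi js}"
  unfolding cyl_def using h_between[OF js] js const_words
  by (auto simp: lo_def hi_def rev_in_lists intro!: imageI)

lemma hull_length_cyl: "js \<in> lists {1..d} \<Longrightarrow> hull_length (cyl d h js) = hi js - lo js"
proof -
  assume js: "js \<in> lists {1..d}"
  have "convex hull (cyl d h js) = {lo js..hi js}"
  proof
    show "convex hull (cyl d h js) \<subseteq> {lo js..hi js}"
      using cyl_bounds[OF js] by (intro hull_minimal) auto
    have "closed_segment (lo js) (hi js) \<subseteq> convex hull (cyl d h js)"
      using cyl_bounds[OF js] by (intro closed_segment_subset_convex_hull) (auto intro: hull_inc)
    then show "{lo js..hi js} \<subseteq> convex hull (cyl d h js)"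
      using lo_less_hi[OF js] by (simp add: closed_segment_eq_real_ivl)
  qed
  then show ?thesis using lo_less_hi[OF js] by (simp add: hull_length_def)
qed

lemma finite_scaling_eq:
  assumes js: "js \<in> lists {1..d}" and k: "k \<in> {1..2*d-1}"
  shows "finite_scaling d h js k =
    (h (rev js \<frown> piece_hi k) - h (rev js \<frown> piece_lo k)) / (hi js - lo js)"
proof (cases "k \<le> d")
  case True
  then show ?thesis using js k hull_length_cyl[of "k # js"] hull_length_cyl[of js]
    by (simp add: finite_scaling_def lo_def hi_def piece_lo_def piece_hi_def)
next
  case False
  define i where "i = k - d"
  have i: "i \<in> {1..d}" "Suc i \<in> {1..d}" using False k d by (auto simp: i_def)
  have l: "i # js \<in> lists {1..d}" "Suc i # js \<in> lists {1..d}" using i js by auto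
  have S: "Sup (cyl d h (i # js)) = hi (i # js)"
    using cyl_bounds[OF l(1)] by (intro cSup_eq_maximum) auto
  have I: "Inf (cyl d h (Suc i # js)) = lo (Suc i # js)"
    using cyl_bounds[OF l(2)] by (intro cInf_eq_minimum) auto
  have e: "hi (i # js) = h (rev js \<frown> piece_lo k)" "lo (Suc i # js) = h (rev js \<frown> piece_hi k)"
    using False by (simp_all add: i_def hi_def lo_def piece_lo_def piece_hi_def)
  have "hull_length (gap d h js i) = lo (Suc i # js) - hi (i # js)"
    unfolding hull_length_def gap_def S I using piece_less[OF js k] e
    by (subst convex_hull_eq[THEN iffD2]) auto
  then show ?thesis using False e hull_length_cyl[OF js] by (simp add: finite_scaling_def i_def)
qed

lemma finite_scaling_pos:
  "js \<in> lists {1..d} \<Longrightarrow> k \<in> {1..2*d-1} \<Longrightarrow> 0 < finite_scaling d h js k"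
  using finite_scaling_eq piece_less lo_less_hi by simp

lemma length_Cons:
  assumes "js \<in> lists {1..d}" "k \<in> {1..d}"
  shows "hi (k # js) - lo (k # js) = (hi js - lo js) * finite_scaling d h js k"
proof -
  have "k \<in> {1..2*d-1}" using assms d by auto
  then show ?thesis
    using assms lo_less_hi[of js] finite_scaling_eq[of js k]
    by (simp add: piece_lo_def piece_hi_def hi_def lo_def)
qed

end

section \<open>The scaling function of a smooth embedding\<close>

text \<open>Turns one Lipschitz constant below 1 per branch into a common one; the strict bound
  survives because the index set is finite.\<close>

lemma finite_uniform_bound:
  fixes P :: "'a \<Rightarrow> real \<Rightarrow> bool"
  assumes "finite A" "\<And>i. i \<in> A \<Longrightarrow> \<exists>H<u. P i H" "\<And>i H H'. P i H \<Longrightarrow> H \<le> H' \<Longrightarrow> P i H'"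
  shows "\<exists>H<u. \<forall>i\<in>A. P i H"
  using assms(1,2)
proof (induction A)
  case empty
  then show ?case by (auto intro: lt_ex)
next
  case (insert x A)
  then obtain H1 where "H1 < u" "\<forall>i\<in>A. P i H1" by auto
  moreover obtain H2 where "H2 < u" "P x H2" using insert by auto
  ultimately show ?case using assms(3)
    by (intro exI[of _ "max H1 H2"]) (auto intro: assms(3)[OF _ max.cobounded1] assms(3)[OF _ max.cobounded2])
qed

text \<open>Appending i to js applies \<open>F i\<close> to the cylinder and to all its pieces and
  gaps, so consecutive finite scalings along a dual word differ by the distortion of one branch on
  an interval of length \<open>D js\<close>. The metric enters at the end, where \<open>D js\<close>
  is compared with products of values of \<open>S\<close>.\<close>

lemma embedding_imp_holder_scaling:
  fixes d :: nat and S :: "nat word \<Rightarrow> nat \<Rightarrow> real"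
  assumes d: "d \<ge> 2" and S: "S \<in> words d \<rightarrow> Simp d" and \<epsilon>: "0 < \<epsilon>"
    and emb: "C_embedding 1 \<epsilon> d h" and scal: "has_scaling_function d h S"
  shows "continuous_scaling d S \<and>
    (\<exists>K. \<forall>j\<in>words d. \<forall>j'\<in>words d. vec_dist d (S j) (S j') \<le> K * rho d S j j' powr \<epsilon>)"
proof -
  interpret order_map d h
    using d emb by unfold_locales (auto simp: C_embedding_def cantor_embedding_def)
  have hull: "convex hull (h ` words d) = {0..1}" using emb by (simp add: C_embedding_def cantor_embedding_def)
  have h01: "h \<alpha> \<in> {0..1}" if "\<alpha> \<in> words d" for \<alpha>
    using hull_inc[of "h \<alpha>" "h ` words d" convex] that unfolding hull by blast
  have Slt: "0 < S j k \<and> S j k < 1" if "j \<in> words d" "k \<in> {1..2*d-1}" for j k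
    using S that by (fastforce simp: Simp_def)
  define D where "D js = hi js - lo js" for js
  have D: "0 < D js" if "js \<in> lists {1..d}" for js using lo_less_hi[OF that] by (simp add: D_def)
  have D0: "D [] = 1"
  proof -
    have "h ` words d \<subseteq> {lo []..hi []}" using h_between[of "[]"] by auto
    then have "{0..1} \<subseteq> {lo []..hi []}" unfolding hull[symmetric] by (intro hull_minimal) auto
    moreover have "lo [] \<in> {0..1}" "hi [] \<in> {0..1}"
      using h01 const_words by (auto simp: lo_def hi_def)
    ultimately show ?thesis by (auto simp: D_def)
  qed
  have "\<forall>i\<in>{1..d}. \<exists>F. (\<forall>\<alpha>\<in>words d. F (h \<alpha>) = h (i ## \<alpha>)) \<and>
        (\<exists>L<1. L-lipschitz_on UNIV F) \<and> C_diffeo_onto_image 1 \<epsilon> F"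
    using emb inv_into_f_f[OF h_inj] by (fastforce simp: C_embedding_def shift_branch_def)
  then obtain F where F: "\<And>i \<alpha>. i \<in> {1..d} \<Longrightarrow> \<alpha> \<in> words d \<Longrightarrow> F i (h \<alpha>) = h (i ## \<alpha>)"
    "\<And>i. i \<in> {1..d} \<Longrightarrow> \<exists>L<1. L-lipschitz_on UNIV (F i)"
    "\<And>i. i \<in> {1..d} \<Longrightarrow> C_diffeo_onto_image 1 \<epsilon> (F i)" by metis
  have "\<exists>L<1. \<forall>i\<in>{1..d}. L-lipschitz_on UNIV (F i)"
    using F(2) lipschitz_on_mono by (intro finite_uniform_bound) blast+
  then obtain L0 where L0: "L0 < 1" "\<And>i. i \<in> {1..d} \<Longrightarrow> L0-lipschitz_on UNIV (F i)" by auto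
  \<comment> \<open>The maximum makes L positive, as the ratio in \<open>geometric_drift\<close> has
    to be.\<close>
  define L where "L = max L0 (1/2)"
  have L: "0 < L" "L < 1" using L0 by (auto simp: L_def)
  have LF: "L-lipschitz_on UNIV (F i)" if "i \<in> {1..d}" for i
    using lipschitz_on_mono[OF L0(2)[OF that], of UNIV L] by (auto simp: L_def)
  let ?P = "\<lambda>i H. \<forall>a p q b. 0 \<le> a \<longrightarrow> a \<le> p \<longrightarrow> p < q \<longrightarrow> q \<le> b \<longrightarrow> b \<le> 1 \<longrightarrow>
    \<bar>ln \<bar>(F i q - F i p) / (F i b - F i a)\<bar> - ln \<bar>(q - p) / (b - a)\<bar>\<bar> \<le> H * (b - a) powr \<epsilon>"
  obtain Hs where Hs: "\<And>i. i \<in> {1..d} \<Longrightarrow> Hs i \<ge> 0 \<and> ?P i (Hs i)"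
    using C_diffeo_log_distortion[OF F(3) \<epsilon>] by metis
  define H where "H = (\<Sum>i=1..d. Hs i)"
  have H: "0 \<le> H" "\<And>i. i \<in> {1..d} \<Longrightarrow> Hs i \<le> H"
    unfolding H_def using Hs by (auto intro: sum_nonneg member_le_sum)
  have HP: "?P i H" if "i \<in> {1..d}" for i
    using Hs[OF that] H(2)[OF that] by (meson mult_right_mono order_trans powr_ge_zero)
  let ?fs = "finite_scaling d h"
  \<comment> \<open>Reversal turns the appended letter into the leading one, so the branch acts from
    outside.\<close>
  have app: "h (rev (js @ [i]) \<frown> u) = F i (h (rev js \<frown> u))"
    if "js \<in> lists {1..d}" "i \<in> {1..d}" "u \<in> words d" for js i u
  proof -
    have "rev js \<frown> u \<in> words d" using that by (auto simp: rev_in_lists)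
    then show ?thesis using F(1)[OF that(2)] by simp
  qed
  have step: "\<bar>ln (?fs (js @ [i]) k) - ln (?fs js k)\<bar> \<le> H * D js powr \<epsilon>"
    if js: "js \<in> lists {1..d}" and i: "i \<in> {1..d}" and k: "k \<in> {1..2*d-1}" for js i k
  proof -
    let ?a = "lo js" let ?b = "hi js"
    let ?p = "h (rev js \<frown> piece_lo k)" let ?q = "h (rev js \<frown> piece_hi k)"
    have jsi: "js @ [i] \<in> lists {1..d}" using js i by auto
    have pos: "0 < ?fs (js @ [i]) k" "0 < ?fs js k" using finite_scaling_pos js jsi k by auto
    have e1: "?fs js k = (?q - ?p) / (?b - ?a)" using finite_scaling_eq[OF js k] .
    have e2: "?fs (js @ [i]) k = (F i ?q - F i ?p) / (F i ?b - F i ?a)"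
      unfolding finite_scaling_eq[OF jsi k] unfolding lo_def hi_def
      using app[OF js i] piece_words[OF k] const_words by simp
    have "rev js \<frown> (\<lambda>_. 1) \<in> words d" "rev js \<frown> (\<lambda>_. d) \<in> words d"
      using js const_words by (auto simp: rev_in_lists)
    then have "0 \<le> ?a" "?b \<le> 1" using h01 unfolding lo_def hi_def by auto
    moreover have "?a \<le> ?p" "?p < ?q" "?q \<le> ?b"
      using conc_between[OF js] piece_words[OF k] piece_less[OF js k] by auto
    ultimately have "\<bar>ln \<bar>?fs (js @ [i]) k\<bar> - ln \<bar>?fs js k\<bar>\<bar> \<le> H * D js powr \<epsilon>"
      unfolding e1 e2 D_def using HP[OF i] by blast
    then show ?thesis using pos by simp
  qed
  have contr: "D (js @ [i]) \<le> L * D js" if js: "js \<in> lists {1..d}" and i: "i \<in> {1..d}" for js i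
  proof -
    have "D (js @ [i]) = F i (hi js) - F i (lo js)"
      unfolding D_def lo_def hi_def using app[OF js i] const_words by simp
    also have "\<dots> \<le> \<bar>F i (hi js) - F i (lo js)\<bar>" by simp
    also have "\<dots> \<le> L * \<bar>hi js - lo js\<bar>" using lipschitz_onD[OF LF[OF i]] by (simp add: dist_real_def)
    finally show ?thesis using lo_less_hi[OF js] by (simp add: D_def)
  qed
  have Dpow: "D js \<le> L ^ length js" if "js \<in> lists {1..d}" for js
    using that
  proof (induction js rule: rev_induct)
    case (snoc i js)
    then have "D (js @ [i]) \<le> L * D js" by (intro contr) auto
    also have "\<dots> \<le> L * L ^ length js" using snoc L by (intro mult_left_mono) auto
    finally show ?case by simp
  qed (simp add: D0)
  define C where "C = H / (1 - L powr \<epsilon>)"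
  have C: "0 \<le> C" using H L \<epsilon> powr_less_mono2[of \<epsilon> L 1] by (simp add: C_def)
  \<comment> \<open>Starting the drift at level m bounds the error by the length of the m-th
    cylinder instead of a constant.\<close>
  have lim: "\<bar>ln (S j k) - ln (?fs (prefix m j) k)\<bar> \<le> C * D (prefix m j) powr \<epsilon>"
    if j: "j \<in> words d" and k: "k \<in> {1..2*d-1}" for j m k
  proof -
    define x where "x n = ln (?fs (prefix (m + n) j) k)" for n
    define \<delta> where "\<delta> n = D (prefix (m + n) j)" for n
    have jn: "j n \<in> {1..d}" for n using j by (simp add: words_def)
    have "(\<lambda>n. ?fs (prefix n j) k) \<longlonglongrightarrow> S j k" using scal j k by (simp add: has_scaling_function_def)
    then have "(\<lambda>n. ln (?fs (prefix n j) k)) \<longlonglongrightarrow> ln (S j k)" using Slt[OF j k] by (intro tendsto_ln) auto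
    then have "x \<longlonglongrightarrow> ln (S j k)" unfolding x_def using LIMSEQ_ignore_initial_segment[of _ _ m] by (simp add: add.commute)
    moreover have "\<bar>x (Suc n) - x n\<bar> \<le> H * \<delta> n powr \<epsilon>" for n
      using step[OF prefix_in_lists[OF j] jn k] by (simp add: x_def \<delta>_def)
    moreover have "0 \<le> \<delta> n" for n using D[OF prefix_in_lists[OF j]] by (simp add: \<delta>_def less_imp_le)
    moreover have "\<delta> (Suc n) \<le> L * \<delta> n" for n
      using contr[OF prefix_in_lists[OF j] jn] by (simp add: \<delta>_def)
    ultimately have "\<bar>ln (S j k) - x 0\<bar> \<le> H / (1 - L powr \<epsilon>) * \<delta> 0 powr \<epsilon>"
      using geometric_drift(3)[of x H \<delta> \<epsilon> L] L \<epsilon> H by blast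
    then show ?thesis by (simp add: C_def x_def \<delta>_def)
  qed
  have diff: "\<bar>S j k - S j' k\<bar> \<le> 2 * C * D (prefix n j) powr \<epsilon>"
    if j: "j \<in> words d" "j' \<in> words d" and k: "k \<in> {1..2*d-1}" and n: "prefix n j = prefix n j'" for j j' k n
  proof -
    have "\<bar>S j k - S j' k\<bar> \<le> \<bar>ln (S j k) - ln (S j' k)\<bar>"
      using Slt[OF j(1) k] Slt[OF j(2) k] by (intro abs_diff_le_abs_ln_diff) auto
    then show ?thesis using lim[OF j(1) k, of n] lim[OF j(2) k, of n] n by simp
  qed
  define Lr where "Lr = L powr \<epsilon>"
  have Lr: "0 < Lr" "Lr < 1" using L \<epsilon> powr_less_mono2[of \<epsilon> L 1] by (auto simp: Lr_def)
  have Dr: "D js powr \<epsilon> \<le> Lr ^ length js" if "js \<in> lists {1..d}" for js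
  proof -
    have "D js powr \<epsilon> \<le> (L ^ length js) powr \<epsilon>" using D[OF that] Dpow[OF that] \<epsilon> by (intro powr_mono2) auto
    also have "\<dots> = Lr ^ length js" using L by (simp add: Lr_def powr_powr mult.commute flip: powr_realpow)
    finally show ?thesis .
  qed
  \<comment> \<open>Cylinder lengths decay geometrically and uniformly in the word, so the estimate
    by \<open>D\<close> also yields continuity.\<close>
  have "continuous_scaling d S"
    unfolding continuous_scaling_def
  proof (intro ballI continuous_map_wordsI)
    fix k \<beta> and e :: real assume k: "k \<in> {1..2*d-1}" and \<beta>: "\<beta> \<in> words d" and e: "0 < e"
    have "(\<lambda>n. 2 * C * Lr ^ n) \<longlonglongrightarrow> 2 * C * 0" using Lr by (intro tendsto_intros LIMSEQ_power_zero) auto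
    then obtain n where n: "2 * C * Lr ^ n < e"
      using order_tendstoD(2)[of "\<lambda>n. 2 * C * Lr ^ n" 0 sequentially e] e by (auto simp: eventually_sequentially)
    have "\<bar>S \<alpha> k - S \<beta> k\<bar> < e" if "\<alpha> \<in> words d" "prefix n \<alpha> = prefix n \<beta>" for \<alpha>
    proof -
      have "2 * C * D (prefix n \<alpha>) powr \<epsilon> \<le> 2 * C * Lr ^ n"
        using Dr[OF prefix_in_lists[OF that(1), of n]] C by (intro mult_left_mono) auto
      then show ?thesis using diff[OF that(1) \<beta> k that(2)] n by simp
    qed
    then show "\<exists>n. \<forall>\<alpha>\<in>words d. prefix n \<alpha> = prefix n \<beta> \<longrightarrow> \<bar>S \<alpha> k - S \<beta> k\<bar> < e" by blast
  qed
  moreover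
  define E where "E = exp (C / (1 - Lr))"
  have Dprod: "D js = path_prod ?fs js" if "js \<in> lists {1..d}" for js
    using that by (induction js) (use length_Cons D0 in \<open>auto simp: D_def\<close>)
  \<comment> \<open>By \<open>lim\<close>, each finite scaling differs from \<open>S\<close> at any
    extension \<open>us \<frown> w\<close> by a logarithmic error geometric in the length of
    \<open>us\<close>; the bound therefore holds with one E for every tail w.\<close>
  have Dle: "D js \<le> E * path_prod (\<lambda>us. S (us \<frown> w)) js" if js: "js \<in> lists {1..d}" and w: "w \<in> words d" for js w
    unfolding Dprod[OF js] E_def
  proof (rule path_prod_distortion[where A = "{1..d}"])
    fix us :: "nat list" and k assume us: "us \<in> lists {1..d}" and k: "k \<in> {1..d}"
    then have k': "k \<in> {1..2*d-1}" by auto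
    have usw: "us \<frown> w \<in> words d" using us w by auto
    show "0 < ?fs us k" "0 < S (us \<frown> w) k" using finite_scaling_pos[OF us k'] Slt[OF usw k'] by auto
    have "ln (?fs us k) \<le> ln (S (us \<frown> w) k) + C * D us powr \<epsilon>"
      using lim[OF usw k', of "length us"] by simp
    also have "C * D us powr \<epsilon> \<le> C * Lr ^ length us" using Dr[OF us] C by (intro mult_left_mono)
    finally show "ln (?fs us k) \<le> ln (S (us \<frown> w) k) + C * Lr ^ length us" by simp
  qed (use Lr C js in auto)
  have "vec_dist d (S j) (S j') \<le> (real (2*d-1) * (2 * C * E powr \<epsilon>)) * rho d S j j' powr \<epsilon>"
    if j: "j \<in> words d" "j' \<in> words d" for j j'
  proof (cases "j = j'")
    case True
    then show ?thesis by (simp add: vec_dist_def rho_def L2_set_def)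
  next
    case False
    define n where "n = first_diff j j'"
    define js where "js = prefix n j"
    have js: "js \<in> lists {1..d}" unfolding js_def using j(1) by (rule prefix_in_lists)
    \<comment> \<open>One tail suffices, since \<open>rho\<close> is a supremum over tails;
      \<open>le1\<close> provides its boundedness.\<close>
    let ?w = "\<lambda>_. 1 :: nat"
    let ?f = "\<lambda>w. path_prod (\<lambda>us. S (us \<frown> w)) js"
    have le1: "?f w \<le> 1" if "w \<in> words d" for w
    proof -
      have "0 < S (us \<frown> w) k \<and> S (us \<frown> w) k \<le> 1" if "us \<in> lists {1..d}" "k \<in> {1..d}" for us k
      proof -
        have "k \<in> {1..2*d-1}" using that(2) by auto
        then show ?thesis
          using Slt[of "us \<frown> w" k] words_conc[OF that(1) \<open>w \<in> words d\<close>] by auto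
      qed
      from path_prod_le_power[of "{1..d}" "\<lambda>us. S (us \<frown> w)" 1, OF this js] show ?thesis by simp
    qed
    have "?f ?w \<le> rho d S j j'"
      unfolding rho_eq[OF False] n_def[symmetric] js_def[symmetric]
      using const_words le1 by (intro cSUP_upper bdd_aboveI2[of _ _ 1]) auto
    then have "E * ?f ?w \<le> E * rho d S j j'" by (simp add: E_def)
    then have "D js \<le> E * rho d S j j'" using Dle[OF js const_words(1)] by linarith
    then have "D js powr \<epsilon> \<le> (E * rho d S j j') powr \<epsilon>" using D[OF js] \<epsilon> by (intro powr_mono2) auto
    also have "\<dots> = E powr \<epsilon> * rho d S j j' powr \<epsilon>"
    proof -
      have "0 < E * rho d S j j'" using \<open>D js \<le> _\<close> D[OF js] by linarith
      then show ?thesis by (simp add: powr_mult E_def zero_less_mult_iff)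
    qed
    finally have DR: "D js powr \<epsilon> \<le> E powr \<epsilon> * rho d S j j' powr \<epsilon>" .
    have "vec_dist d (S j) (S j') \<le> (\<Sum>k\<in>{1..2*d-1}. \<bar>S j k - S j' k\<bar>)"
      unfolding vec_dist_def by (rule L2_set_le_sum_abs)
    also have "\<dots> \<le> (\<Sum>k\<in>{1..2*d-1}. 2 * C * (E powr \<epsilon> * rho d S j j' powr \<epsilon>))"
    proof (rule sum_mono)
      fix k assume k: "k \<in> {1..2*d-1}"
      have "\<bar>S j k - S j' k\<bar> \<le> 2 * C * D js powr \<epsilon>"
        unfolding js_def using first_diff_prefix[of j j'] by (intro diff[OF j k]) (simp add: n_def)
      also have "\<dots> \<le> 2 * C * (E powr \<epsilon> * rho d S j j' powr \<epsilon>)" using DR C by (intro mult_left_mono) auto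
      finally show "\<bar>S j k - S j' k\<bar> \<le> 2 * C * (E powr \<epsilon> * rho d S j j' powr \<epsilon>)" .
    qed
    also have "\<dots> = (real (2*d-1) * (2 * C * E powr \<epsilon>)) * rho d S j j' powr \<epsilon>" by simp
    finally show ?thesis .
  qed
  then have "\<exists>K. \<forall>j\<in>words d. \<forall>j'\<in>words d. vec_dist d (S j) (S j') \<le> K * rho d S j j' powr \<epsilon>" by blast
  ultimately show ?thesis by blast
qed

section \<open>Embeddings from prescribed cylinder lengths\<close>

text \<open>\<open>p js k\<close> is the length of the k-th piece or gap of js. Both
  \<open>contr\<close> and \<open>distort\<close> concern an appended letter, that is, the image
  under a branch; \<open>contr\<close> includes gaps because the branches are interpolated over
  them. \<open>lower\<close> gives both the separation of points by gaps and the geometric decay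
  under refinement.\<close>

locale length_tree =
  fixes d :: nat and p :: "nat list \<Rightarrow> nat \<Rightarrow> real" and len :: "nat list \<Rightarrow> real"
    and \<epsilon> c l C :: real
  assumes d: "2 \<le> d" and \<epsilon>: "0 < \<epsilon>" "\<epsilon> \<le> 1" and c: "0 < c" and l: "l < 1" and C: "0 \<le> C"
    and root: "len [] = 1"
    and sum_pieces: "\<And>js. js \<in> lists {1..d} \<Longrightarrow> (\<Sum>k=1..2*d-1. p js k) = len js"
    and child: "\<And>js k. js \<in> lists {1..d} \<Longrightarrow> k \<in> {1..d} \<Longrightarrow> len (k # js) = p js k"
    and lower: "\<And>js k. js \<in> lists {1..d} \<Longrightarrow> k \<in> {1..2*d-1} \<Longrightarrow> c * len js \<le> p js k"
    and contr: "\<And>js k i. js \<in> lists {1..d} \<Longrightarrow> k \<in> {1..2*d-1} \<Longrightarrow> i \<in> {1..d} \<Longrightarrow>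
        p (js @ [i]) k \<le> l * p js k"
    and distort: "\<And>js k i. js \<in> lists {1..d} \<Longrightarrow> k \<in> {1..2*d-1} \<Longrightarrow> i \<in> {1..d} \<Longrightarrow>
        \<bar>ln (p (js @ [i]) k / len (js @ [i])) - ln (p js k / len js)\<bar> \<le> C * len js powr \<epsilon>"
begin

lemma len_pos: "js \<in> lists {1..d} \<Longrightarrow> 0 < len js"
proof (induction js)
  case (Cons k js)
  then have "c * len js \<le> p js k" by (intro lower) auto
  moreover have "0 < c * len js" using Cons c by simp
  ultimately show ?case using Cons child[of js k] by auto
qed (simp add: root)

lemma p_pos: "js \<in> lists {1..d} \<Longrightarrow> k \<in> {1..2*d-1} \<Longrightarrow> 0 < p js k"
  using lower[of js k] len_pos[of js] c by (meson less_le_trans mult_pos_pos)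

definition \<theta> :: real where "\<theta> = 1 - c"

text \<open>Some other coordinate takes at least \<open>c * len js\<close>, which leaves the
  fraction 1 - c.\<close>

lemma p_le: assumes js: "js \<in> lists {1..d}" and k: "k \<in> {1..2*d-1}" shows "p js k \<le> \<theta> * len js"
proof -
  obtain k' where k': "k' \<in> {1..2*d-1}" "k' \<noteq> k"
    using that[of 1] that[of 2] d by (cases "k = 1") auto
  have "p js k + p js k' = (\<Sum>k\<in>{k,k'}. p js k)" using k' by simp
  also have "\<dots> \<le> (\<Sum>k=1..2*d-1. p js k)"
    using k k' p_pos[OF js] by (intro sum_mono2) (auto intro: less_imp_le)
  finally show ?thesis using lower[OF js k'(1)] sum_pieces[OF js] by (simp add: \<theta>_def left_diff_distrib)
qed

lemma len_child: "js \<in> lists {1..d} \<Longrightarrow> k \<in> {1..d} \<Longrightarrow> len (k # js) \<le> \<theta> * len js"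
  using p_le[of js k] child[of js k] by auto

lemma \<theta>: "0 < \<theta>" "\<theta> < 1"
proof -
  have "0 < p [] 1" "p [] 1 \<le> \<theta> * len []" using p_pos[of "[]" 1] p_le[of "[]" 1] d by auto
  then show "0 < \<theta>" by (simp add: root)
qed (use c in \<open>simp add: \<theta>_def\<close>)

lemma len_power: "js \<in> lists {1..d} \<Longrightarrow> len js \<le> \<theta> ^ length js"
proof (induction js)
  case (Cons k js)
  then have "len (k # js) \<le> \<theta> * len js" by (intro len_child) auto
  also have "\<dots> \<le> \<theta> * \<theta> ^ length js" using Cons \<theta> by (intro mult_left_mono) auto
  finally show ?case by simp
qed (simp add: root)

lemma len_le_1: "js \<in> lists {1..d} \<Longrightarrow> len js \<le> 1"
  using len_power[of js] \<theta> power_le_one[of \<theta> "length js"] by linarith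

text \<open>Position of piece k inside its cylinder: to its left lie the pieces i < k, each followed
  by its gap, which has coordinate d + i.\<close>

definition off :: "nat list \<Rightarrow> nat \<Rightarrow> real" where
  "off js k = (\<Sum>i=1..<k. p js i + p js (d + i))"

primrec left :: "nat list \<Rightarrow> real" where
  "left [] = 0"
| "left (k # js) = left js + off js k"

lemma off_Suc: "1 \<le> k \<Longrightarrow> off js (Suc k) = off js k + p js k + p js (d + k)"
  by (simp add: off_def)

lemma off_mono:
  assumes js: "js \<in> lists {1..d}" and "k \<le> k'" "k' \<le> d"
  shows "off js k \<le> off js k'"
  unfolding off_def
proof (rule sum_mono2)
  fix i assume "i \<in> {1..<k'} - {1..<k}"
  then have "i \<in> {1..2*d-1}" "d + i \<in> {1..2*d-1}" using assms(3) by auto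
  then show "0 \<le> p js i + p js (d + i)" using p_pos[OF js] by (meson add_nonneg_nonneg less_imp_le)
qed (use assms(2) in auto)

lemma off_nonneg: "js \<in> lists {1..d} \<Longrightarrow> k \<le> d \<Longrightarrow> 0 \<le> off js k"
  using off_mono[of js 0 k] by (simp add: off_def)

text \<open>The last piece has no gap behind it: d pieces and d - 1 gaps exhaust the cylinder, so
  both have the same right end.\<close>

lemma off_last: assumes js: "js \<in> lists {1..d}" shows "off js d + len (d # js) = len js"
proof -
  have "{1..2*d-1} = {1..d} \<union> {d+1..d+(d-1)}" using d by auto
  then have "len js = (\<Sum>k=1..d. p js k) + (\<Sum>k=d+1..d+(d-1). p js k)"
    using sum_pieces[OF js] by (simp add: sum.union_disjoint)
  also have "(\<Sum>k=d+1..d+(d-1). p js k) = (\<Sum>k=1..d-1. p js (d + k))"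
    using sum.shift_bounds_cl_nat_ivl[of "p js" 1 d "d-1"] by (simp add: add.commute)
  also have "{1..d-1} = {1..<d}" using d by auto
  also have "(\<Sum>k=1..d. p js k) = (\<Sum>k=1..<d. p js k) + p js d"
    using d by (simp flip: atLeastLessThanSuc_atLeastAtMost)
  finally show ?thesis using child[OF js, of d] d by (simp add: off_def sum.distrib)
qed

lemma off_le:
  assumes js: "js \<in> lists {1..d}" and k: "k \<in> {1..d}"
  shows "off js k + len (k # js) \<le> len js"
proof (cases "k = d")
  case True
  then show ?thesis using off_last[OF js] by simp
next
  case False
  then have "off js (Suc k) \<le> off js d" using k by (intro off_mono[OF js]) auto
  moreover have "0 < p js (d + k)" "0 < len (d # js)" using False k js d by (auto intro!: p_pos len_pos)
  ultimately show ?thesis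
    using off_Suc[of k js] off_last[OF js] child[OF js k] k by simp
qed

text \<open>Strings are reversed as in \<^const>\<open>cyl\<close>: extending a cylinder conses a letter, whereas applying
  the branch \<open>i\<close> appends \<open>i\<close>.\<close>

definition stage :: "nat word \<Rightarrow> nat \<Rightarrow> nat list" where
  "stage \<alpha> n = rev (prefix n \<alpha>)"

lemma stage_simps [simp]: "stage \<alpha> 0 = []" "stage \<alpha> (Suc n) = \<alpha> n # stage \<alpha> n"
  by (simp_all add: stage_def)

lemma stage_in [intro]: "\<alpha> \<in> words d \<Longrightarrow> stage \<alpha> n \<in> lists {1..d}"
  unfolding stage_def rev_in_lists by (rule prefix_in_lists)

lemma letter: "\<alpha> \<in> words d \<Longrightarrow> \<alpha> n \<in> {1..d}"
  by (simp add: words_def)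

lemma length_stage [simp]: "length (stage \<alpha> n) = n"
  by (simp add: stage_def)

lemma stage_build: "stage (i ## \<alpha>) (Suc n) = stage \<alpha> n @ [i]"
  by (induction n) auto

lemma stage_conc: "stage (rev js \<frown> w) (length js) = js"
  by (simp add: stage_def)

section \<open>The limit map on words\<close>

lemma left_stage: "left (stage \<alpha> n) = (\<Sum>m<n. off (stage \<alpha> m) (\<alpha> m))"
  by (induction n) auto

definition h :: "nat word \<Rightarrow> real" where
  "h \<alpha> = (\<Sum>m. off (stage \<alpha> m) (\<alpha> m))"

lemma left_stage_bounds:
  assumes \<alpha>: "\<alpha> \<in> words d" and "n \<le> N"
  shows "left (stage \<alpha> n) \<le> left (stage \<alpha> N)"
    "left (stage \<alpha> N) + len (stage \<alpha> N) \<le> left (stage \<alpha> n) + len (stage \<alpha> n)"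
  using \<open>n \<le> N\<close>
proof (induction N rule: dec_induct)
  case (step N)
  {
    case 1
    show ?case using off_nonneg[OF stage_in[OF \<alpha>], of "\<alpha> N" N] letter[OF \<alpha>, of N] step by simp
  next
    case 2
    show ?case using off_le[OF stage_in[OF \<alpha>] letter[OF \<alpha>, of N], of N] step by simp
  }
qed auto

lemma summable_off: assumes \<alpha>: "\<alpha> \<in> words d" shows "summable (\<lambda>m. off (stage \<alpha> m) (\<alpha> m))"
proof (rule summableI_nonneg_bounded)
  show "0 \<le> off (stage \<alpha> n) (\<alpha> n)" for n
    using letter[OF \<alpha>, of n] by (intro off_nonneg stage_in \<alpha>) auto
  show "(\<Sum>m<n. off (stage \<alpha> m) (\<alpha> m)) \<le> 1" for n
    using left_stage_bounds(2)[OF \<alpha>, of 0 n] len_pos[OF stage_in[OF \<alpha>], of n]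
    by (simp add: root flip: left_stage)
qed

lemma h_limit: "\<alpha> \<in> words d \<Longrightarrow> (\<lambda>n. left (stage \<alpha> n)) \<longlonglongrightarrow> h \<alpha>"
  unfolding h_def left_stage by (intro summable_LIMSEQ summable_off)

lemma h_bounds:
  assumes \<alpha>: "\<alpha> \<in> words d"
  shows "left (stage \<alpha> n) \<le> h \<alpha>" "h \<alpha> \<le> left (stage \<alpha> n) + len (stage \<alpha> n)"
proof -
  show "left (stage \<alpha> n) \<le> h \<alpha>"
    using left_stage_bounds(1)[OF \<alpha>, of n] by (intro LIMSEQ_le_const[OF h_limit[OF \<alpha>]]) auto
  have "left (stage \<alpha> N) \<le> left (stage \<alpha> n) + len (stage \<alpha> n)" if "n \<le> N" for N
    using left_stage_bounds(2)[OF \<alpha> that] len_pos[OF stage_in[OF \<alpha>], of N] by linarith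
  then show "h \<alpha> \<le> left (stage \<alpha> n) + len (stage \<alpha> n)"
    by (intro LIMSEQ_le_const2[OF h_limit[OF \<alpha>]]) auto
qed

lemma len_stage_0: assumes \<alpha>: "\<alpha> \<in> words d" shows "(\<lambda>n. len (stage \<alpha> n)) \<longlonglongrightarrow> 0"
proof (rule tendsto_sandwich[of "\<lambda>_. 0" _ _ "\<lambda>n. \<theta> ^ n"])
  show "\<forall>\<^sub>F n in sequentially. 0 \<le> len (stage \<alpha> n)"
    using len_pos[OF stage_in[OF \<alpha>]] by (auto intro!: always_eventually less_imp_le)
  show "\<forall>\<^sub>F n in sequentially. len (stage \<alpha> n) \<le> \<theta> ^ n"
    using len_power[OF stage_in[OF \<alpha>]] by (auto intro!: always_eventually)
  show "(\<lambda>n. \<theta> ^ n) \<longlonglongrightarrow> 0" using \<theta> by (intro LIMSEQ_power_zero) auto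
qed simp

lemma const_mem: "(\<lambda>_. 1) \<in> words d" "(\<lambda>_. d) \<in> words d"
  using d by auto

text \<open>\<open>off js 1\<close> is an empty sum, so letters 1 leave the left end fixed; dually,
  by \<open>off_last\<close>, letters d leave the right end fixed in \<open>h_right\<close>.\<close>

lemma h_left: assumes js: "js \<in> lists {1..d}" shows "h (rev js \<frown> (\<lambda>_. 1)) = left js"
proof -
  let ?\<alpha> = "rev js \<frown> (\<lambda>_. 1)"
  have \<alpha>: "?\<alpha> \<in> words d" using js const_mem by (auto simp: rev_in_lists)
  have "left (stage ?\<alpha> (length js + m)) = left js" for m
  proof (induction m)
    case (Suc m)
    have "?\<alpha> (length js + m) = 1" by simp
    then show ?case using Suc by (simp add: off_def)
  qed (simp add: stage_conc)
  then have "(\<lambda>m. left (stage ?\<alpha> (m + length js))) \<longlonglongrightarrow> left js" by (simp add: add.commute)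
  then show ?thesis using LIMSEQ_ignore_initial_segment[OF h_limit[OF \<alpha>]] LIMSEQ_unique by blast
qed

lemma h_right: assumes js: "js \<in> lists {1..d}" shows "h (rev js \<frown> (\<lambda>_. d)) = left js + len js"
proof -
  let ?\<alpha> = "rev js \<frown> (\<lambda>_. d)"
  have \<alpha>: "?\<alpha> \<in> words d" using js const_mem by (auto simp: rev_in_lists)
  have "left (stage ?\<alpha> (length js + m)) + len (stage ?\<alpha> (length js + m)) = left js + len js" for m
  proof (induction m)
    case (Suc m)
    have "?\<alpha> (length js + m) = d" by simp
    then show ?case using Suc off_last[OF stage_in[OF \<alpha>], of "length js + m"] by simp
  qed (simp add: stage_conc)
  then have "(\<lambda>m. left (stage ?\<alpha> (m + length js)) + len (stage ?\<alpha> (m + length js))) \<longlonglongrightarrow> left js + len js"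
    by (simp add: add.commute)
  moreover have "(\<lambda>m. left (stage ?\<alpha> (m + length js)) + len (stage ?\<alpha> (m + length js))) \<longlonglongrightarrow> h ?\<alpha> + 0"
    using h_limit[OF \<alpha>] len_stage_0[OF \<alpha>] by (intro tendsto_add LIMSEQ_ignore_initial_segment)
  ultimately show ?thesis using LIMSEQ_unique by fastforce
qed

lemma stage_eq: "prefix n \<alpha> = prefix n \<beta> \<Longrightarrow> stage \<alpha> n = stage \<beta> n"
  by (simp add: stage_def)

text \<open>The gap behind the piece \<open>\<alpha> n\<close> lies between the two points. Together
  with \<open>h_close\<close> this makes their distance comparable with the length of their smallest
  common cylinder.\<close>

lemma h_separated:
  assumes \<alpha>: "\<alpha> \<in> words d" and \<beta>: "\<beta> \<in> words d" and n: "prefix n \<alpha> = prefix n \<beta>" "\<alpha> n < \<beta> n"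
  shows "c * len (stage \<alpha> n) \<le> h \<beta> - h \<alpha>"
proof -
  let ?js = "stage \<alpha> n"
  have js: "?js \<in> lists {1..d}" using \<alpha> by (rule stage_in)
  have k: "\<alpha> n \<in> {1..d}" "\<beta> n \<in> {1..d}" using letter \<alpha> \<beta> by auto
  then have dk: "d + \<alpha> n \<in> {1..2*d-1}" using n by auto
  have "off ?js (Suc (\<alpha> n)) \<le> off ?js (\<beta> n)" using n k by (intro off_mono js) auto
  then have "off ?js (\<alpha> n) + len (\<alpha> n # ?js) + c * len ?js \<le> off ?js (\<beta> n)"
    using off_Suc[of "\<alpha> n" ?js] k child[OF js k(1)] lower[OF js dk] by auto
  moreover have "h \<alpha> \<le> left ?js + off ?js (\<alpha> n) + len (\<alpha> n # ?js)"
    using h_bounds(2)[OF \<alpha>, of "Suc n"] by simp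
  moreover have "left ?js + off ?js (\<beta> n) \<le> h \<beta>"
    using h_bounds(1)[OF \<beta>, of "Suc n"] stage_eq[OF n(1)] by simp
  ultimately show ?thesis by linarith
qed

lemma h_lt:
  assumes "\<alpha> \<in> words d" "\<beta> \<in> words d" "prefix n \<alpha> = prefix n \<beta>" "\<alpha> n < \<beta> n"
  shows "h \<alpha> < h \<beta>"
  using h_separated[OF assms] len_pos[OF stage_in[OF assms(1)], of n] c
  by (smt (verit) mult_pos_pos)

sublocale order_map d h
proof
  fix \<alpha> \<beta> assume *: "\<alpha> \<in> words d" "\<beta> \<in> words d" "\<alpha> \<noteq> \<beta>"
  let ?n = "first_diff \<alpha> \<beta>"
  show "h \<beta> < h \<alpha> \<longleftrightarrow> \<beta> ?n < \<alpha> ?n"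
    using h_lt[OF *(1,2) first_diff_prefix] h_lt[OF *(2,1) first_diff_prefix[symmetric]] first_diff_neq[OF *(3)]
    by (metis less_asym linorder_neqE_nat)
qed (rule d)

lemma lo_eq: "js \<in> lists {1..d} \<Longrightarrow> lo js = left js"
  and hi_eq: "js \<in> lists {1..d} \<Longrightarrow> hi js = left js + len js"
  by (simp_all only: lo_def hi_def h_left h_right)

lemma piece_length:
  assumes js: "js \<in> lists {1..d}" and k: "k \<in> {1..2*d-1}"
  shows "h (rev js \<frown> piece_hi k) - h (rev js \<frown> piece_lo k) = p js k"
proof (cases "k \<le> d")
  case True
  then have k': "k # js \<in> lists {1..d}" "k \<in> {1..d}" using js k by auto
  have "h (rev js \<frown> piece_hi k) = hi (k # js)" "h (rev js \<frown> piece_lo k) = lo (k # js)"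
    using True by (simp_all add: piece_hi_def piece_lo_def hi_def lo_def)
  then show ?thesis using lo_eq[OF k'(1)] hi_eq[OF k'(1)] child[OF js k'(2)] by simp
next
  case False
  define i where "i = k - d"
  have i: "i # js \<in> lists {1..d}" "Suc i # js \<in> lists {1..d}" "i \<in> {1..d}" "k = d + i"
    using False js k by (auto simp: i_def)
  have "h (rev js \<frown> piece_hi k) = lo (Suc i # js)" "h (rev js \<frown> piece_lo k) = hi (i # js)"
    using False by (simp_all add: piece_hi_def piece_lo_def hi_def lo_def i_def)
  then show ?thesis
    using lo_eq[OF i(2)] hi_eq[OF i(1)] child[OF js i(3)] off_Suc[of i js] i by simp
qed

lemma finite_scaling_h:
  assumes js: "js \<in> lists {1..d}" and k: "k \<in> {1..2*d-1}"
  shows "finite_scaling d h js k = p js k / len js"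
  using finite_scaling_eq[OF js k] piece_length[OF js k] lo_eq[OF js] hi_eq[OF js] by simp

lemma h_close:
  assumes \<alpha>: "\<alpha> \<in> words d" and \<beta>: "\<beta> \<in> words d" and n: "prefix n \<alpha> = prefix n \<beta>"
  shows "\<bar>h \<alpha> - h \<beta>\<bar> \<le> len (stage \<alpha> n)"
  using h_bounds[OF \<alpha>, of n] h_bounds[OF \<beta>, of n] stage_eq[OF n] by auto

lemma h_continuous: "continuous_map (words_top d) euclideanreal h"
proof (rule continuous_map_wordsI)
  fix \<beta> and e :: real assume \<beta>: "\<beta> \<in> words d" and "0 < e"
  then obtain n where n: "len (stage \<beta> n) < e"
    using order_tendstoD(2)[OF len_stage_0[OF \<beta>]] by (auto simp: eventually_sequentially)
  have "\<bar>h \<alpha> - h \<beta>\<bar> < e" if "\<alpha> \<in> words d" "prefix n \<alpha> = prefix n \<beta>" for \<alpha>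
    using h_close[OF that(1) \<beta> that(2)] n stage_eq[OF that(2)] by simp
  then show "\<exists>n. \<forall>\<alpha>\<in>words d. prefix n \<alpha> = prefix n \<beta> \<longrightarrow> \<bar>h \<alpha> - h \<beta>\<bar> < e" by blast
qed

lemma h_endpoints: "0 \<in> h ` words d" "1 \<in> h ` words d" "h ` words d \<subseteq> {0..1}"
proof -
  have "h (\<lambda>_. 1) = 0" "h (\<lambda>_. d) = 1" using h_left[of "[]"] h_right[of "[]"] by (auto simp: root)
  then show "0 \<in> h ` words d" "1 \<in> h ` words d" using const_mem by (metis imageI)+
  show "h ` words d \<subseteq> {0..1}" using h_bounds[of _ 0] by (auto simp: root)
qed

lemma compact_range: "compact (h ` words d)"
  using image_compactin[OF _ h_continuous, of "words d"] compact_space_words_top[of d]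
  by (simp add: compact_space_def)

lemma h_embedding: "cantor_embedding d h"
  unfolding cantor_embedding_def
proof (intro conjI ballI impI)
  have "closed_map (words_top d) euclideanreal h"
    using compact_space_words_top h_continuous
    by (intro continuous_imp_closed_map) (auto simp: Hausdorff_space_euclidean)
  then show "embedding_map (words_top d) euclideanreal h"
    using h_continuous h_inj by (intro injective_closed_imp_embedding_map) auto
  show "convex hull (h ` words d) = {0..1}"
  proof
    show "convex hull (h ` words d) \<subseteq> {0..1}" using h_endpoints by (intro hull_minimal) auto
    have "closed_segment 0 1 \<subseteq> convex hull (h ` words d)"
      using h_endpoints by (intro closed_segment_subset_convex_hull) (auto intro: hull_inc)
    then show "{0..1} \<subseteq> convex hull (h ` words d)" by (simp add: closed_segment_eq_real_ivl)
  qed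
qed (use order in auto)

section \<open>Mean slopes of the branches and their limits\<close>

definition ratio :: "nat \<Rightarrow> nat list \<Rightarrow> real" where
  "ratio i js = len (js @ [i]) / len js"

definition C1 :: real where "C1 = C / (1 - \<theta> powr \<epsilon>)"

lemma C1: "0 \<le> C1"
  using C \<theta> \<epsilon> powr_less_mono2[of \<epsilon> \<theta> 1] by (simp add: C1_def)

lemma ratio_bounds:
  assumes js: "js \<in> lists {1..d}" and i: "i \<in> {1..d}"
  shows "0 < ratio i js" "ratio i js \<le> l"
proof -
  have jsi: "js @ [i] \<in> lists {1..d}" using js i by auto
  show "0 < ratio i js" using len_pos[OF js] len_pos[OF jsi] by (simp add: ratio_def)
  have "len (js @ [i]) \<le> l * len js"
    unfolding sum_pieces[OF js, symmetric] sum_pieces[OF jsi, symmetric] sum_distrib_left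
    using contr[OF js _ i] by (intro sum_mono)
  then show "ratio i js \<le> l" using len_pos[OF js] by (simp add: ratio_def divide_le_eq)
qed

lemma l_pos: "0 < l"
  using ratio_bounds[of "[]" 1] d by auto

text \<open>The change of mean slope from js to its child k and the change of the k-th scaling
  coordinate under the branch are the same cross ratio of four lengths. Thus \<open>distort\<close>,
  a statement about branches, controls refinement.\<close>

lemma ln_ratio_Cons:
  assumes js: "js \<in> lists {1..d}" and i: "i \<in> {1..d}" and k: "k \<in> {1..d}"
  shows "\<bar>ln (ratio i (k # js)) - ln (ratio i js)\<bar> \<le> C * len js powr \<epsilon>"
proof -
  have jsi: "js @ [i] \<in> lists {1..d}" using js i by auto
  have k': "k \<in> {1..2*d-1}" using k d by auto
  have pos: "0 < len js" "0 < len (js @ [i])" "0 < p js k" "0 < p (js @ [i]) k"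
    using len_pos js jsi p_pos k' by auto
  have "ratio i (k # js) = p (js @ [i]) k / p js k"
    using child[OF js k] child[OF jsi k] by (simp add: ratio_def)
  then have "ln (ratio i (k # js)) - ln (ratio i js)
      = ln (p (js @ [i]) k / len (js @ [i])) - ln (p js k / len js)"
    using pos by (simp add: ratio_def ln_div)
  then show ?thesis using distort[OF js k' i] by simp
qed

lemma ratio_drift:
  assumes \<alpha>: "\<alpha> \<in> words d" and i: "i \<in> {1..d}"
  shows "\<bar>ln (ratio i (stage \<alpha> (n + m))) - ln (ratio i (stage \<alpha> n))\<bar> \<le> C1 * len (stage \<alpha> n) powr \<epsilon>"
    and "convergent (\<lambda>n. ln (ratio i (stage \<alpha> n)))"
    and "(\<lambda>n. ln (ratio i (stage \<alpha> n))) \<longlonglongrightarrow> y \<Longrightarrow>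
      \<bar>y - ln (ratio i (stage \<alpha> n))\<bar> \<le> C1 * len (stage \<alpha> n) powr \<epsilon>"
proof -
  define x where "x n m = ln (ratio i (stage \<alpha> (n + m)))" for n m
  define \<delta> where "\<delta> n m = len (stage \<alpha> (n + m))" for n m
  have 1: "\<bar>x n (Suc m) - x n m\<bar> \<le> C * \<delta> n m powr \<epsilon>" for n m
    using ln_ratio_Cons[OF stage_in[OF \<alpha>] i letter[OF \<alpha>]] by (simp add: x_def \<delta>_def)
  have 2: "0 \<le> \<delta> n m" for n m using len_pos[OF stage_in[OF \<alpha>]] by (simp add: \<delta>_def less_imp_le)
  have 3: "\<delta> n (Suc m) \<le> \<theta> * \<delta> n m" for n m
    using len_child[OF stage_in[OF \<alpha>] letter[OF \<alpha>]] by (simp add: \<delta>_def)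
  note drift = geometric_drift[of "x n" C "\<delta> n" \<epsilon> \<theta> for n, OF 1 2 3 \<theta> \<epsilon>(1) C, folded C1_def]
  show "\<bar>ln (ratio i (stage \<alpha> (n + m))) - ln (ratio i (stage \<alpha> n))\<bar> \<le> C1 * len (stage \<alpha> n) powr \<epsilon>"
    using drift(1)[of n m] by (simp add: x_def \<delta>_def)
  show "convergent (\<lambda>n. ln (ratio i (stage \<alpha> n)))"
    using drift(2)[of 0] unfolding x_def by simp
  assume "(\<lambda>n. ln (ratio i (stage \<alpha> n))) \<longlonglongrightarrow> y"
  then have "x n \<longlonglongrightarrow> y" unfolding x_def using LIMSEQ_ignore_initial_segment[of _ _ n] by (simp add: add.commute)
  then show "\<bar>y - ln (ratio i (stage \<alpha> n))\<bar> \<le> C1 * len (stage \<alpha> n) powr \<epsilon>"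
    using drift(3)[of n y] by (simp add: x_def \<delta>_def)
qed

text \<open>The derivative of branch i at \<open>h \<alpha>\<close>; as an exponential of a limit of
  logarithms it is positive by construction.\<close>

definition slope :: "nat \<Rightarrow> nat word \<Rightarrow> real" where
  "slope i \<alpha> = exp (lim (\<lambda>n. ln (ratio i (stage \<alpha> n))))"

lemma slope_limit:
  assumes \<alpha>: "\<alpha> \<in> words d" and i: "i \<in> {1..d}"
  shows "(\<lambda>n. ratio i (stage \<alpha> n)) \<longlonglongrightarrow> slope i \<alpha>"
proof -
  have "(\<lambda>n. exp (ln (ratio i (stage \<alpha> n)))) \<longlonglongrightarrow> slope i \<alpha>"
    unfolding slope_def using ratio_drift(2)[OF \<alpha> i] by (intro tendsto_exp) (simp add: convergent_LIMSEQ_iff)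
  then show ?thesis using ratio_bounds(1)[OF stage_in[OF \<alpha>] i] by simp
qed

lemma slope_le: "\<alpha> \<in> words d \<Longrightarrow> i \<in> {1..d} \<Longrightarrow> slope i \<alpha> \<le> l"
  using ratio_bounds(2)[OF stage_in] by (intro LIMSEQ_le_const2[OF slope_limit]) blast+

lemma slope_pos: "0 < slope i \<alpha>"
  by (simp add: slope_def)

lemma slope_close:
  assumes \<alpha>: "\<alpha> \<in> words d" and i: "i \<in> {1..d}"
  shows "\<bar>slope i \<alpha> - ratio i (stage \<alpha> n)\<bar> \<le> C1 * len (stage \<alpha> n) powr \<epsilon>"
proof -
  have "\<bar>slope i \<alpha> - ratio i (stage \<alpha> n)\<bar> \<le> \<bar>ln (slope i \<alpha>) - ln (ratio i (stage \<alpha> n))\<bar>"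
    using slope_pos slope_le[OF \<alpha> i] ratio_bounds[OF stage_in[OF \<alpha>] i, of n] l
    by (intro abs_diff_le_abs_ln_diff) auto
  moreover have "\<bar>ln (slope i \<alpha>) - ln (ratio i (stage \<alpha> n))\<bar> \<le> C1 * len (stage \<alpha> n) powr \<epsilon>"
    using ratio_drift(2)[OF \<alpha> i] by (intro ratio_drift(3)[OF \<alpha> i]) (simp add: slope_def convergent_LIMSEQ_iff)
  ultimately show ?thesis by linarith
qed

text \<open>The mean slope starts at least at c on the root and drifts by at most C1 in logarithm
  along any word; the further factor \<open>exp (- C)\<close> covers the passage from a cylinder to
  one of its pieces or gaps.\<close>

definition c1 :: real where "c1 = c * exp (- C1 - C)"

lemma c1: "0 < c1" using c by (simp add: c1_def)

lemma ratio_ge: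
  assumes \<alpha>: "\<alpha> \<in> words d" and i: "i \<in> {1..d}"
  shows "c * exp (- C1) \<le> ratio i (stage \<alpha> n)"
proof -
  have "ratio i [] = p [] i" using child[of "[]" i] i by (simp add: ratio_def root)
  then have r0: "c \<le> ratio i []" using lower[of "[]" i] i d by (auto simp: root)
  have "ln c \<le> ln (ratio i [])" using r0 c by simp
  moreover have "\<bar>ln (ratio i (stage \<alpha> n)) - ln (ratio i [])\<bar> \<le> C1"
    using ratio_drift(1)[OF \<alpha> i, of 0 n] by (simp add: root)
  ultimately have "ln (c * exp (- C1)) \<le> ln (ratio i (stage \<alpha> n))"
    using c by (simp add: ln_mult)
  then show ?thesis using c ratio_bounds(1)[OF stage_in[OF \<alpha>] i, of n] by simp
qed

lemma c1_le: "c1 \<le> c * exp (- C1)"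
  using c C by (simp add: c1_def)

lemma slope_ge: assumes "\<alpha> \<in> words d" "i \<in> {1..d}" shows "c1 \<le> slope i \<alpha>"
  using ratio_ge[OF assms] c1_le by (intro LIMSEQ_le_const[OF slope_limit[OF assms]]) (meson order_trans)

section \<open>Whitney estimates for the branches\<close>

lemma ln_piece_ratio:
  assumes js: "js \<in> lists {1..d}" and i: "i \<in> {1..d}" and k: "k \<in> {1..2*d-1}"
  shows "\<bar>ln (p (js @ [i]) k / p js k) - ln (ratio i js)\<bar> \<le> C * len js powr \<epsilon>"
proof -
  have jsi: "js @ [i] \<in> lists {1..d}" using js i by auto
  have pos: "0 < len js" "0 < len (js @ [i])" "0 < p js k" "0 < p (js @ [i]) k"
    using len_pos js jsi p_pos k by auto
  then have "ln (p (js @ [i]) k / p js k) - ln (ratio i js)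
      = ln (p (js @ [i]) k / len (js @ [i])) - ln (p js k / len js)"
    by (simp add: ratio_def ln_div)
  then show ?thesis using distort[OF js k i] by simp
qed

lemma piece_ratio_ge:
  assumes \<alpha>: "\<alpha> \<in> words d" and i: "i \<in> {1..d}" and k: "k \<in> {1..2*d-1}"
  shows "c1 * p (stage \<alpha> n) k \<le> p (stage \<alpha> n @ [i]) k"
proof -
  let ?js = "stage \<alpha> n"
  have js: "?js \<in> lists {1..d}" "?js @ [i] \<in> lists {1..d}" using stage_in[OF \<alpha>] i by simp_all
  have pos: "0 < p ?js k" "0 < p (?js @ [i]) k" using p_pos js k by auto
  have "len ?js powr \<epsilon> \<le> 1" using len_le_1[OF js(1)] len_pos[OF js(1)] \<epsilon> by (simp add: powr_le1)
  then have "C * len ?js powr \<epsilon> \<le> C * 1" using C by (intro mult_left_mono)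
  then have "ln (ratio i ?js) - C \<le> ln (p (?js @ [i]) k / p ?js k)"
    using ln_piece_ratio[OF js(1) i k] by linarith
  moreover have "ln (c * exp (- C1)) \<le> ln (ratio i ?js)"
    using ratio_ge[OF \<alpha> i, of n] ratio_bounds(1)[OF js(1) i] c by (subst ln_le_cancel_iff) auto
  ultimately have "ln c1 \<le> ln (p (?js @ [i]) k / p ?js k)"
    using c by (simp add: c1_def ln_mult)
  then have "c1 \<le> p (?js @ [i]) k / p ?js k"
    using c1 pos by (subst (asm) ln_le_cancel_iff) auto
  then show ?thesis using pos by (simp add: le_divide_eq)
qed

definition C2 :: real where "C2 = C1 + C"

text \<open>A branch scales everything inside \<open>stage \<alpha> n\<close> by nearly one factor:
  the drift of the mean slope from level n to level m costs C1, the step from that cylinder to its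
  k-th part costs C.\<close>

lemma piece_ratio_close:
  assumes \<alpha>: "\<alpha> \<in> words d" and i: "i \<in> {1..d}" and k: "k \<in> {1..2*d-1}" and "n \<le> m"
  shows "\<bar>p (stage \<alpha> m @ [i]) k - ratio i (stage \<alpha> n) * p (stage \<alpha> m) k\<bar>
    \<le> C2 * len (stage \<alpha> n) powr \<epsilon> * p (stage \<alpha> m) k"
proof -
  let ?js = "stage \<alpha> m"
  have js: "?js \<in> lists {1..d}" "?js @ [i] \<in> lists {1..d}" using stage_in[OF \<alpha>] i by simp_all
  have pos: "0 < p ?js k" "0 < p (?js @ [i]) k" using p_pos js k by auto
  define r where "r = p (?js @ [i]) k / p ?js k"
  have r: "0 < r" "r \<le> 1" "p (?js @ [i]) k = r * p ?js k"
    using pos contr[OF js(1) k i] l l_pos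
    by (auto simp: r_def divide_le_eq intro: order_trans[OF _ mult_left_le_one_le])
  have "len ?js \<le> len (stage \<alpha> n)"
    using left_stage_bounds[OF \<alpha> \<open>n \<le> m\<close>] by linarith
  then have "C * len ?js powr \<epsilon> \<le> C * len (stage \<alpha> n) powr \<epsilon>"
    using C len_pos[OF js(1)] \<epsilon> by (intro mult_left_mono powr_mono2) auto
  then have "\<bar>ln r - ln (ratio i (stage \<alpha> n))\<bar> \<le> C2 * len (stage \<alpha> n) powr \<epsilon>"
    using ln_piece_ratio[OF js(1) i k] ratio_drift(1)[OF \<alpha> i, of n "m - n"] \<open>n \<le> m\<close>
    by (simp add: r_def C2_def distrib_right)
  moreover have "\<bar>r - ratio i (stage \<alpha> n)\<bar> \<le> \<bar>ln r - ln (ratio i (stage \<alpha> n))\<bar>"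
    using r ratio_bounds[OF stage_in[OF \<alpha>] i, of n] l by (intro abs_diff_le_abs_ln_diff) auto
  ultimately have "\<bar>r - ratio i (stage \<alpha> n)\<bar> * p ?js k \<le> (C2 * len (stage \<alpha> n) powr \<epsilon>) * p ?js k"
    using pos by (intro mult_right_mono) auto
  moreover have "\<bar>p (?js @ [i]) k - ratio i (stage \<alpha> n) * p ?js k\<bar> = \<bar>r - ratio i (stage \<alpha> n)\<bar> * p ?js k"
    unfolding r(3) left_diff_distrib[symmetric] abs_mult using pos by simp
  ultimately show ?thesis by simp
qed

lemma off_ratio_close:
  assumes \<alpha>: "\<alpha> \<in> words d" and i: "i \<in> {1..d}" and k: "k \<in> {1..d}" and nm: "n \<le> m"
  shows "\<bar>off (stage \<alpha> m @ [i]) k - ratio i (stage \<alpha> n) * off (stage \<alpha> m) k\<bar>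
    \<le> C2 * len (stage \<alpha> n) powr \<epsilon> * off (stage \<alpha> m) k"
proof -
  let ?R = "ratio i (stage \<alpha> n)" and ?js = "stage \<alpha> m"
  define u where "u t = p (?js @ [i]) t - ?R * p ?js t" for t
  let ?\<kappa> = "C2 * len (stage \<alpha> n) powr \<epsilon>"
  have "\<bar>u t + u (d + t)\<bar> \<le> ?\<kappa> * (p ?js t + p ?js (d + t))" if "t \<in> {1..<k}" for t
  proof -
    have t: "t \<in> {1..2*d-1}" "d + t \<in> {1..2*d-1}" using k that by auto
    show ?thesis
      using piece_ratio_close[OF \<alpha> i t(1) nm] piece_ratio_close[OF \<alpha> i t(2) nm]
      unfolding u_def distrib_left by linarith
  qed
  then have "(\<Sum>t=1..<k. \<bar>u t + u (d + t)\<bar>) \<le> ?\<kappa> * off ?js k"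
    unfolding off_def sum_distrib_left by (rule sum_mono)
  moreover have "off (?js @ [i]) k - ?R * off ?js k = (\<Sum>t=1..<k. u t + u (d + t))"
    unfolding off_def sum_distrib_left sum_subtractf[symmetric] u_def
    by (rule sum.cong) (simp_all add: distrib_left)
  ultimately show ?thesis using sum_abs[of "\<lambda>t. u t + u (d + t)" "{1..<k}"] by linarith
qed

text \<open>On a cylinder the branch is affine up to a relative error: increments of left ends are
  compared term by term, with errors proportional to the increments, so the errors sum up to a
  multiple of the length.\<close>

lemma branch_ratio_close:
  assumes \<alpha>: "\<alpha> \<in> words d" and i: "i \<in> {1..d}"
  shows "\<bar>(h (i ## \<alpha>) - left (stage \<alpha> n @ [i])) - ratio i (stage \<alpha> n) * (h \<alpha> - left (stage \<alpha> n))\<bar>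
    \<le> C2 * len (stage \<alpha> n) powr (1 + \<epsilon>)"
proof -
  let ?R = "ratio i (stage \<alpha> n)" and ?\<kappa> = "C2 * len (stage \<alpha> n) powr \<epsilon>"
  define a b where "a N = left (stage \<alpha> N)" and "b N = left (stage \<alpha> N @ [i])" for N
  have i\<alpha>: "i ## \<alpha> \<in> words d" using i \<alpha> by auto
  have C2: "0 \<le> C2" using C C1 by (simp add: C2_def)
  have "\<bar>(b N - b n) - ?R * (a N - a n)\<bar> \<le> ?\<kappa> * (a N - a n)" if "n \<le> N" for N
    using that
  proof (induction N rule: dec_induct)
    case (step N)
    have "b (Suc N) = b N + off (stage \<alpha> N @ [i]) (\<alpha> N)" "a (Suc N) = a N + off (stage \<alpha> N) (\<alpha> N)"
      by (simp_all add: a_def b_def)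
    then have "b (Suc N) - b n - ?R * (a (Suc N) - a n) = (b N - b n - ?R * (a N - a n))
        + (off (stage \<alpha> N @ [i]) (\<alpha> N) - ?R * off (stage \<alpha> N) (\<alpha> N))"
      "?\<kappa> * (a (Suc N) - a n) = ?\<kappa> * (a N - a n) + ?\<kappa> * off (stage \<alpha> N) (\<alpha> N)"
      by (simp_all only: right_diff_distrib distrib_left)
    then show ?case using step.IH off_ratio_close[OF \<alpha> i letter[OF \<alpha>, of N] step(1)] by linarith
  qed simp
  moreover have "a \<longlonglongrightarrow> h \<alpha>" using h_limit[OF \<alpha>] unfolding a_def .
  \<comment> \<open>By \<open>stage_build\<close>, \<open>b N\<close> is the left end at level N + 1
    of the word \<open>i ## \<alpha>\<close>, hence the shift by one.\<close>
  moreover have "b \<longlonglongrightarrow> h (i ## \<alpha>)"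
    using h_limit[OF i\<alpha>] unfolding b_def stage_build[symmetric] by (rule LIMSEQ_Suc)
  ultimately have "\<bar>(h (i ## \<alpha>) - b n) - ?R * (h \<alpha> - a n)\<bar> \<le> ?\<kappa> * (h \<alpha> - a n)"
    by (intro tendsto_le[OF sequentially_bot, where f = "\<lambda>N. ?\<kappa> * (a N - a n)" and g = "\<lambda>N. \<bar>(b N - b n) - ?R * (a N - a n)\<bar>"]
      tendsto_intros) (auto simp: eventually_sequentially)
  also have "\<dots> \<le> ?\<kappa> * len (stage \<alpha> n)"
    using h_bounds[OF \<alpha>, of n] C2 by (intro mult_left_mono) (auto simp: a_def)
  also have "\<dots> = C2 * len (stage \<alpha> n) powr (1 + \<epsilon>)"
    using len_pos[OF stage_in[OF \<alpha>], of n] by (simp add: powr_one_plus)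
  finally show ?thesis by (simp add: a_def b_def)
qed

text \<open>All is compared on the smallest common cylinder, whose length is at most the distance
  divided by c. Two errors come from \<open>branch_ratio_close\<close> at the two points, a third
  from replacing the mean slope by the slope at \<alpha>.\<close>

lemma branch_jet:
  assumes \<alpha>: "\<alpha> \<in> words d" and \<beta>: "\<beta> \<in> words d" and i: "i \<in> {1..d}" and less: "h \<alpha> < h \<beta>"
  defines "M \<equiv> 2 * (C1 + C2) / c powr (1 + \<epsilon>)"
  shows "\<bar>slope i \<beta> - slope i \<alpha>\<bar> \<le> M * (h \<beta> - h \<alpha>) powr \<epsilon>"
    "\<bar>h (i ## \<beta>) - h (i ## \<alpha>) - slope i \<alpha> * (h \<beta> - h \<alpha>)\<bar> \<le> M * (h \<beta> - h \<alpha>) powr (1 + \<epsilon>)"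
proof -
  let ?n = "first_diff \<alpha> \<beta>"
  define js where "js = stage \<alpha> ?n"
  define \<Delta> where "\<Delta> = h \<beta> - h \<alpha>"
  have js\<beta>: "stage \<beta> ?n = js" unfolding js_def by (rule stage_eq[OF first_diff_prefix, symmetric])
  have ne: "\<alpha> \<noteq> \<beta>" using less by auto
  have js: "js \<in> lists {1..d}" unfolding js_def using \<alpha> by (rule stage_in)
  have lt: "\<alpha> ?n < \<beta> ?n"
    using h_lt[OF \<beta> \<alpha> first_diff_prefix[of \<alpha> \<beta>, symmetric]] first_diff_neq[OF ne] less by fastforce
  have sep: "c * len js \<le> \<Delta>" unfolding js_def \<Delta>_def by (rule h_separated[OF \<alpha> \<beta> first_diff_prefix lt])
  have cl: "\<bar>\<Delta>\<bar> \<le> len js" using h_close[OF \<beta> \<alpha> first_diff_prefix[of \<alpha> \<beta>, symmetric]] js\<beta> by (simp add: \<Delta>_def)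
  have C12: "0 \<le> C1" "0 \<le> C2" using C C1 by (auto simp: C2_def)
  have lp: "0 < len js" using len_pos[OF js] .
  have le: "len js \<le> \<Delta> / c" using sep c by (simp add: field_simps)
  \<comment> \<open>Positivity of \<theta> means c < 1, so the exponent 1 + \<epsilon> gives the
    smaller denominator and one M serves both estimates.\<close>
  have cc: "c powr (1 + \<epsilon>) \<le> c powr \<epsilon>"
    using c \<theta> by (intro powr_mono') (auto simp: \<theta>_def)
  have e1: "len js powr (1 + \<epsilon>) \<le> \<Delta> powr (1 + \<epsilon>) / c powr (1 + \<epsilon>)"
    using powr_mono2[of "1 + \<epsilon>", OF _ _ le] lp c \<epsilon> sep by (simp add: powr_divide)
  have "len js powr \<epsilon> \<le> \<Delta> powr \<epsilon> / c powr \<epsilon>"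
    using powr_mono2[of \<epsilon>, OF _ _ le] lp c \<epsilon> sep by (simp add: powr_divide)
  also have "\<dots> \<le> \<Delta> powr \<epsilon> / c powr (1 + \<epsilon>)" using cc c by (intro frac_le) auto
  finally have e2: "len js powr \<epsilon> \<le> \<Delta> powr \<epsilon> / c powr (1 + \<epsilon>)" .
  have "\<bar>slope i \<beta> - slope i \<alpha>\<bar> \<le> 2 * C1 * len js powr \<epsilon>"
    using slope_close[OF \<alpha> i, of ?n] slope_close[OF \<beta> i, of ?n] js\<beta> by (simp add: js_def)
  also have "\<dots> \<le> 2 * (C1 + C2) * len js powr \<epsilon>" using C12 by (intro mult_right_mono) auto
  also have "\<dots> \<le> 2 * (C1 + C2) * (\<Delta> powr \<epsilon> / c powr (1 + \<epsilon>))" using C12 e2 by (intro mult_left_mono) auto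
  finally show "\<bar>slope i \<beta> - slope i \<alpha>\<bar> \<le> M * (h \<beta> - h \<alpha>) powr \<epsilon>" by (simp add: M_def \<Delta>_def)
  have 1: "\<bar>(h (i ## \<alpha>) - left (js @ [i])) - ratio i js * (h \<alpha> - left js)\<bar> \<le> C2 * len js powr (1 + \<epsilon>)"
    using branch_ratio_close[OF \<alpha> i, of ?n] by (simp add: js_def)
  have 2: "\<bar>(h (i ## \<beta>) - left (js @ [i])) - ratio i js * (h \<beta> - left js)\<bar> \<le> C2 * len js powr (1 + \<epsilon>)"
    using branch_ratio_close[OF \<beta> i, of ?n] js\<beta> by simp
  have "\<bar>(ratio i js - slope i \<alpha>) * \<Delta>\<bar> \<le> (C1 * len js powr \<epsilon>) * len js"
    unfolding abs_mult using slope_close[OF \<alpha> i, of ?n] cl by (intro mult_mono) (auto simp: js_def abs_minus_commute)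
  also have "\<dots> = C1 * len js powr (1 + \<epsilon>)" using lp by (simp add: powr_one_plus)
  finally have 3: "\<bar>(ratio i js - slope i \<alpha>) * \<Delta>\<bar> \<le> C1 * len js powr (1 + \<epsilon>)" .
  have "h (i ## \<beta>) - h (i ## \<alpha>) - slope i \<alpha> * \<Delta> =
    ((h (i ## \<beta>) - left (js @ [i])) - ratio i js * (h \<beta> - left js))
    - ((h (i ## \<alpha>) - left (js @ [i])) - ratio i js * (h \<alpha> - left js)) + (ratio i js - slope i \<alpha>) * \<Delta>"
    by (simp add: \<Delta>_def algebra_simps)
  then have "\<bar>h (i ## \<beta>) - h (i ## \<alpha>) - slope i \<alpha> * \<Delta>\<bar> \<le> (C1 + 2 * C2) * len js powr (1 + \<epsilon>)"
    using 1 2 3 by (simp add: distrib_right)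
  also have "\<dots> \<le> 2 * (C1 + C2) * len js powr (1 + \<epsilon>)" using C12 by (intro mult_right_mono) auto
  also have "\<dots> \<le> 2 * (C1 + C2) * (\<Delta> powr (1 + \<epsilon>) / c powr (1 + \<epsilon>))" using C12 e1 by (intro mult_left_mono) auto
  finally show "\<bar>h (i ## \<beta>) - h (i ## \<alpha>) - slope i \<alpha> * (h \<beta> - h \<alpha>)\<bar> \<le> M * (h \<beta> - h \<alpha>) powr (1 + \<epsilon>)"
    by (simp add: M_def \<Delta>_def)
qed

text \<open>A complementary interval must be a gap of the construction, with the right end of a
  piece k and the left end of piece k + 1 as endpoints. By injectivity this fixes both words, and
  the branch maps the gap to the corresponding gap of \<open>js @ [i]\<close>.\<close>

lemma gap_slope:
  assumes \<alpha>: "\<alpha> \<in> words d" and \<beta>: "\<beta> \<in> words d" and i: "i \<in> {1..d}" and less: "h \<alpha> < h \<beta>"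
    and gap: "{h \<alpha><..<h \<beta>} \<inter> h ` words d = {}"
  shows "c1 * (h \<beta> - h \<alpha>) \<le> h (i ## \<beta>) - h (i ## \<alpha>)"
    "h (i ## \<beta>) - h (i ## \<alpha>) \<le> l * (h \<beta> - h \<alpha>)"
proof -
  let ?n = "first_diff \<alpha> \<beta>"
  define js where "js = stage \<alpha> ?n"
  define k where "k = \<alpha> ?n"
  have js\<beta>: "stage \<beta> ?n = js" unfolding js_def by (rule stage_eq[OF first_diff_prefix, symmetric])
  have ne: "\<alpha> \<noteq> \<beta>" using less by auto
  have js: "js \<in> lists {1..d}" unfolding js_def using \<alpha> by (rule stage_in)
  have lt: "k < \<beta> ?n"
    using h_lt[OF \<beta> \<alpha> first_diff_prefix[of \<alpha> \<beta>, symmetric]] first_diff_neq[OF ne] less by (fastforce simp: k_def)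
  have k: "k \<in> {1..d}" "Suc k \<in> {1..d}" "d + k \<in> {1..2*d-1}" "k < d" "\<beta> ?n \<le> d"
    using lt letter[OF \<alpha>, of ?n] letter[OF \<beta>, of ?n] by (auto simp: k_def)
  let ?u = "rev js \<frown> piece_lo (d + k)" and ?v = "rev js \<frown> piece_hi (d + k)"
  have uv: "?u \<in> words d" "?v \<in> words d" using piece_words[OF k(3)] js by (auto simp: rev_in_lists)
  have "\<not> d + k \<le> d" using k by auto
  then have hu: "h ?u = left (k # js) + len (k # js)" and hv: "h ?v = left (Suc k # js)"
    using h_right[of "k # js"] h_left[of "Suc k # js"] js k by (simp_all add: piece_lo_def piece_hi_def)
  have "h \<alpha> \<le> h ?u"
    using h_bounds(2)[OF \<alpha>, of "Suc ?n"] hu by (simp add: js_def k_def)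
  moreover have "h ?u < h ?v" using piece_less[OF js k(3)] .
  moreover have "h ?v \<le> h \<beta>"
    using h_bounds(1)[OF \<beta>, of "Suc ?n"] hv js\<beta> off_mono[OF js, of "Suc k" "\<beta> ?n"] lt k by simp
  ultimately have "h \<alpha> = h ?u" "h \<beta> = h ?v"
    using gap uv by (force simp: disjoint_iff)+
  then have eq: "\<alpha> = ?u" "\<beta> = ?v" using h_inj \<alpha> \<beta> uv by (auto dest: inj_onD)
  have jsi: "js @ [i] \<in> lists {1..d}" using js i by auto
  have "h \<beta> - h \<alpha> = p js (d + k)" using piece_length[OF js k(3)] eq by simp
  moreover have "h (i ## \<beta>) - h (i ## \<alpha>) = p (js @ [i]) (d + k)"
    using piece_length[OF jsi k(3)] eq by simp
  ultimately show "c1 * (h \<beta> - h \<alpha>) \<le> h (i ## \<beta>) - h (i ## \<alpha>)"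
    "h (i ## \<beta>) - h (i ## \<alpha>) \<le> l * (h \<beta> - h \<alpha>)"
    using contr[OF js k(3) i] piece_ratio_ge[OF \<alpha> i k(3), of ?n] by (simp_all add: js_def)
qed

lemma h_C_embedding: "C_embedding 1 \<epsilon> d h"
  unfolding C_embedding_def
proof (intro conjI ballI h_embedding)
  fix i assume i: "i \<in> {1..d}"
  define M where "M = 2 * (C1 + C2) / c powr (1 + \<epsilon>)"
  have M: "0 \<le> M" using C C1 by (simp add: M_def C2_def)
  let ?\<phi> = "shift_branch d h i" and ?g = "\<lambda>x. slope i (inv_into (words d) h x)"
  have \<phi>: "?\<phi> (h \<alpha>) = h (i ## \<alpha>)" and g: "?g (h \<alpha>) = slope i \<alpha>" if "\<alpha> \<in> words d" for \<alpha>
    using inv_into_f_f[OF h_inj that] by (simp_all add: shift_branch_def)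
  show "\<exists>F. (\<forall>x\<in>h ` words d. F x = ?\<phi> x) \<and> (\<exists>L<1. L-lipschitz_on UNIV F) \<and> C_diffeo_onto_image 1 \<epsilon> F"
  proof (rule whitney_extension_diffeo)
    show "closed (h ` words d)" using compact_range by (rule compact_imp_closed)
    show "0 \<in> h ` words d" "1 \<in> h ` words d" "h ` words d \<subseteq> {0..1}" by (fact h_endpoints)+
    show "0 < \<epsilon>" "\<epsilon> \<le> 1" "0 < c1" "l < 1" "0 \<le> M" using \<epsilon> c1 l M by auto
    show "jet_close \<epsilon> M ?\<phi> ?g x y" if "x \<in> h ` words d" "y \<in> h ` words d" "x \<le> y" for x y
    proof (cases "x = y")
      case False
      obtain \<alpha> \<beta> where *: "\<alpha> \<in> words d" "\<beta> \<in> words d" "x = h \<alpha>" "y = h \<beta>" using \<open>x \<in> _\<close> \<open>y \<in> _\<close> by blast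
      then have "h \<alpha> < h \<beta>" using False \<open>x \<le> y\<close> by simp
      then show ?thesis
        using branch_jet[OF *(1,2) i, folded M_def] * by (simp add: jet_close_def \<phi> g)
    qed (simp add: jet_close_refl)
    show "?g x \<in> {c1..l}" if "x \<in> h ` words d" for x
      using that slope_le[OF _ i] slope_ge[OF _ i] by (auto simp: g)
    show "c1 * (b - a) \<le> ?\<phi> b - ?\<phi> a \<and> ?\<phi> b - ?\<phi> a \<le> l * (b - a)"
      if "a \<in> h ` words d" "b \<in> h ` words d" "a < b" "{a<..<b} \<inter> h ` words d = {}" for a b
      using that gap_slope[OF _ _ i] by (auto simp: \<phi>)
  qed
qed

end

section \<open>Adapted lengths for a Hoelder scaling function\<close>

definition strings :: "nat \<Rightarrow> nat \<Rightarrow> nat list set" where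
  "strings d m = {vs \<in> lists {1..d}. length vs = m}"

lemma strings_0 [simp]: "strings d 0 = {[]}"
  by (auto simp: strings_def)

lemma sum_strings_Suc:
  "(\<Sum>vs\<in>strings d (Suc m). f vs) = (\<Sum>k=1..d. \<Sum>vs\<in>strings d m. f (k # vs))"
proof -
  have "(\<Sum>k=1..d. \<Sum>vs\<in>strings d m. f (k # vs)) = (\<Sum>(k, vs)\<in>{1..d} \<times> strings d m. f (k # vs))"
    by (simp add: sum.cartesian_product)
  also have "\<dots> = (\<Sum>vs\<in>strings d (Suc m). f vs)"
  proof (rule sum.reindex_bij_witness[of _ "\<lambda>vs. (hd vs, tl vs)" "\<lambda>(k, vs). k # vs"])
    fix vs assume vs: "vs \<in> strings d (Suc m)"
    then obtain k us where "vs = k # us" by (cases vs) (auto simp: strings_def)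
    with vs show "(hd vs, tl vs) \<in> {1..d} \<times> strings d m" "(case (hd vs, tl vs) of (k, vs) \<Rightarrow> k # vs) = vs"
      by (auto simp: strings_def)
  qed (auto simp: strings_def)
  finally show ?thesis by simp
qed

text \<open>The strings \<open>js @ vs\<close> are the images of the cylinder js under all
  compositions of m branches. The average is monotone and linear in f, so inequalities between
  lengths pass to it.\<close>

definition weighted_avg :: "nat \<Rightarrow> real \<Rightarrow> nat \<Rightarrow> (nat list \<Rightarrow> real) \<Rightarrow> nat list \<Rightarrow> real" where
  "weighted_avg d l N f js = (\<Sum>m<N. (1 / l) ^ m * (\<Sum>vs\<in>strings d m. f (js @ vs)))"

lemma weighted_avg_mono:
  assumes "0 < l" "js \<in> lists {1..d}" "\<And>vs. vs \<in> lists {1..d} \<Longrightarrow> f (js @ vs) \<le> g (js @ vs)"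
  shows "weighted_avg d l N f js \<le> weighted_avg d l N g js"
  unfolding weighted_avg_def using assms
  by (intro sum_mono mult_left_mono) (auto simp: strings_def)

lemma weighted_avg_mult: "weighted_avg d l N (\<lambda>us. c * f us) js = c * weighted_avg d l N f js"
  by (simp add: weighted_avg_def sum_distrib_left mult_ac)

lemma weighted_avg_sum:
  "weighted_avg d l N (\<lambda>us. \<Sum>k\<in>A. f k us) js = (\<Sum>k\<in>A. weighted_avg d l N (f k) js)"
proof -
  have "weighted_avg d l N (\<lambda>us. \<Sum>k\<in>A. f k us) js =
      (\<Sum>m<N. \<Sum>k\<in>A. (1 / l) ^ m * (\<Sum>vs\<in>strings d m. f k (js @ vs)))"
    unfolding weighted_avg_def by (subst sum.swap[of _ A]) (simp add: sum_distrib_left)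
  also have "\<dots> = (\<Sum>k\<in>A. weighted_avg d l N (f k) js)"
    unfolding weighted_avg_def by (rule sum.swap)
  finally show ?thesis .
qed

lemma weighted_avg_ge:
  assumes "0 < l" "\<And>vs. vs \<in> lists {1..d} \<Longrightarrow> 0 \<le> f (js @ vs)" "0 < N"
  shows "f js \<le> weighted_avg d l N f js"
proof -
  have "(\<Sum>m\<in>{0}. (1 / l) ^ m * (\<Sum>vs\<in>strings d m. f (js @ vs))) \<le> weighted_avg d l N f js"
    unfolding weighted_avg_def using assms
    by (intro sum_mono2) (auto intro!: mult_nonneg_nonneg sum_nonneg simp: strings_def)
  then show ?thesis by simp
qed

text \<open>Appending \<open>i\<close> shifts the sum by one level; the condition \<open>top\<close> says that the level \<open>N\<close> thereby
  gained weighs less than the level \<open>0\<close> lost.\<close>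

lemma weighted_avg_append:
  assumes l: "0 < l" and i: "i \<in> {1..d}" and nonneg: "\<And>vs. vs \<in> lists {1..d} \<Longrightarrow> 0 \<le> f (js @ vs)"
    and top: "(1 / l) ^ N * (\<Sum>vs\<in>strings d N. f (js @ vs)) \<le> f js"
  shows "weighted_avg d l N f (js @ [i]) \<le> l * weighted_avg d l N f js"
proof -
  define T where "T m = (1 / l) ^ m * (\<Sum>vs\<in>strings d m. f (js @ vs))" for m
  have "weighted_avg d l N f (js @ [i]) = (\<Sum>m<N. (1 / l) ^ m * (\<Sum>vs\<in>strings d m. f (js @ i # vs)))"
    by (simp add: weighted_avg_def)
  \<comment> \<open>The strings beginning with i are among all strings of length m + 1, and f is
    nonnegative.\<close>
  also have "\<dots> \<le> (\<Sum>m<N. (1 / l) ^ m * (\<Sum>vs\<in>strings d (Suc m). f (js @ vs)))"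
  proof (intro sum_mono mult_left_mono)
    fix m
    have "(\<Sum>vs\<in>strings d m. f (js @ i # vs)) = (\<Sum>k\<in>{i}. \<Sum>vs\<in>strings d m. f (js @ k # vs))" by simp
    also have "\<dots> \<le> (\<Sum>k=1..d. \<Sum>vs\<in>strings d m. f (js @ k # vs))"
      using i nonneg by (intro sum_mono2 sum_nonneg) (auto simp: strings_def)
    finally show "(\<Sum>vs\<in>strings d m. f (js @ i # vs)) \<le> (\<Sum>vs\<in>strings d (Suc m). f (js @ vs))"
      by (simp add: sum_strings_Suc)
  qed (use l in auto)
  also have "\<dots> = (\<Sum>m<N. l * T (Suc m))"
    using l by (intro sum.cong) (auto simp: T_def)
  also have "\<dots> = l * (\<Sum>m<N. T (Suc m))" by (simp add: sum_distrib_left)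
  also have "(\<Sum>m<N. T (Suc m)) = (\<Sum>m<N. T m) + T N - T 0"
    using sum.lessThan_Suc[of T N] sum.lessThan_Suc_shift[of T N] by simp
  also have "l * \<dots> \<le> l * (\<Sum>m<N. T m)"
    using l top by (intro mult_left_mono) (auto simp: T_def)
  finally show ?thesis by (simp add: weighted_avg_def T_def)
qed

locale holder_scaling =
  fixes d :: nat and S :: "nat word \<Rightarrow> nat \<Rightarrow> real" and \<epsilon> K :: real
  assumes d: "2 \<le> d" and S: "S \<in> words d \<rightarrow> Simp d" and \<epsilon>: "0 < \<epsilon>" "\<epsilon> \<le> 1"
    and cont: "continuous_scaling d S"
    and holder: "\<And>j j'. j \<in> words d \<Longrightarrow> j' \<in> words d \<Longrightarrow> vec_dist d (S j) (S j') \<le> K * rho d S j j' powr \<epsilon>"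
begin

lemma S_pos: "j \<in> words d \<Longrightarrow> k \<in> {1..2*d-1} \<Longrightarrow> 0 < S j k"
  using S by (fastforce simp: Simp_def)

lemma S_sum: "j \<in> words d \<Longrightarrow> (\<Sum>k=1..2*d-1. S j k) = 1"
  using S by (fastforce simp: Simp_def)

text \<open>Positivity becomes uniform by compactness of the word space and continuity; the decay
  rate \<theta> originates here.\<close>

lemma S_lower_bound: "\<exists>c>0. \<forall>j\<in>words d. \<forall>k\<in>{1..2*d-1}. c \<le> S j k"
proof -
  have "\<exists>c>0. \<forall>j\<in>words d. c \<le> S j k" if k: "k \<in> {1..2*d-1}" for k
  proof -
    have "continuous_map (words_top d) euclideanreal (\<lambda>j. S j k)"
      using cont k by (simp add: continuous_scaling_def)
    then have "compactin euclideanreal ((\<lambda>j. S j k) ` words d)"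
      using image_compactin compact_space_words_top[of d] unfolding compact_space_def topspace_words_top by blast
    then have "compact ((\<lambda>j. S j k) ` words d)" by simp
    moreover have "(\<lambda>j. S j k) ` words d \<noteq> {}" using d const_in_words[of 1 d] by auto
    ultimately obtain s where "s \<in> (\<lambda>j. S j k) ` words d" "\<forall>t\<in>(\<lambda>j. S j k) ` words d. s \<le> t"
      using compact_attains_inf by blast
    then show ?thesis using S_pos[OF _ k] by (intro exI[of _ s]) auto
  qed
  then obtain c where c: "\<And>k. k \<in> {1..2*d-1} \<Longrightarrow> 0 < c k \<and> (\<forall>j\<in>words d. c k \<le> S j k)" by metis
  define m where "m = Min (c ` {1..2*d-1})"
  have "m \<in> c ` {1..2*d-1}" unfolding m_def using d by (intro Min_in) auto
  then have "0 < m" using c by auto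
  moreover have "m \<le> c k" if "k \<in> {1..2*d-1}" for k
    unfolding m_def using that by (intro Min_le) auto
  ultimately show ?thesis using c by (intro exI[of _ m]) (meson order_trans)
qed

definition c where "c = (SOME c. c > 0 \<and> (\<forall>j\<in>words d. \<forall>k\<in>{1..2*d-1}. c \<le> S j k))"

lemma c: "0 < c" "\<And>j k. j \<in> words d \<Longrightarrow> k \<in> {1..2*d-1} \<Longrightarrow> c \<le> S j k"
  using someI_ex[OF S_lower_bound] unfolding c_def[symmetric] by auto

definition \<theta> where "\<theta> = 1 - c"

text \<open>With d \<ge> 2 there is a gap, coordinate d + 1, of relative size at least c. Bounding
  all pieces together, rather than one by one, makes the total length of a level decay.\<close>

lemma S_sum_le: assumes j: "j \<in> words d" shows "(\<Sum>k=1..d. S j k) \<le> \<theta>"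
proof -
  have k: "d + 1 \<in> {1..2*d-1}" using d by auto
  have "(\<Sum>k=1..d. S j k) + S j (d + 1) = (\<Sum>k\<in>{1..d+1}. S j k)" by simp
  also have "\<dots> \<le> (\<Sum>k=1..2*d-1. S j k)"
    using S_pos[OF j] d by (intro sum_mono2) (auto intro: less_imp_le)
  finally show ?thesis using S_sum[OF j] c(2)[OF j k] by (simp add: \<theta>_def)
qed

lemma S_le: assumes j: "j \<in> words d" and k: "k \<in> {1..d}" shows "S j k \<le> \<theta>"
proof -
  have "0 \<le> S j k'" if "k' \<in> {1..d}" for k'
  proof -
    have "k' \<in> {1..2*d-1}" using that by auto
    then show ?thesis using S_pos[OF j] by (simp add: less_imp_le)
  qed
  then have "S j k \<le> (\<Sum>k=1..d. S j k)"
    using k by (intro member_le_sum) auto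
  then show ?thesis using S_sum_le[OF j] by simp
qed

lemma letter_index: "k \<in> {1..d} \<Longrightarrow> k \<in> {1..2*d-1}"
  by auto

lemma \<theta>: "0 < \<theta>" "\<theta> < 1"
proof -
  have j: "(\<lambda>_. 1) \<in> words d" using d by auto
  have "0 < S (\<lambda>_. 1) 1" "S (\<lambda>_. 1) 1 \<le> \<theta>" using S_pos[OF j, of 1] S_le[OF j, of 1] d by auto
  then show "0 < \<theta>" by simp
qed (use c in \<open>simp add: \<theta>_def\<close>)

section \<open>Products of scalings with a prescribed tail\<close>

definition plen :: "nat word \<Rightarrow> nat list \<Rightarrow> real" where
  "plen w = path_prod (\<lambda>us. S (us \<frown> w))"

lemma plen_simps [simp]: "plen w [] = 1" "plen w (k # js) = plen w js * S (js \<frown> w) k"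
  by (simp_all add: plen_def)

lemma plen_append: "plen w (js @ vs) = plen (vs \<frown> w) js * plen w vs"
  unfolding plen_def path_prod_append by simp

lemma S_letter:
  assumes "w \<in> words d" "js \<in> lists {1..d}" "k \<in> {1..d}"
  shows "0 < S (js \<frown> w) k \<and> S (js \<frown> w) k \<le> \<theta>"
  using S_pos[OF words_conc letter_index] S_le[OF words_conc] assms by simp

lemma plen_pos: "w \<in> words d \<Longrightarrow> js \<in> lists {1..d} \<Longrightarrow> 0 < plen w js"
  unfolding plen_def by (rule path_prod_pos[of "{1..d}"]) (simp add: S_letter)

lemma plen_le: "w \<in> words d \<Longrightarrow> js \<in> lists {1..d} \<Longrightarrow> plen w js \<le> \<theta> ^ length js"
  unfolding plen_def by (rule path_prod_le_power[of "{1..d}"]) (simp_all add: S_letter)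

lemma plen_le_1: "w \<in> words d \<Longrightarrow> js \<in> lists {1..d} \<Longrightarrow> plen w js \<le> 1"
  using plen_le[of w js] \<theta> power_le_one[of \<theta> "length js"] by linarith

text \<open>\<open>rho\<close> is a supremum of \<open>plen\<close> over tails, and any common
  letters beyond js only decrease it, so a bound B for js alone suffices. The maximum covers a
  negative K.\<close>

lemma S_close:
  assumes js: "js \<in> lists {1..d}" and w: "w \<in> words d" "w' \<in> words d" and k: "k \<in> {1..2*d-1}"
    and B: "\<And>v. v \<in> words d \<Longrightarrow> plen v js \<le> B"
  shows "\<bar>S (js \<frown> w) k - S (js \<frown> w') k\<bar> \<le> max K 0 * B powr \<epsilon>"
proof (cases "js \<frown> w = js \<frown> w'")
  case False
  let ?j = "js \<frown> w" and ?j' = "js \<frown> w'"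
  let ?n = "first_diff ?j ?j'"
  have jw: "?j \<in> words d" "?j' \<in> words d" using js w by auto
  have n: "length js \<le> ?n" using False by (intro first_diff_ge) auto
  \<comment> \<open>The words may agree beyond js; \<open>vs\<close> is the surplus.\<close>
  define vs where "vs = prefix (?n - length js) w"
  have vs: "vs \<in> lists {1..d}" unfolding vs_def using w(1) by (rule prefix_in_lists)
  have pre: "prefix ?n ?j = js @ vs" using n by (simp add: vs_def)
  have ne: "words d \<noteq> {}" using w by auto
  have rho: "rho d S ?j ?j' = (SUP v\<in>words d. plen v (js @ vs))"
    unfolding rho_eq[OF False] pre plen_def ..
  have le: "plen v (js @ vs) \<le> B" if v: "v \<in> words d" for v
  proof -
    have vv: "vs \<frown> v \<in> words d" using vs v by auto
    have "plen v (js @ vs) \<le> plen (vs \<frown> v) js * 1"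
      unfolding plen_append using plen_le_1[OF v vs] plen_pos[OF vv js] by (intro mult_left_mono) auto
    then show ?thesis using B[OF vv] by simp
  qed
  have "rho d S ?j ?j' \<le> B" unfolding rho using le by (intro cSUP_least ne) auto
  moreover have "0 \<le> rho d S ?j ?j'"
  proof -
    have "js @ vs \<in> lists {1..d}" using js vs by simp
    then have "0 < plen w (js @ vs)" using plen_pos w by blast
    also have "\<dots> \<le> rho d S ?j ?j'" unfolding rho
      using w le by (intro cSUP_upper bdd_aboveI2[of _ _ B]) auto
    finally show ?thesis by simp
  qed
  ultimately have r: "rho d S ?j ?j' powr \<epsilon> \<le> B powr \<epsilon>" using \<epsilon> by (intro powr_mono2) auto
  have "\<bar>S ?j k - S ?j' k\<bar> \<le> vec_dist d (S ?j) (S ?j')"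
    unfolding vec_dist_def using member_le_L2_set[of "{1..2*d-1}" k "\<lambda>k. \<bar>S ?j k - S ?j' k\<bar>"] k
    by (simp add: L2_set_def)
  also have "\<dots> \<le> K * rho d S ?j ?j' powr \<epsilon>" using holder jw by blast
  also have "\<dots> \<le> max K 0 * rho d S ?j ?j' powr \<epsilon>" by (intro mult_right_mono) auto
  also have "\<dots> \<le> max K 0 * B powr \<epsilon>" using r by (intro mult_left_mono) auto
  finally show ?thesis .
qed simp

text \<open>The constant of \<open>path_prod_distortion\<close> with q =
  \<open>\<theta> powr \<epsilon>\<close>, where 1 / c converts differences of \<open>S\<close> into
  differences of logarithms.\<close>

definition E where "E = exp (max K 0 / c / (1 - \<theta> powr \<epsilon>))"

lemma E_pos: "0 < E"
  by (simp add: E_def)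

text \<open>A bootstrap: the crude decay of \<open>plen\<close>, valid for every tail, already gives
  \<open>S\<close> a geometric modulus of continuity that is summable along the string.\<close>

lemma plen_distortion:
  assumes js: "js \<in> lists {1..d}" and w: "w \<in> words d" "w' \<in> words d"
  shows "plen w js \<le> E * plen w' js"
  unfolding plen_def E_def
proof (rule path_prod_distortion[where A = "{1..d}"])
  fix us :: "nat list" and k assume us: "us \<in> lists {1..d}" and k: "k \<in> {1..d}"
  show "0 < S (us \<frown> w) k" "0 < S (us \<frown> w') k" using S_letter us k w by auto
  have uw: "us \<frown> w \<in> words d" "us \<frown> w' \<in> words d" using us w by auto
  have "\<bar>S (us \<frown> w) k - S (us \<frown> w') k\<bar> \<le> max K 0 * (\<theta> ^ length us) powr \<epsilon>"
    using plen_le us by (intro S_close us w letter_index k) auto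
  also have "(\<theta> ^ length us) powr \<epsilon> = (\<theta> powr \<epsilon>) ^ length us"
    using \<theta> by (simp add: powr_powr mult.commute flip: powr_realpow)
  finally have *: "\<bar>S (us \<frown> w) k - S (us \<frown> w') k\<bar> \<le> max K 0 * (\<theta> powr \<epsilon>) ^ length us" .
  have "\<bar>ln (S (us \<frown> w) k) - ln (S (us \<frown> w') k)\<bar> \<le> \<bar>S (us \<frown> w) k - S (us \<frown> w') k\<bar> / c"
    using c uw letter_index[OF k] by (intro abs_ln_diff_le) auto
  also have "\<dots> \<le> (max K 0 * (\<theta> powr \<epsilon>) ^ length us) / c"
    using * c by (intro divide_right_mono) auto
  finally show "ln (S (us \<frown> w) k) \<le> ln (S (us \<frown> w') k) + max K 0 / c * (\<theta> powr \<epsilon>) ^ length us" by simp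
next
  show "0 \<le> \<theta> powr \<epsilon>" "\<theta> powr \<epsilon> < 1" "0 \<le> max K 0 / c" "js \<in> lists {1..d}"
    using \<theta> \<epsilon> powr_less_mono2[of \<epsilon> \<theta> 1] c js by auto
qed

definition base :: "nat word" where "base = (\<lambda>_. 1)"

lemma base: "base \<in> words d"
  unfolding base_def using d by auto

text \<open>In the concatenation js merely sees the tail \<open>vs \<frown> base\<close> instead of
  \<open>base\<close>, which costs a factor E.\<close>

lemma plen_append_le:
  assumes js: "js \<in> lists {1..d}" and vs: "vs \<in> lists {1..d}"
  shows "plen base (js @ vs) \<le> E * plen base js * plen base vs"
  unfolding plen_append
  using plen_distortion[OF js words_conc[OF vs base] base] plen_pos[OF base vs]
  by (intro mult_right_mono) auto

text \<open>Prepending a letter multiplies by a coordinate of \<open>S\<close>, and summing over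
  that letter gains \<theta> by \<open>S_sum_le\<close>.\<close>

lemma sum_plen_le: "(\<Sum>vs\<in>strings d m. plen base vs) \<le> \<theta> ^ m"
proof (induction m)
  case (Suc m)
  have "(\<Sum>vs\<in>strings d (Suc m). plen base vs) = (\<Sum>vs\<in>strings d m. plen base vs * (\<Sum>k=1..d. S (vs \<frown> base) k))"
    unfolding sum_strings_Suc by (subst sum.swap) (simp add: sum_distrib_left)
  also have "\<dots> \<le> (\<Sum>vs\<in>strings d m. plen base vs * \<theta>)"
    using S_sum_le[OF words_conc[OF _ base]] plen_pos[OF base]
    by (intro sum_mono mult_left_mono) (auto simp: strings_def intro: less_imp_le)
  also have "\<dots> \<le> \<theta> ^ m * \<theta>"
    unfolding sum_distrib_right[symmetric] using Suc \<theta> by (intro mult_right_mono) auto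
  finally show ?case by (simp add: mult.commute)
qed simp

section \<open>Adapted lengths\<close>

definition l where "l = (1 + \<theta>) / 2"

lemma l: "\<theta> < l" "l < 1" "0 < l"
  using \<theta> by (auto simp: l_def)

text \<open>Makes level N negligible for \<open>weighted_avg_append\<close>: E is the loss in
  \<open>plen_append_le\<close>, 1 / c compares a cylinder with one of its parts,
  \<open>\<theta> ^ N\<close> is the total length of a level, and the weights grow like
  \<open>(1 / l) ^ N\<close>, which \<theta> < l outweighs.\<close>

definition N where "N = (SOME N. E / c * (\<theta> / l) ^ N \<le> 1 \<and> 0 < N)"

lemma N: "E / c * (\<theta> / l) ^ N \<le> 1" "0 < N"
proof -
  have "(\<lambda>N. E / c * (\<theta> / l) ^ N) \<longlonglongrightarrow> E / c * 0"
    using \<theta> l by (intro tendsto_intros LIMSEQ_power_zero) auto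
  then have "\<forall>\<^sub>F N in sequentially. E / c * (\<theta> / l) ^ N < 1"
    by (intro order_tendstoD(2)) auto
  moreover have "\<forall>\<^sub>F N in sequentially. 0 < (N :: nat)" by (rule eventually_gt_at_top)
  ultimately have "\<forall>\<^sub>F N in sequentially. E / c * (\<theta> / l) ^ N \<le> 1 \<and> 0 < N"
    by eventually_elim simp
  then have "\<exists>N. E / c * (\<theta> / l) ^ N \<le> 1 \<and> 0 < N" by (rule eventually_happens'[OF sequentially_bot])
  from someI_ex[OF this] show "E / c * (\<theta> / l) ^ N \<le> 1" "0 < N"
    unfolding N_def[symmetric] by auto
qed

definition piece :: "nat \<Rightarrow> nat list \<Rightarrow> real" where
  "piece k us = plen base us * S (us \<frown> base) k"

definition avg_len :: "nat list \<Rightarrow> real" where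
  "avg_len = weighted_avg d l N (plen base)"

definition avg_piece :: "nat list \<Rightarrow> nat \<Rightarrow> real" where
  "avg_piece js k = weighted_avg d l N (piece k) js"

lemma piece_bounds:
  assumes us: "us \<in> lists {1..d}" and k: "k \<in> {1..2*d-1}"
  shows "c * plen base us \<le> piece k us" "piece k us \<le> plen base us" "0 < piece k us"
proof -
  have uw: "us \<frown> base \<in> words d" using us base by auto
  have "S (us \<frown> base) k \<le> (\<Sum>k=1..2*d-1. S (us \<frown> base) k)"
    using k S_pos[OF uw] by (intro member_le_sum) (auto intro: less_imp_le)
  then have "S (us \<frown> base) k \<le> 1" using S_sum[OF uw] by simp
  then show "c * plen base us \<le> piece k us" "piece k us \<le> plen base us" "0 < piece k us"
    using c(2)[OF uw k] plen_pos[OF base us] S_pos[OF uw k]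
    by (auto simp: piece_def mult.commute mult_left_le)
qed

lemma avg_len_ge: "js \<in> lists {1..d} \<Longrightarrow> plen base js \<le> avg_len js"
  unfolding avg_len_def using l N plen_pos[OF base]
  by (intro weighted_avg_ge) (simp_all add: less_imp_le)

lemma avg_len_pos: "js \<in> lists {1..d} \<Longrightarrow> 0 < avg_len js"
  using avg_len_ge[of js] plen_pos[OF base, of js] by linarith

lemma avg_sum: assumes js: "js \<in> lists {1..d}" shows "(\<Sum>k=1..2*d-1. avg_piece js k) = avg_len js"
proof -
  have "(\<Sum>k=1..2*d-1. piece k (js @ vs)) = plen base (js @ vs)" if "vs \<in> lists {1..d}" for vs
  proof -
    have "(js @ vs) \<frown> base \<in> words d" using js that base by (intro words_conc) auto
    then show ?thesis unfolding piece_def sum_distrib_left[symmetric] by (simp only: S_sum mult_1_right)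
  qed
  then have "weighted_avg d l N (\<lambda>us. \<Sum>k=1..2*d-1. piece k us) js = avg_len js"
    unfolding avg_len_def using l js by (intro antisym weighted_avg_mono) auto
  then show ?thesis by (simp add: avg_piece_def weighted_avg_sum)
qed

text \<open>Refinement conses at the front and averaging appends at the back, so the two commute and
  the averaged lengths again form a tree.\<close>

lemma avg_child: "avg_len (k # js) = avg_piece js k"
  by (simp add: avg_len_def avg_piece_def weighted_avg_def piece_def)

lemma avg_lower:
  assumes "js \<in> lists {1..d}" "k \<in> {1..2*d-1}"
  shows "c * avg_len js \<le> avg_piece js k"
  unfolding avg_len_def avg_piece_def weighted_avg_mult[symmetric]
  using assms l by (intro weighted_avg_mono piece_bounds) auto

lemma avg_contr:
  assumes js: "js \<in> lists {1..d}" and k: "k \<in> {1..2*d-1}" and i: "i \<in> {1..d}"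
  shows "avg_piece (js @ [i]) k \<le> l * avg_piece js k"
  unfolding avg_piece_def
proof (rule weighted_avg_append[OF l(3) i])
  show "0 \<le> piece k (js @ vs)" if "vs \<in> lists {1..d}" for vs
    using piece_bounds(3)[of "js @ vs" k] js k that by (simp add: less_imp_le)
  have p: "0 < piece k js" using piece_bounds(3)[OF js k] .
  have "(\<Sum>vs\<in>strings d N. piece k (js @ vs)) \<le> (\<Sum>vs\<in>strings d N. E / c * piece k js * plen base vs)"
  proof (rule sum_mono)
    fix vs assume "vs \<in> strings d N"
    then have vs: "vs \<in> lists {1..d}" by (simp add: strings_def)
    have "piece k (js @ vs) \<le> plen base (js @ vs)" using piece_bounds(2)[of "js @ vs" k] js k vs by simp
    also have "\<dots> \<le> E * plen base js * plen base vs" by (rule plen_append_le[OF js vs])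
    \<comment> \<open>Contraction is claimed for each part separately, so the whole cylinder js is
      traded for its k-th part at the cost 1 / c.\<close>
    also have "\<dots> \<le> E * (piece k js / c) * plen base vs"
      using piece_bounds(1)[OF js k] c E_pos plen_pos[OF base vs]
      by (intro mult_right_mono mult_left_mono) (auto simp: field_simps)
    finally show "piece k (js @ vs) \<le> E / c * piece k js * plen base vs" by simp
  qed
  also have "\<dots> \<le> E / c * piece k js * \<theta> ^ N"
    unfolding sum_distrib_left[symmetric] using sum_plen_le[of N] E_pos c p by (intro mult_left_mono) auto
  finally have "(1 / l) ^ N * (\<Sum>vs\<in>strings d N. piece k (js @ vs)) \<le> (1 / l) ^ N * (E / c * piece k js * \<theta> ^ N)"
    using l by (intro mult_left_mono) auto
  also have "\<dots> = (E / c * (\<theta> / l) ^ N) * piece k js" by (simp add: power_divide mult_ac)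
  also have "\<dots> \<le> 1 * piece k js" using N p by (intro mult_right_mono) auto
  finally show "(1 / l) ^ N * (\<Sum>vs\<in>strings d N. piece k (js @ vs)) \<le> piece k js" by simp
qed

text \<open>The modulus of \<open>S_close\<close> for B = \<open>E * plen base js\<close>, which
  bounds \<open>plen v js\<close> for every tail v by \<open>plen_distortion\<close>.\<close>

definition err :: "nat list \<Rightarrow> real" where
  "err js = max K 0 * (E * plen base js) powr \<epsilon>"

text \<open>The quotient is a weighted mean of the k-th coordinate of \<open>S\<close> at words that
  all begin with js, so it is as close to \<open>S (js \<frown> w) k\<close> as these values are.
  The string z allows js and \<open>js @ [i]\<close> to be compared with the same value.\<close>

lemma avg_close:
  assumes js: "js \<in> lists {1..d}" and z: "z \<in> lists {1..d}" and w: "w \<in> words d" and k: "k \<in> {1..2*d-1}"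
  shows "\<bar>avg_piece (js @ z) k / avg_len (js @ z) - S (js \<frown> w) k\<bar> \<le> err js"
proof -
  let ?s = "S (js \<frown> w) k"
  have jz: "js @ z \<in> lists {1..d}" using js z by simp
  have *: "(?s - err js) * plen base ((js @ z) @ vs) \<le> piece k ((js @ z) @ vs)
      \<and> piece k ((js @ z) @ vs) \<le> (?s + err js) * plen base ((js @ z) @ vs)" if vs: "vs \<in> lists {1..d}" for vs
  proof -
    have zv: "(z @ vs) \<frown> base \<in> words d" using z vs base by (intro words_conc) auto
    have "\<bar>S (js \<frown> (z @ vs) \<frown> base) k - ?s\<bar> \<le> err js"
      unfolding err_def using plen_distortion[OF js _ base] by (intro S_close js zv w k)
    moreover have "0 < plen base ((js @ z) @ vs)" using js z vs by (intro plen_pos base) auto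
    ultimately show ?thesis by (auto simp: piece_def mult.commute intro!: mult_left_mono)
  qed
  have "(?s - err js) * avg_len (js @ z) \<le> avg_piece (js @ z) k"
    unfolding avg_len_def avg_piece_def weighted_avg_mult[symmetric]
    using * by (intro weighted_avg_mono l jz) blast
  moreover have "avg_piece (js @ z) k \<le> (?s + err js) * avg_len (js @ z)"
    unfolding avg_len_def avg_piece_def weighted_avg_mult[symmetric]
    using * by (intro weighted_avg_mono l jz) blast
  ultimately have "?s - err js \<le> avg_piece (js @ z) k / avg_len (js @ z)"
    "avg_piece (js @ z) k / avg_len (js @ z) \<le> ?s + err js"
    using avg_len_pos[OF jz] by (simp_all add: pos_le_divide_eq pos_divide_le_eq)
  then show ?thesis by linarith
qed

lemma avg_ratio_ge:
  "js \<in> lists {1..d} \<Longrightarrow> k \<in> {1..2*d-1} \<Longrightarrow> c \<le> avg_piece js k / avg_len js"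
  using avg_lower[of js k] avg_len_pos[of js] by (simp add: pos_le_divide_eq)

definition root_len where "root_len = avg_len []"

lemma root_len: "0 < root_len"
  using avg_len_pos[of "[]"] by (simp add: root_len_def)

text \<open>The factor 2 comes from comparing two averaged ratios with one value of
  \<open>S\<close>, 1 / c from passing to logarithms, and \<open>root_len\<close> from normalising
  the total length to 1.\<close>

definition C where "C = 2 * max K 0 * (E * root_len) powr \<epsilon> / c"

lemma avg_distort:
  assumes js: "js \<in> lists {1..d}" and k: "k \<in> {1..2*d-1}" and i: "i \<in> {1..d}"
  shows "\<bar>ln (avg_piece (js @ [i]) k / avg_len (js @ [i])) - ln (avg_piece js k / avg_len js)\<bar>
    \<le> C * (avg_len js / root_len) powr \<epsilon>"
proof -
  have jsi: "js @ [i] \<in> lists {1..d}" "[i] \<in> lists {1..d}" using js i by auto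
  let ?a = "avg_piece (js @ [i]) k / avg_len (js @ [i])" and ?b = "avg_piece js k / avg_len js"
  have "\<bar>ln ?a - ln ?b\<bar> \<le> \<bar>?a - ?b\<bar> / c"
    using avg_ratio_ge[OF js k] avg_ratio_ge[OF jsi(1) k] c by (intro abs_ln_diff_le) auto
  also have "\<bar>?a - ?b\<bar> \<le> 2 * err js"
    using avg_close[OF js jsi(2) base k] avg_close[OF js _ base k, of "[]"] by simp
  \<comment> \<open>The adapted length dominates its level-0 term
    \<open>plen base js\<close>.\<close>
  also have "err js \<le> max K 0 * (E * root_len * (avg_len js / root_len)) powr \<epsilon>"
    unfolding err_def using root_len E_pos \<epsilon> avg_len_ge[OF js] plen_pos[OF base js]
    by (intro mult_left_mono powr_mono2) auto
  also have "\<dots> = max K 0 * ((E * root_len) powr \<epsilon> * (avg_len js / root_len) powr \<epsilon>)"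
    using root_len E_pos avg_len_pos[OF js] by (subst powr_mult) auto
  finally show ?thesis using c by (simp add: C_def divide_right_mono)
qed

lemma tree: "length_tree d (\<lambda>js k. avg_piece js k / root_len) (\<lambda>js. avg_len js / root_len) \<epsilon> c l C"
proof
  show "2 \<le> d" "0 < \<epsilon>" "\<epsilon> \<le> 1" "0 < c" "l < 1" by (fact d \<epsilon> c(1) l(2))+
  show "0 \<le> C" using c by (simp add: C_def)
  show "avg_len [] / root_len = 1" using root_len by (simp add: root_len_def)
  fix js :: "nat list" assume js: "js \<in> lists {1..d}"
  show "(\<Sum>k=1..2*d-1. avg_piece js k / root_len) = avg_len js / root_len"
    using avg_sum[OF js] by (simp add: sum_divide_distrib[symmetric])
  fix k
  show "avg_len (k # js) / root_len = avg_piece js k / root_len" by (simp add: avg_child)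
  assume k: "k \<in> {1..2*d-1}"
  show "c * (avg_len js / root_len) \<le> avg_piece js k / root_len"
    using avg_lower[OF js k] root_len by (simp add: divide_right_mono)
  fix i assume i: "i \<in> {1..d}"
  show "avg_piece (js @ [i]) k / root_len \<le> l * (avg_piece js k / root_len)"
    using avg_contr[OF js k i] root_len by (simp add: divide_right_mono)
  show "\<bar>ln (avg_piece (js @ [i]) k / root_len / (avg_len (js @ [i]) / root_len))
      - ln (avg_piece js k / root_len / (avg_len js / root_len))\<bar> \<le> C * (avg_len js / root_len) powr \<epsilon>"
    using avg_distort[OF js k i] root_len by simp
qed

lemma embedding_exists: "\<exists>h. C_embedding 1 \<epsilon> d h \<and> has_scaling_function d h S"
proof -
  interpret T: length_tree d "\<lambda>js k. avg_piece js k / root_len" "\<lambda>js. avg_len js / root_len" \<epsilon> c l C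
    by (rule tree)
  have "(\<lambda>n. finite_scaling d T.h (prefix n j) k) \<longlonglongrightarrow> S j k"
    if j: "j \<in> words d" and k: "k \<in> {1..2*d-1}" for j k
  proof -
    have pre: "prefix n j \<in> lists {1..d}" for n using j by (rule prefix_in_lists)
    have "\<bar>finite_scaling d T.h (prefix n j) k - S j k\<bar> \<le> max K 0 * (E * \<theta> ^ n) powr \<epsilon>" for n
    proof -
      \<comment> \<open>With this tail \<open>avg_close\<close> compares the n-th finite scaling
        with \<open>S\<close> at j itself.\<close>
      have "suffix n j \<in> words d" using j by (simp add: words_def)
      from avg_close[OF pre _ this k, of "[]" n]
      have "\<bar>finite_scaling d T.h (prefix n j) k - S j k\<bar> \<le> err (prefix n j)"
        using T.finite_scaling_h[OF pre k] root_len by simp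
      also have "\<dots> \<le> max K 0 * (E * \<theta> ^ n) powr \<epsilon>"
        unfolding err_def using plen_le[OF base pre, of n] plen_pos[OF base pre, of n] E_pos \<epsilon>
        by (intro mult_left_mono powr_mono2) auto
      finally show ?thesis .
    qed
    then have bound: "\<forall>\<^sub>F n in sequentially.
        norm (finite_scaling d T.h (prefix n j) k - S j k) \<le> max K 0 * (E * \<theta> ^ n) powr \<epsilon>"
      by (simp only: real_norm_def always_eventually simp_thms)
    have "(\<lambda>n. max K 0 * (E * \<theta> ^ n) powr \<epsilon>) \<longlonglongrightarrow> max K 0 * (E * 0) powr \<epsilon>"
      using \<theta> \<epsilon> E_pos by (intro tendsto_intros tendsto_powr' LIMSEQ_power_zero) auto
    then have "(\<lambda>n. max K 0 * (E * \<theta> ^ n) powr \<epsilon>) \<longlonglongrightarrow> 0" by simp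
    with bound have "(\<lambda>n. finite_scaling d T.h (prefix n j) k - S j k) \<longlonglongrightarrow> 0"
      by (rule Lim_null_comparison)
    then show ?thesis by (simp add: LIM_zero_iff)
  qed
  then have "has_scaling_function d T.h S" by (simp add: has_scaling_function_def)
  then show ?thesis using T.h_C_embedding by blast
qed

end

section \<open>The equivalence\<close>

theorem theorem1:
  fixes d :: nat and S :: "nat word \<Rightarrow> nat \<Rightarrow> real" and \<epsilon> :: real
  assumes "d \<ge> 2"
    and "S \<in> words d \<rightarrow> Simp d"
    and "0 < \<epsilon>" and "\<epsilon> \<le> 1"
  shows "(\<exists>h. C_embedding 1 \<epsilon> d h \<and> has_scaling_function d h S) \<longleftrightarrow>
         (continuous_scaling d S \<and>
          (\<exists>K. \<forall>j\<in>words d. \<forall>j'\<in>words d. vec_dist d (S j) (S j') \<le> K * rho d S j j' powr \<epsilon>))"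
proof
  assume "\<exists>h. C_embedding 1 \<epsilon> d h \<and> has_scaling_function d h S"
  then show "continuous_scaling d S \<and>
      (\<exists>K. \<forall>j\<in>words d. \<forall>j'\<in>words d. vec_dist d (S j) (S j') \<le> K * rho d S j j' powr \<epsilon>)"
    using embedding_imp_holder_scaling assms(1-3) by blast
next
  assume "continuous_scaling d S \<and>
      (\<exists>K. \<forall>j\<in>words d. \<forall>j'\<in>words d. vec_dist d (S j) (S j') \<le> K * rho d S j j' powr \<epsilon>)"
  then obtain K where "continuous_scaling d S"
    "\<forall>j\<in>words d. \<forall>j'\<in>words d. vec_dist d (S j) (S j') \<le> K * rho d S j j' powr \<epsilon>" by blast
  then interpret holder_scaling d S \<epsilon> K
    using assms by unfold_locales auto
  show "\<exists>h. C_embedding 1 \<epsilon> d h \<and> has_scaling_function d h S" by (rule embedding_exists)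
qed

end
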